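(* Let $G$ be a finite group and $\alpha\in Z^3(G,k^* )$ a normalised 3-cocycle. A Lagrangian algebra $L\in\mathcal{Z}(G,\alpha)$ has the form $L(H,\gamma)$, where $H\subset G$ is a subgroup and $\gamma\in C^2(H,k^* )$ satisfies $d(\gamma)=\alpha|_H$.
   Context: $k$ is an algebraically closed field of characteristic zero, $k^*$ its multiplicative group; vector spaces are finite dimensional. Normalised 3-cocycles of $G$ are functions $\alpha:G^3\to k^*$ with $\alpha(g,h,l)\alpha(f,gh,l)\alpha(f,g,h)=\alpha(fg,h,l)\alpha(f,g,hl)$ and $\alpha(f,g,h)=1$ whenever one of $f,g,h$ is the identity $e$. With ${}^{g}h=ghg^{-1}$ put $$\alpha(f,g|h)=\alpha(f,g,h)^{-1}\alpha(f,{}^{g}h,g)\alpha({}^{fg}h,f,g)^{-1},\qquad \alpha(f|g,h)=\alpha(f,g,h)\alpha({}^{f}g,f,h)^{-1}\alpha({}^{f}g,{}^{f}h,f).$$ The braided monoidal category $\mathcal{Z}(G,\alpha)$ (and likewise $\mathcal{Z}(H,\alpha|_H)$): objects are $G$-graded vector spaces $X=\bigoplus_gX_g$ with an $\alpha$-projective $G$-action, i.e. automorphisms $v\mapsto f.v$ with $f.X_g=X_{fgf^{-1}}$ and $(fg).v=\alpha(f,g|h)\,f.(g.v)$ for $v\in X_h$; morphisms preserve grading and action. Tensor product: graded tensor product with $f.(x\otimes y)=\alpha(f|g,h)(f.x\otimes f.y)$ for $x\in X_g,y\in Y_h$; associativity constraint $u\otimes(v\otimes w)\mapsto\alpha(f,g,h)(u\otimes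 v)\otimes w$ for degrees $f,g,h$; unit $k$ in degree $e$; braiding $c_{X,Y}(x\otimes y)=f.y\otimes x$ for $x\in X_f$. "Algebra" means associative unital algebra object; $A$ is commutative if $\mu=\mu\circ c_{A,A}$; indecomposable means not a direct sum of two nonzero algebras. The canonical trace function $\tau:A\to k$ is zero on $A_f$ for $f\neq e$ and equals the trace of $x\mapsto ax$ on $A$ for $a\in A_e$; $A$ is separable if $a\otimes b\mapsto\tau(ab)$ is nondegenerate. Etale means indecomposable, commutative and separable. A right module $(M,\nu)$ over a commutative algebra $A$ is local if $\nu\circ c_{A,M}\circ c_{M,A}=\nu$. A Lagrangian algebra is an etale algebra $L$ such that any local $L$-module is a direct sum of copies of the regular module $L$. $C^2(H,k^* )$: normalised 2-cochains $H\times H\to k^*$; $d(\gamma)(f,g,h)=\gamma(g,h)\gamma(fg,h)^{-1}\gamma(f,gh)\gamma(f,g)^{-1}$. For $d(\gamma)=\alpha|_H$, $k[H,\gamma]$ is the algebra in $\mathcal{Z}(H,\alpha|_H)$ with basis $e_f$, $f\in H$, of degree $f$, multiplication $e_fe_g=\gamma(f,g)e_{fg}$ and $H$-action $h.e_f=\frac{\gamma(h,f)}{\gamma(hfh^{-1},h)}e_{hfh^{-1}}$. For $V\in\mathcal{Z}(H,\alpha|_H)$ (viewed as $G$-graded with zero components outside $H$) let $E(V)=\bigoplus_{f\in G}E(V)_f\in\mathcal{Z}(G,\alpha)$, where $E(V)_f$ is the space of maps $a:G\to V$ with $a(x)\in V_{x^{-1}fx}$ and $a(xh)=\alpha(h^{-1},x^{-1}|f)\,h^{-1}.a(x)$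 for all $x\in G,h\in H$, with $G$-action $(g.a)(x)=\alpha(x^{-1},g|f)^{-1}a(g^{-1}x)$ for $a\in E(V)_f$. If $B$ is an algebra in $\mathcal{Z}(H,\alpha|_H)$, then $E(B)$ is an algebra in $\mathcal{Z}(G,\alpha)$ with $(ab)(x)=\alpha(x^{-1}|f,g)\,a(x)b(x)$ for $a\in E(B)_f,b\in E(B)_g$. Define $L(H,\gamma)=E(k[H,\gamma])$. "Has the form" means "is isomorphic to". *)

theory Defs
  imports
    "HOL-Algebra.Group"
    "HOL-Computational_Algebra.Polynomial"
    "HOL-Library.Function_Algebras"
    "HOL-Library.Product_Plus"
begin

section \<open>Cocycles\<close>

definition cj :: "('g, 'z) monoid_scheme \<Rightarrow> 'g \<Rightarrow> 'g \<Rightarrow> 'g" where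
  "cj G g h = g \<otimes>\<^bsub>G\<^esub> h \<otimes>\<^bsub>G\<^esub> inv\<^bsub>G\<^esub> g"

definition normalised_3cocycle ::
  "('g, 'z) monoid_scheme \<Rightarrow> ('g \<Rightarrow> 'g \<Rightarrow> 'g \<Rightarrow> 'k::field) \<Rightarrow> bool" where
  "normalised_3cocycle G \<alpha> \<longleftrightarrow>
     (\<forall>f\<in>carrier G. \<forall>g\<in>carrier G. \<forall>h\<in>carrier G. \<alpha> f g h \<noteq> 0) \<and>
     (\<forall>f\<in>carrier G. \<forall>g\<in>carrier G. \<forall>h\<in>carrier G. \<forall>l\<in>carrier G.
        \<alpha> g h l * \<alpha> f (g \<otimes>\<^bsub>G\<^esub> h) l * \<alpha> f g h
          = \<alpha> (f \<otimes>\<^bsub>G\<^esub> g) h l * \<alpha> f g (h \<otimes>\<^bsub>G\<^esub> l)) \<and>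
     (\<forall>f\<in>carrier G. \<forall>g\<in>carrier G.
        \<alpha> \<one>\<^bsub>G\<^esub> f g = 1 \<and> \<alpha> f \<one>\<^bsub>G\<^esub> g = 1 \<and> \<alpha> f g \<one>\<^bsub>G\<^esub> = 1)"

definition normalised_2cochain ::
  "('g, 'z) monoid_scheme \<Rightarrow> 'g set \<Rightarrow> ('g \<Rightarrow> 'g \<Rightarrow> 'k::field) \<Rightarrow> bool" where
  "normalised_2cochain G H \<gamma> \<longleftrightarrow>
     (\<forall>f\<in>H. \<forall>g\<in>H. \<gamma> f g \<noteq> 0) \<and>
     (\<forall>f\<in>H. \<gamma> \<one>\<^bsub>G\<^esub> f = 1 \<and> \<gamma> f \<one>\<^bsub>G\<^esub> = 1)"

definition coboundary ::
  "('g, 'z) monoid_scheme \<Rightarrow> ('g \<Rightarrow> 'g \<Rightarrow> 'k::field) \<Rightarrow> 'g \<Rightarrow> 'g \<Rightarrow> 'g \<Rightarrow> 'k" where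
  "coboundary G \<gamma> f g h =
     \<gamma> g h * inverse (\<gamma> (f \<otimes>\<^bsub>G\<^esub> g) h) * \<gamma> f (g \<otimes>\<^bsub>G\<^esub> h) * inverse (\<gamma> f g)"

text \<open>The scalars \<open>\<alpha>(f,g|h)\<close> and \<open>\<alpha>(f|g,h)\<close>.\<close>

definition acoef :: "('g, 'z) monoid_scheme \<Rightarrow> ('g \<Rightarrow> 'g \<Rightarrow> 'g \<Rightarrow> 'k::field) \<Rightarrow> 'g \<Rightarrow> 'g \<Rightarrow> 'g \<Rightarrow> 'k" where
  "acoef G \<alpha> f g h =
     inverse (\<alpha> f g h) * \<alpha> f (cj G g h) g * inverse (\<alpha> (cj G (f \<otimes>\<^bsub>G\<^esub> g) h) f g)"

definition tcoef :: "('g, 'z) monoid_scheme \<Rightarrow> ('g \<Rightarrow> 'g \<Rightarrow> 'g \<Rightarrow> 'k::field) \<Rightarrow> 'g \<Rightarrow> 'g \<Rightarrow> 'g \<Rightarrow> 'k" where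
  "tcoef G \<alpha> f g h =
     \<alpha> f g h * inverse (\<alpha> (cj G f g) f h) * \<alpha> (cj G f g) (cj G f h) f"

section \<open>Linear algebra on subspaces\<close>

definition linear_on ::
  "'v set \<Rightarrow> ('k::field \<Rightarrow> 'v::ab_group_add \<Rightarrow> 'v) \<Rightarrow> ('k \<Rightarrow> 'w::ab_group_add \<Rightarrow> 'w)
     \<Rightarrow> ('v \<Rightarrow> 'w) \<Rightarrow> bool" where
  "linear_on S s t \<phi> \<longleftrightarrow>
     (\<forall>x\<in>S. \<forall>y\<in>S. \<phi> (x + y) = \<phi> x + \<phi> y) \<and> (\<forall>c. \<forall>x\<in>S. \<phi> (s c x) = t c (\<phi> x))"

definition fd_subspace :: "('k::field \<Rightarrow> 'v::ab_group_add \<Rightarrow> 'v) \<Rightarrow> 'v set \<Rightarrow> bool" where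
  "fd_subspace s W \<longleftrightarrow> (\<exists>B. finite B \<and> module.span s B = W)"

text \<open>Trace of a linear endomorphism of a finite dimensional subspace \<open>W\<close>, computed in a basis.\<close>

definition trace_on :: "('k::field \<Rightarrow> 'v::ab_group_add \<Rightarrow> 'v) \<Rightarrow> 'v set \<Rightarrow> ('v \<Rightarrow> 'v) \<Rightarrow> 'k" where
  "trace_on s W \<phi> =
     (let B = (SOME B. \<not> module.dependent s B \<and> module.span s B = W)
      in \<Sum>b\<in>B. module.representation s B (\<phi> b) b)"

section \<open>The category \<open>\<Z>(G,\<alpha>)\<close>\<close>

text \<open>The underlying vector space of an object is the (internal) direct sum of the
  subspaces \<open>grd X g\<close>, \<open>g\<close> in \<open>G\<close>, of an ambient vector space.
  The values of \<open>act X f\<close> matter only on this direct sum.\<close>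

record ('g, 'k, 'v) zobj =
  scal :: "'k \<Rightarrow> 'v \<Rightarrow> 'v"
  grd :: "'g \<Rightarrow> 'v set"
  act :: "'g \<Rightarrow> 'v \<Rightarrow> 'v"

definition total :: "('g, 'z) monoid_scheme \<Rightarrow> ('g \<Rightarrow> 'v::ab_group_add set) \<Rightarrow> 'v set" where
  "total G D = {(\<Sum>g\<in>carrier G. x g) | x. \<forall>g\<in>carrier G. x g \<in> D g}"

abbreviation space :: "('g, 'z) monoid_scheme \<Rightarrow> ('g, 'k, 'v::ab_group_add, 'e) zobj_scheme \<Rightarrow> 'v set" where
  "space G X \<equiv> total G (grd X)"

definition direct :: "('g, 'z) monoid_scheme \<Rightarrow> ('g \<Rightarrow> 'v::ab_group_add set) \<Rightarrow> bool" where
  "direct G D \<longleftrightarrow>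
     (\<forall>x. (\<forall>g\<in>carrier G. x g \<in> D g) \<and> (\<Sum>g\<in>carrier G. x g) = 0 \<longrightarrow> (\<forall>g\<in>carrier G. x g = 0))"

text \<open>\<open>hom_part G D v g\<close> is the component in degree \<open>g\<close> of \<open>v\<close>.\<close>

definition hom_part :: "('g, 'z) monoid_scheme \<Rightarrow> ('g \<Rightarrow> 'v::ab_group_add set) \<Rightarrow> 'v \<Rightarrow> 'g \<Rightarrow> 'v" where
  "hom_part G D v = (SOME x. (\<forall>g\<in>carrier G. x g \<in> D g) \<and> v = (\<Sum>g\<in>carrier G. x g))"

definition zobject ::
  "('g, 'z) monoid_scheme \<Rightarrow> ('g \<Rightarrow> 'g \<Rightarrow> 'g \<Rightarrow> 'k::field)
     \<Rightarrow> ('g, 'k, 'v::ab_group_add, 'e) zobj_scheme \<Rightarrow> bool" where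
  "zobject G \<alpha> X \<longleftrightarrow>
     vector_space (scal X) \<and>
     (\<forall>g\<in>carrier G. fd_subspace (scal X) (grd X g)) \<and>
     direct G (grd X) \<and>
     (\<forall>f\<in>carrier G.
        linear_on (space G X) (scal X) (scal X) (act X f) \<and>
        bij_betw (act X f) (space G X) (space G X) \<and>
        (\<forall>g\<in>carrier G. act X f ` grd X g = grd X (cj G f g))) \<and>
     (\<forall>f\<in>carrier G. \<forall>g\<in>carrier G. \<forall>h\<in>carrier G. \<forall>v\<in>grd X h.
        act X (f \<otimes>\<^bsub>G\<^esub> g) v = scal X (acoef G \<alpha> f g h) (act X f (act X g v)))"

definition zhom ::
  "('g, 'z) monoid_scheme \<Rightarrow> ('g, 'k::field, 'v::ab_group_add, 'e) zobj_scheme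
     \<Rightarrow> ('g, 'k, 'w::ab_group_add, 'd) zobj_scheme \<Rightarrow> ('v \<Rightarrow> 'w) \<Rightarrow> bool" where
  "zhom G X Y \<phi> \<longleftrightarrow>
     linear_on (space G X) (scal X) (scal Y) \<phi> \<and>
     (\<forall>g\<in>carrier G. \<phi> ` grd X g \<subseteq> grd Y g) \<and>
     (\<forall>f\<in>carrier G. \<forall>v\<in>space G X. \<phi> (act X f v) = act Y f (\<phi> v))"

text \<open>Morphisms \<open>X \<otimes> Y \<rightarrow> Z\<close> are given as bilinear maps, via the universal property of the
  tensor product of vector spaces; equalities of such morphisms are stated below on pure
  tensors of homogeneous elements, which span.\<close>

definition tensor_hom ::
  "('g, 'z) monoid_scheme \<Rightarrow> ('g \<Rightarrow> 'g \<Rightarrow> 'g \<Rightarrow> 'k::field)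
     \<Rightarrow> ('g, 'k, 'v::ab_group_add, 'e) zobj_scheme \<Rightarrow> ('g, 'k, 'w::ab_group_add, 'd) zobj_scheme
     \<Rightarrow> ('g, 'k, 'u::ab_group_add, 'c) zobj_scheme \<Rightarrow> ('v \<Rightarrow> 'w \<Rightarrow> 'u) \<Rightarrow> bool" where
  "tensor_hom G \<alpha> X Y Z \<mu> \<longleftrightarrow>
     (\<forall>y\<in>space G Y. linear_on (space G X) (scal X) (scal Z) (\<lambda>x. \<mu> x y)) \<and>
     (\<forall>x\<in>space G X. linear_on (space G Y) (scal Y) (scal Z) (\<mu> x)) \<and>
     (\<forall>g\<in>carrier G. \<forall>h\<in>carrier G. \<forall>x\<in>grd X g. \<forall>y\<in>grd Y h.
        \<mu> x y \<in> grd Z (g \<otimes>\<^bsub>G\<^esub> h) \<and>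
        (\<forall>f\<in>carrier G.
           act Z f (\<mu> x y) = scal Z (tcoef G \<alpha> f g h) (\<mu> (act X f x) (act Y f y))))"

text \<open>The braiding \<open>c\<close> on the pure tensor \<open>x \<otimes> y\<close> with \<open>x\<close> of degree \<open>f\<close> and \<open>y\<close> in \<open>Y\<close>.\<close>

definition braid :: "('g, 'k, 'w, 'd) zobj_scheme \<Rightarrow> 'g \<Rightarrow> 'v \<Rightarrow> 'w \<Rightarrow> 'w \<times> 'v" where
  "braid Y f x y = (act Y f y, x)"

section \<open>Algebras\<close>

record ('g, 'k, 'v) zalg = "('g, 'k, 'v) zobj" +
  amul :: "'v \<Rightarrow> 'v \<Rightarrow> 'v"
  aunit :: "'v"

definition zalgebra ::
  "('g, 'z) monoid_scheme \<Rightarrow> ('g \<Rightarrow> 'g \<Rightarrow> 'g \<Rightarrow> 'k::field)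
     \<Rightarrow> ('g, 'k, 'v::ab_group_add) zalg \<Rightarrow> bool" where
  "zalgebra G \<alpha> A \<longleftrightarrow>
     zobject G \<alpha> A \<and>
     tensor_hom G \<alpha> A A A (amul A) \<and>
     (\<forall>f\<in>carrier G. \<forall>g\<in>carrier G. \<forall>h\<in>carrier G.
        \<forall>a\<in>grd A f. \<forall>b\<in>grd A g. \<forall>c\<in>grd A h.
          amul A a (amul A b c) = scal A (\<alpha> f g h) (amul A (amul A a b) c)) \<and>
     aunit A \<in> grd A \<one>\<^bsub>G\<^esub> \<and>
     (\<forall>f\<in>carrier G. act A f (aunit A) = aunit A) \<and>
     (\<forall>a\<in>space G A. amul A (aunit A) a = a \<and> amul A a (aunit A) = a)"

definition alg_isomorphic ::
  "('g, 'z) monoid_scheme \<Rightarrow> ('g, 'k::field, 'v::ab_group_add) zalg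
     \<Rightarrow> ('g, 'k, 'w::ab_group_add) zalg \<Rightarrow> bool" where
  "alg_isomorphic G A B \<longleftrightarrow>
     (\<exists>\<phi>. zhom G A B \<phi> \<and> bij_betw \<phi> (space G A) (space G B) \<and>
        (\<forall>a\<in>space G A. \<forall>b\<in>space G A. \<phi> (amul A a b) = amul B (\<phi> a) (\<phi> b)) \<and>
        \<phi> (aunit A) = aunit B)"

definition alg_sum ::
  "('g, 'k, 'v) zalg \<Rightarrow> ('g, 'k, 'w) zalg \<Rightarrow> ('g, 'k, 'v \<times> 'w) zalg" where
  "alg_sum B C = \<lparr>
     scal = (\<lambda>c (x, y). (scal B c x, scal C c y)),
     grd = (\<lambda>g. grd B g \<times> grd C g),
     act = (\<lambda>f (x, y). (act B f x, act C f y)),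
     amul = (\<lambda>(x, y) (x', y'). (amul B x x', amul C y y')),
     aunit = (aunit B, aunit C)\<rparr>"

text \<open>The zero algebra does not count as indecomposable. Restricting the summands to the type
  of \<open>A\<close> loses nothing, since summands of \<open>A\<close> embed into \<open>A\<close>.\<close>

definition indecomposable ::
  "('g, 'z) monoid_scheme \<Rightarrow> ('g \<Rightarrow> 'g \<Rightarrow> 'g \<Rightarrow> 'k::field)
     \<Rightarrow> ('g, 'k, 'v::ab_group_add) zalg \<Rightarrow> bool" where
  "indecomposable G \<alpha> A \<longleftrightarrow>
     space G A \<noteq> {0} \<and>
     \<not> (\<exists>(B :: ('g, 'k, 'v) zalg) (C :: ('g, 'k, 'v) zalg).
          zalgebra G \<alpha> B \<and> zalgebra G \<alpha> C \<and> space G B \<noteq> {0} \<and> space G C \<noteq> {0} \<and>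
          alg_isomorphic G A (alg_sum B C))"

definition commutative ::
  "('g, 'z) monoid_scheme \<Rightarrow> ('g, 'k, 'v) zalg \<Rightarrow> bool" where
  "commutative G A \<longleftrightarrow>
     (\<forall>f\<in>carrier G. \<forall>g\<in>carrier G. \<forall>a\<in>grd A f. \<forall>b\<in>grd A g.
        amul A a b = case_prod (amul A) (braid A f a b))"

definition canonical_trace ::
  "('g, 'z) monoid_scheme \<Rightarrow> ('g, 'k::field, 'v::ab_group_add) zalg \<Rightarrow> 'v \<Rightarrow> 'k" where
  "canonical_trace G A a =
     trace_on (scal A) (space G A) (amul A (hom_part G (grd A) a \<one>\<^bsub>G\<^esub>))"

definition separable ::
  "('g, 'z) monoid_scheme \<Rightarrow> ('g, 'k::field, 'v::ab_group_add) zalg \<Rightarrow> bool" where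
  "separable G A \<longleftrightarrow>
     (\<forall>a\<in>space G A. (\<forall>b\<in>space G A. canonical_trace G A (amul A a b) = 0) \<longrightarrow> a = 0) \<and>
     (\<forall>b\<in>space G A. (\<forall>a\<in>space G A. canonical_trace G A (amul A a b) = 0) \<longrightarrow> b = 0)"

definition etale ::
  "('g, 'z) monoid_scheme \<Rightarrow> ('g \<Rightarrow> 'g \<Rightarrow> 'g \<Rightarrow> 'k::field)
     \<Rightarrow> ('g, 'k, 'v::ab_group_add) zalg \<Rightarrow> bool" where
  "etale G \<alpha> A \<longleftrightarrow>
     zalgebra G \<alpha> A \<and> indecomposable G \<alpha> A \<and> commutative G A \<and> separable G A"

section \<open>Modules and Lagrangian algebras\<close>

record ('g, 'k, 'm, 'v) zmod = "('g, 'k, 'm) zobj" +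
  mact :: "'m \<Rightarrow> 'v \<Rightarrow> 'm"

definition right_module ::
  "('g, 'z) monoid_scheme \<Rightarrow> ('g \<Rightarrow> 'g \<Rightarrow> 'g \<Rightarrow> 'k::field)
     \<Rightarrow> ('g, 'k, 'v::ab_group_add) zalg \<Rightarrow> ('g, 'k, 'm::ab_group_add, 'v) zmod \<Rightarrow> bool" where
  "right_module G \<alpha> A M \<longleftrightarrow>
     zobject G \<alpha> M \<and>
     tensor_hom G \<alpha> M A M (mact M) \<and>
     (\<forall>f\<in>carrier G. \<forall>g\<in>carrier G. \<forall>h\<in>carrier G.
        \<forall>m\<in>grd M f. \<forall>a\<in>grd A g. \<forall>b\<in>grd A h.
          mact M m (amul A a b) = scal M (\<alpha> f g h) (mact M (mact M m a) b)) \<and>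
     (\<forall>m\<in>space G M. mact M m (aunit A) = m)"

text \<open>In the second application of the braiding, the left factor has degree \<open>fgf\<^sup>-\<^sup>1\<close>.\<close>

definition local_module ::
  "('g, 'z) monoid_scheme \<Rightarrow> ('g, 'k, 'v) zalg \<Rightarrow> ('g, 'k, 'm, 'v) zmod \<Rightarrow> bool" where
  "local_module G A M \<longleftrightarrow>
     (\<forall>f\<in>carrier G. \<forall>g\<in>carrier G. \<forall>m\<in>grd M f. \<forall>a\<in>grd A g.
        case_prod (mact M) (case_prod (braid M (cj G f g)) (braid A f m a)) = mact M m a)"

definition mod_isomorphic ::
  "('g, 'z) monoid_scheme \<Rightarrow> ('g, 'k::field, 'v::ab_group_add) zalg
     \<Rightarrow> ('g, 'k, 'm::ab_group_add, 'v) zmod \<Rightarrow> ('g, 'k, 'n::ab_group_add, 'v) zmod \<Rightarrow> bool" where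
  "mod_isomorphic G A M N \<longleftrightarrow>
     (\<exists>\<phi>. zhom G M N \<phi> \<and> bij_betw \<phi> (space G M) (space G N) \<and>
        (\<forall>m\<in>space G M. \<forall>a\<in>space G A. \<phi> (mact M m a) = mact N (\<phi> m) a))"

text \<open>The direct sum of \<open>n\<close> copies of the regular right module of \<open>A\<close>; its elements are
  sequences in \<open>A\<close> vanishing from index \<open>n\<close> on.\<close>

definition regular_power ::
  "nat \<Rightarrow> ('g, 'k, 'v::zero) zalg \<Rightarrow> ('g, 'k, nat \<Rightarrow> 'v, 'v) zmod" where
  "regular_power n A = \<lparr>
     scal = (\<lambda>c x i. scal A c (x i)),
     grd = (\<lambda>g. {x. (\<forall>i<n. x i \<in> grd A g) \<and> (\<forall>i\<ge>n. x i = 0)}),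
     act = (\<lambda>f x i. if i < n then act A f (x i) else 0),
     mact = (\<lambda>x a i. if i < n then amul A (x i) a else 0)\<rparr>"

text \<open>Every finite dimensional vector space over \<open>'k\<close> is isomorphic to a subspace of
  \<open>nat \<Rightarrow> 'k\<close>, so quantifying over modules on such subspaces covers all modules.\<close>

definition lagrangian ::
  "('g, 'z) monoid_scheme \<Rightarrow> ('g \<Rightarrow> 'g \<Rightarrow> 'g \<Rightarrow> 'k::field)
     \<Rightarrow> ('g, 'k, 'v::ab_group_add) zalg \<Rightarrow> bool" where
  "lagrangian G \<alpha> L \<longleftrightarrow>
     etale G \<alpha> L \<and>
     (\<forall>M :: ('g, 'k, nat \<Rightarrow> 'k, 'v) zmod.
        right_module G \<alpha> L M \<and> local_module G L M \<longrightarrow>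
          (\<exists>n. mod_isomorphic G L M (regular_power n L)))"

section \<open>The algebras \<open>k[H,\<gamma>]\<close>, \<open>E(B)\<close> and \<open>L(H,\<gamma>)\<close>\<close>

definition bvec :: "'g \<Rightarrow> 'g \<Rightarrow> 'k::zero_neq_one" where
  "bvec f = (\<lambda>x. if x = f then 1 else 0)"

text \<open>The basis vector \<open>e\<^sub>f\<close> is \<open>bvec f\<close>; elements are functions supported in \<open>H\<close>.\<close>

definition twisted_group_algebra ::
  "('g, 'z) monoid_scheme \<Rightarrow> 'g set \<Rightarrow> ('g \<Rightarrow> 'g \<Rightarrow> 'k::field) \<Rightarrow> ('g, 'k, 'g \<Rightarrow> 'k) zalg" where
  "twisted_group_algebra G H \<gamma> = \<lparr>
     scal = (\<lambda>c a x. c * a x),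
     grd = (\<lambda>f. {(\<lambda>x. c * bvec f x) | c. True}),
     act = (\<lambda>h a x. \<Sum>f\<in>H. a f * (\<gamma> h f / \<gamma> (cj G h f) h) * bvec (cj G h f) x),
     amul = (\<lambda>a b x. \<Sum>f\<in>H. \<Sum>g\<in>H. a f * b g * \<gamma> f g * bvec (f \<otimes>\<^bsub>G\<^esub> g) x),
     aunit = bvec \<one>\<^bsub>G\<^esub>\<rparr>"

text \<open>\<open>E(V)\<close> consists of maps \<open>a\<close> on \<open>G\<close>, extended by \<open>0\<close> outside \<open>carrier G\<close>. Its components
  are independent because \<open>a(x)\<close> has degree \<open>x\<^sup>-\<^sup>1fx\<close> for \<open>a\<close> in degree \<open>f\<close>. The operations,
  prescribed on homogeneous maps, are extended (bi)linearly by decomposing into homogeneous parts.\<close>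

definition E_grd ::
  "('g, 'z) monoid_scheme \<Rightarrow> ('g \<Rightarrow> 'g \<Rightarrow> 'g \<Rightarrow> 'k::field) \<Rightarrow> 'g set
     \<Rightarrow> ('g, 'k, 'v::ab_group_add, 'e) zobj_scheme \<Rightarrow> 'g \<Rightarrow> ('g \<Rightarrow> 'v) set" where
  "E_grd G \<alpha> H V f = {a.
     (\<forall>x\<in>carrier G. a x \<in>
        (if inv\<^bsub>G\<^esub> x \<otimes>\<^bsub>G\<^esub> f \<otimes>\<^bsub>G\<^esub> x \<in> H then grd V (inv\<^bsub>G\<^esub> x \<otimes>\<^bsub>G\<^esub> f \<otimes>\<^bsub>G\<^esub> x) else {0})) \<and>
     (\<forall>x\<in>carrier G. \<forall>h\<in>H.
        a (x \<otimes>\<^bsub>G\<^esub> h) = scal V (acoef G \<alpha> (inv\<^bsub>G\<^esub> h) (inv\<^bsub>G\<^esub> x) f) (act V (inv\<^bsub>G\<^esub> h) (a x))) \<and>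
     (\<forall>x. x \<notin> carrier G \<longrightarrow> a x = 0)}"

definition E_alg ::
  "('g, 'z) monoid_scheme \<Rightarrow> ('g \<Rightarrow> 'g \<Rightarrow> 'g \<Rightarrow> 'k::field) \<Rightarrow> 'g set
     \<Rightarrow> ('g, 'k, 'v::ab_group_add) zalg \<Rightarrow> ('g, 'k, 'g \<Rightarrow> 'v) zalg" where
  "E_alg G \<alpha> H B = (let part = hom_part G (E_grd G \<alpha> H B) in \<lparr>
     scal = (\<lambda>c a x. scal B c (a x)),
     grd = E_grd G \<alpha> H B,
     act = (\<lambda>g a x. if x \<in> carrier G
        then \<Sum>f\<in>carrier G.
          scal B (inverse (acoef G \<alpha> (inv\<^bsub>G\<^esub> x) g f)) (part a f (inv\<^bsub>G\<^esub> g \<otimes>\<^bsub>G\<^esub> x))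
        else 0),
     amul = (\<lambda>a b x. if x \<in> carrier G
        then \<Sum>f\<in>carrier G. \<Sum>g\<in>carrier G.
          scal B (tcoef G \<alpha> (inv\<^bsub>G\<^esub> x) f g) (amul B (part a f x) (part b g x))
        else 0),
     aunit = (\<lambda>x. if x \<in> carrier G then aunit B else 0)\<rparr>)"

definition L_alg ::
  "('g, 'z) monoid_scheme \<Rightarrow> ('g \<Rightarrow> 'g \<Rightarrow> 'g \<Rightarrow> 'k::field) \<Rightarrow> 'g set \<Rightarrow> ('g \<Rightarrow> 'g \<Rightarrow> 'k)
     \<Rightarrow> ('g, 'k, 'g \<Rightarrow> 'g \<Rightarrow> 'k) zalg" where
  "L_alg G \<alpha> H \<gamma> = E_alg G \<alpha> H (twisted_group_algebra G H \<gamma>)"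

end

(* Idea. Every element of R = L_e is central, R is reduced because the trace of a square-zero
   operator vanishes, and G acts on R by automorphisms. Choose a primitive idempotent p of R, so that
   p R = k p, with stabiliser H. The sum of the orbit of p is an invariant idempotent, hence equal to 1
   by indecomposability. Commutativity gives p L_g = 0 for g outside H, and nondegeneracy of the trace
   form shows that p L_g has dimension at most 1, with invertible nonzero elements. The degrees g with
   p L_g \<noteq> 0 form a subgroup F of H. The representation of H on functions on H/F, placed in degree e,
   gives a local module over the corner p L and hence a local L-module; it is free only if F = H.
   This replaces the usual comparison of dimensions of categories of local modules. Once F = H,
   nonzero u_h in p L_h multiply by a cochain \<gamma> with coboundary \<alpha>, and a \<mapsto> (x \<mapsto> p (x^-1.a)) is the
   isomorphism L \<rightarrow> L(H, \<gamma>). *)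

theory Submission
  imports Defs
begin

section \<open>Linear algebra on subspaces\<close>

text \<open>The obstacle is that products are associative only up to \<open>\<alpha>\<close> and
  that \<open>G\<close> acts only projectively. Normalisation makes \<open>\<alpha>\<close>,
  \<open>acoef\<close> and \<open>tcoef\<close> equal to 1 as soon as one argument is the identity,
  so elements of degree \<open>\<one>\<close> obey ordinary commutative algebra and can be moved
  through any product. Idempotents of degree \<open>\<one>\<close> therefore carry the argument, and
  \<open>\<alpha>\<close> returns only through nonzero scalars in the corner at \<open>p\<close>.
  The corner lives over \<open>H\<close> because commuting \<open>p\<close> past an element of
  degree \<open>g\<close> replaces it by \<open>g.p\<close>, which is orthogonal to \<open>p\<close>
  unless \<open>g\<close> fixes \<open>p\<close>. The test module is local for this reason: with
  \<open>k = f g f^-1\<close>, the double braiding moves the argument \<open>x\<close> of a module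
  element to \<open>k^-1 x\<close>, and the algebra element involved acts at \<open>x\<close>
  nontrivially only if \<open>x^-1 k x\<close> lies in \<open>F\<close>; functions invariant under
  right translation by \<open>F\<close> do not notice the move. Algebraic closure gives
  \<open>p R = k p\<close>; characteristic zero allows division by the order of \<open>H\<close>,
  both for the sum of the orbit and for the averaging that yields surjectivity.\<close>

lemma sum_fun_apply: "(\<Sum>i\<in>A. f i) x = (\<Sum>i\<in>A. f i x)"
  by (induction A rule: infinite_finite_induct) auto

lemma linear_onD:
  assumes "linear_on S s t \<phi>"
  shows "x \<in> S \<Longrightarrow> y \<in> S \<Longrightarrow> \<phi> (x + y) = \<phi> x + \<phi> y" "x \<in> S \<Longrightarrow> \<phi> (s c x) = t c (\<phi> x)"
  using assms by (auto simp: linear_on_def)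

lemma linear_on_zero: "linear_on S s t \<phi> \<Longrightarrow> 0 \<in> S \<Longrightarrow> \<phi> 0 = 0"
  using linear_onD(1)[of S s t \<phi> 0 0] by simp

lemma linear_on_subset: "linear_on S s t \<phi> \<Longrightarrow> T \<subseteq> S \<Longrightarrow> linear_on T s t \<phi>"
  by (simp add: linear_on_def subset_iff)

context vector_space
begin

lemma linear_on_sum:
  assumes "linear_on S scale t \<phi>" "subspace S" "\<And>i. i \<in> I \<Longrightarrow> f i \<in> S"
  shows "\<phi> (\<Sum>i\<in>I. f i) = (\<Sum>i\<in>I. \<phi> (f i))"
  using assms(3)
proof (induction I rule: infinite_finite_induct)
  case (insert i I)
  then show ?case
    using linear_onD(1)[OF assms(1), of "f i" "\<Sum>i\<in>I. f i"] subspace_sum[OF assms(2), of I f] by auto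
qed (use linear_on_zero[OF assms(1) subspace_0[OF assms(2)]] in auto)

lemma linear_on_diff:
  assumes "linear_on S scale t \<phi>" "subspace S" "x \<in> S" "y \<in> S"
  shows "\<phi> (x - y) = \<phi> x - \<phi> y"
  using linear_onD(1)[OF assms(1), of "x - y" y] subspace_diff[OF assms(2)] assms(3,4)
  by (simp add: algebra_simps)

lemma inj_on_linear_onI:
  assumes "linear_on S scale t \<phi>" "subspace S" "\<And>x. x \<in> S \<Longrightarrow> \<phi> x = 0 \<Longrightarrow> x = 0"
  shows "inj_on \<phi> S"
proof (rule inj_onI)
  fix x y assume "x \<in> S" "y \<in> S" "\<phi> x = \<phi> y"
  then show "x = y"
    using assms(3)[of "x - y"] linear_on_diff[OF assms(1,2)] subspace_diff[OF assms(2)] by simp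
qed

lemma fd_basis:
  assumes "fd_subspace scale W"
  obtains B where "finite B" "independent B" "span B = W"
proof -
  obtain C where C: "finite C" "span C = W" using assms(1) unfolding fd_subspace_def by blast
  obtain B where "B \<subseteq> W" "independent B" "W \<subseteq> span B" by (metis basis_exists[of W])
  moreover from this have "finite B" using independent_span_bound[of C B] C by blast
  moreover have "span B = W"
    using \<open>B \<subseteq> W\<close> \<open>W \<subseteq> span B\<close> C span_minimal[of B W] subspace_span by blast
  ultimately show thesis using that by blast
qed

lemma fd_subspace_subspace: "fd_subspace scale W \<Longrightarrow> subspace W"
  by (auto simp: fd_subspace_def)

lemma fd_subspace_subset:
  assumes "fd_subspace scale W" "subspace U" "U \<subseteq> W"
  shows "fd_subspace scale U"
proof -
  obtain C where C: "finite C" "span C = W" using assms(1) unfolding fd_subspace_def by blast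
  obtain B where "B \<subseteq> U" "independent B" "U \<subseteq> span B" by (metis basis_exists[of U])
  moreover from this have "finite B" using independent_span_bound[of C B] C assms(3) by blast
  moreover have "span B = U"
    using \<open>B \<subseteq> U\<close> \<open>U \<subseteq> span B\<close> span_minimal[of B U] assms(2) by blast
  ultimately show ?thesis by (auto simp only: fd_subspace_def)
qed

text \<open>Makes dimension a strict measure, so that a nonzero principal ideal of least dimension
  contains no smaller nonzero one.\<close>

lemma fd_dim_psubset:
  assumes "fd_subspace scale W" "subspace U" "U \<subset> W"
  shows "dim U < dim W"
proof -
  obtain B where B: "finite B" "independent B" "span B = U"
    using fd_subspace_subset assms fd_basis by (metis psubset_imp_subset)
  obtain C where C: "finite C" "independent C" "span C = W"
    using assms(1) by (rule fd_basis)
  obtain v where v: "v \<in> W" "v \<notin> U" using assms(3) by blast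
  have "independent (insert v B)" using v B independent_insertI by blast
  moreover have "insert v B \<subseteq> span C"
    using v B C assms(3) span_superset by blast
  ultimately have "card (insert v B) \<le> card C"
    using independent_span_bound[OF C(1)] by blast
  moreover have "v \<notin> B" using v B span_superset by blast
  ultimately show ?thesis
    using B C dim_span_eq_card_independent by (metis Suc_le_eq card_insert_disjoint)
qed

lemma linear_on_image_span:
  assumes "vector_space t" "linear_on (span B) scale t \<phi>"
  shows "\<phi> ` span B = module.span t (\<phi> ` B)"
proof -
  interpret t: vector_space t by fact
  note lin = linear_onD[OF assms(2)]
  have "t.subspace (\<phi> ` span B)"
  proof (rule t.subspaceI)
    show "0 \<in> \<phi> ` span B" using linear_on_zero[OF assms(2) span_zero] span_zero by (metis imageI)
  next
    fix x y assume "x \<in> \<phi> ` span B" "y \<in> \<phi> ` span B"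
    then show "x + y \<in> \<phi> ` span B" using lin(1) span_add by (smt (verit) imageE imageI)
  next
    fix c x assume "x \<in> \<phi> ` span B"
    then show "t c x \<in> \<phi> ` span B" using lin(2) span_scale by (smt (verit) imageE imageI)
  qed
  then have 1: "module.span t (\<phi> ` B) \<subseteq> \<phi> ` span B"
    using t.span_minimal span_superset by (metis image_mono)
  have "span B \<subseteq> {x \<in> span B. \<phi> x \<in> module.span t (\<phi> ` B)}"
  proof (rule span_minimal)
    show "B \<subseteq> {x \<in> span B. \<phi> x \<in> module.span t (\<phi> ` B)}"
      using span_base t.span_base by blast
    show "subspace {x \<in> span B. \<phi> x \<in> module.span t (\<phi> ` B)}"
      using lin linear_on_zero[OF assms(2) span_zero]
      by (auto intro!: subspaceI simp: span_zero t.span_zero span_add t.span_add span_scale t.span_scale)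
  qed
  with 1 show ?thesis by blast
qed

lemma fd_subspace_image:
  assumes "vector_space t" "linear_on W scale t \<phi>" "fd_subspace scale W"
  shows "fd_subspace t (\<phi> ` W)"
proof -
  obtain B where B: "finite B" "span B = W" using assms(3) unfolding fd_subspace_def by blast
  then have "module.span t (\<phi> ` B) = \<phi> ` W" using linear_on_image_span[OF assms(1)] assms(2) by metis
  then show ?thesis using B(1) unfolding fd_subspace_def by blast
qed

text \<open>Expanding \<open>b\<close> in the basis \<open>C\<close> and \<open>T c\<close> in the
  basis \<open>B\<close> turns both sides into the same double sum over \<open>B\<close> and
  \<open>C\<close>.\<close>

lemma trace_basis_independent:
  assumes B: "finite B" "independent B" "span B = W"
    and C: "finite C" "independent C" "span C = W"
    and T: "linear_on W scale scale T" "T ` W \<subseteq> W"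
  shows "(\<Sum>b\<in>B. representation B (T b) b) = (\<Sum>c\<in>C. representation C (T c) c)"
proof -
  have W: "subspace W" using B(3) subspace_span by blast
  have BW: "b \<in> W" if "b \<in> B" for b using that B(3) span_base by blast
  have CW: "c \<in> W" if "c \<in> C" for c using that C(3) span_base by blast
  have TW: "T w \<in> W" if "w \<in> W" for w using that T(2) by blast
  have Bexp: "(\<Sum>b\<in>B. scale (representation B w b) b) = w" if "w \<in> W" for w
    using sum_representation_eq[OF B(2), of w B] that B by auto
  have Cexp: "(\<Sum>c\<in>C. scale (representation C w c) c) = w" if "w \<in> W" for w
    using sum_representation_eq[OF C(2), of w C] that C by auto
  have "representation B (T b) b = (\<Sum>c\<in>C. representation C b c * representation B (T c) b)"
    if "b \<in> B" for b
  proof -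
    have "T b = T (\<Sum>c\<in>C. scale (representation C b c) c)"
      using Cexp BW that by simp
    also have "\<dots> = (\<Sum>c\<in>C. scale (representation C b c) (T c))"
      using linear_on_sum[OF T(1) W, of C "\<lambda>c. scale (representation C b c) c"]
        CW subspace_scale[OF W] linear_onD(2)[OF T(1)] by simp
    finally show ?thesis
      using TW CW B by (simp add: representation_sum[OF B(2)] representation_scale[OF B(2)] W subspace_scale)
  qed
  then have "(\<Sum>b\<in>B. representation B (T b) b)
    = (\<Sum>b\<in>B. \<Sum>c\<in>C. representation C b c * representation B (T c) b)" by simp
  also have "\<dots> = (\<Sum>c\<in>C. \<Sum>b\<in>B. representation C b c * representation B (T c) b)"
    by (rule sum.swap)
  also have "\<dots> = (\<Sum>c\<in>C. representation C (T c) c)"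
  proof (rule sum.cong[OF refl])
    fix c assume "c \<in> C"
    have "representation C (T c) c
      = representation C (\<Sum>b\<in>B. scale (representation B (T c) b) b) c"
      using Bexp TW CW \<open>c \<in> C\<close> by simp
    also have "\<dots> = (\<Sum>b\<in>B. representation B (T c) b * representation C b c)"
      using BW C by (simp add: representation_sum[OF C(2)] representation_scale[OF C(2)] W subspace_scale)
    finally show "(\<Sum>b\<in>B. representation C b c * representation B (T c) b) = representation C (T c) c"
      by (simp add: mult.commute)
  qed
  finally show ?thesis .
qed

text \<open>The \<open>SOME\<close> in \<open>trace_on\<close> does not ask for a finite basis;
  finiteness of the chosen one is first deduced from \<open>C\<close>.\<close>

lemma trace_on_basis:
  assumes C: "finite C" "independent C" "span C = W"
    and T: "linear_on W scale scale T" "T ` W \<subseteq> W"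
  shows "trace_on scale W T = (\<Sum>c\<in>C. representation C (T c) c)"
proof -
  define B where "B = (SOME B. independent B \<and> span B = W)"
  have B: "independent B \<and> span B = W"
    unfolding B_def by (rule someI[of _ C]) (use C in auto)
  then have "finite B" using independent_span_bound[OF C(1), of B] C(3) span_superset by blast
  then show ?thesis
    using trace_basis_independent[OF _ _ _ C T] B by (simp add: trace_on_def B_def[symmetric])
qed

text \<open>In a basis \<open>C\<close> extending a basis \<open>D\<close> of the kernel all
  diagonal entries vanish: \<open>T\<close> kills \<open>D\<close>, and for \<open>c\<close> outside
  \<open>D\<close> the vector \<open>T c\<close> lies in the kernel, hence has no coordinate at
  \<open>c\<close>.\<close>

lemma trace_on_square_zero:
  assumes W: "fd_subspace scale W" and T: "linear_on W scale scale T" "T ` W \<subseteq> W"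
    and sq: "\<And>w. w \<in> W \<Longrightarrow> T (T w) = 0"
  shows "trace_on scale W T = 0"
proof -
  have sW: "subspace W" using W fd_subspace_subspace by blast
  define K where "K = {w \<in> W. T w = 0}"
  have K: "subspace K"
    using sW linear_onD[OF T(1)] linear_on_zero[OF T(1)]
    by (auto simp: subspace_def K_def)
  obtain D where D: "D \<subseteq> K" "independent D" "K \<subseteq> span D" by (metis basis_exists[of K])
  have "D \<subseteq> W" using D K_def by blast
  then obtain C where C: "D \<subseteq> C" "C \<subseteq> W" "independent C" "W \<subseteq> span C"
    using maximal_independent_subset_extend D(2) by metis
  have sC: "span C = W" using C span_minimal sW by blast
  obtain E where "finite E" "span E = W" using W by (auto simp only: fd_subspace_def)
  then have fC: "finite C" using independent_span_bound C by blast
  have "representation C (T c) c = 0" if "c \<in> C" for c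
  proof (cases "c \<in> D")
    case True
    then show ?thesis using D K_def by (auto simp: representation_zero)
  next
    case False
    have "T c \<in> span D" using C that sq T(2) D(3) K_def by blast
    then have "representation C (T c) = representation D (T c)"
      using representation_extend[OF C(3) _ C(1)] by blast
    then show ?thesis using False representation_ne_zero by metis
  qed
  then show ?thesis using trace_on_basis[OF fC C(3) sC T] by simp
qed

end

section \<open>Graded spaces and objects\<close>

text \<open>Keeps the direct sum decomposition apart from the action, so that it also serves direct
  sums of algebras, powers of the regular module and \<open>L_alg\<close>, for which only the
  grading is established.\<close>

locale graded_sum = vector_space s
  for s :: "'k::field \<Rightarrow> 'v::ab_group_add \<Rightarrow> 'v" +
  fixes G :: "('g, 'z) monoid_scheme" and D :: "'g \<Rightarrow> 'v set"
  assumes fin: "finite (carrier G)"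
    and sub: "g \<in> carrier G \<Longrightarrow> subspace (D g)"
    and dir: "direct G D"
begin

lemma sum_total: "(\<And>g. g \<in> carrier G \<Longrightarrow> x g \<in> D g) \<Longrightarrow> (\<Sum>g\<in>carrier G. x g) \<in> total G D"
  by (auto simp: total_def)

lemma totalE:
  assumes "v \<in> total G D"
  obtains x where "\<And>g. g \<in> carrier G \<Longrightarrow> x g \<in> D g" "v = (\<Sum>g\<in>carrier G. x g)"
  using assms by (auto simp: total_def)

lemma total_subspace: "subspace (total G D)"
proof (rule subspaceI)
  show "0 \<in> total G D" using sum_total[of "\<lambda>_. 0"] sub subspace_0 by simp
next
  fix v w assume "v \<in> total G D" "w \<in> total G D"
  then obtain x y where x: "\<And>g. g \<in> carrier G \<Longrightarrow> x g \<in> D g" "v = (\<Sum>g\<in>carrier G. x g)"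
    and y: "\<And>g. g \<in> carrier G \<Longrightarrow> y g \<in> D g" "w = (\<Sum>g\<in>carrier G. y g)" by (auto elim!: totalE)
  show "v + w \<in> total G D"
    using sum_total[of "\<lambda>g. x g + y g"] x y sub subspace_add by (simp add: sum.distrib)
next
  fix c v assume "v \<in> total G D"
  then obtain x where x: "\<And>g. g \<in> carrier G \<Longrightarrow> x g \<in> D g" "v = (\<Sum>g\<in>carrier G. x g)"
    by (auto elim!: totalE)
  show "s c v \<in> total G D"
    using sum_total[of "\<lambda>g. s c (x g)"] x sub subspace_scale by (simp add: scale_sum_right)
qed

lemma sum_single:
  assumes "g \<in> carrier G"
  shows "(\<Sum>h\<in>carrier G. if h = g then v else 0) = (v::'w::comm_monoid_add)"
  using fin assms by simp

lemma grd_total: "g \<in> carrier G \<Longrightarrow> v \<in> D g \<Longrightarrow> v \<in> total G D"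
  using sum_total[of "\<lambda>h. if h = g then v else 0"] sum_single[of g v] sub subspace_0 by auto

lemma hom_part:
  assumes "v \<in> total G D"
  shows "g \<in> carrier G \<Longrightarrow> hom_part G D v g \<in> D g" "(\<Sum>g\<in>carrier G. hom_part G D v g) = v"
proof -
  have "\<exists>x. (\<forall>g\<in>carrier G. x g \<in> D g) \<and> v = (\<Sum>g\<in>carrier G. x g)"
    using assms by (auto simp: total_def)
  from someI_ex[OF this]
  show "g \<in> carrier G \<Longrightarrow> hom_part G D v g \<in> D g" "(\<Sum>g\<in>carrier G. hom_part G D v g) = v"
    by (auto simp: hom_part_def)
qed

text \<open>\<open>hom_part\<close> is obtained by choice; directness, applied to the difference of
  two decompositions, shows that the choice is forced.\<close>

lemma hom_part_sum:
  assumes "\<And>g. g \<in> carrier G \<Longrightarrow> x g \<in> D g" "g \<in> carrier G"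
  shows "hom_part G D (\<Sum>g\<in>carrier G. x g) g = x g"
proof -
  let ?v = "\<Sum>g\<in>carrier G. x g"
  have v: "?v \<in> total G D" using assms(1) by (rule sum_total)
  have "\<forall>g\<in>carrier G. hom_part G D ?v g - x g \<in> D g"
    using hom_part(1)[OF v] assms(1) sub subspace_diff by blast
  moreover have "(\<Sum>g\<in>carrier G. hom_part G D ?v g - x g) = 0"
    using hom_part(2)[OF v] by (simp add: sum_subtractf)
  ultimately have "hom_part G D ?v g - x g = 0"
    using dir[unfolded direct_def, rule_format, of "\<lambda>g. hom_part G D ?v g - x g"] assms(2) by blast
  then show ?thesis by simp
qed

lemma hom_part_homogeneous:
  assumes "g \<in> carrier G" "v \<in> D g" "h \<in> carrier G"
  shows "hom_part G D v h = (if h = g then v else 0)"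
proof -
  have "hom_part G D (\<Sum>h\<in>carrier G. if h = g then v else 0) h = (if h = g then v else 0)"
    by (rule hom_part_sum) (use assms sub subspace_0 in auto)
  then show ?thesis using sum_single[of g v] assms(1) by simp
qed

lemma hom_part_linear:
  assumes "g \<in> carrier G"
  shows "linear_on (total G D) s s (\<lambda>v. hom_part G D v g)"
proof -
  have "hom_part G D (v + w) g = hom_part G D v g + hom_part G D w g"
    if "v \<in> total G D" "w \<in> total G D" for v w
    using hom_part_sum[of "\<lambda>g. hom_part G D v g + hom_part G D w g" g] hom_part[OF that(1)]
      hom_part[OF that(2)] assms sub subspace_add by (simp add: sum.distrib)
  moreover have "hom_part G D (s c v) g = s c (hom_part G D v g)" if "v \<in> total G D" for c v
    using hom_part_sum[of "\<lambda>g. s c (hom_part G D v g)" g] hom_part[OF that] assms sub subspace_scale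
    by (simp add: scale_sum_right[symmetric])
  ultimately show ?thesis by (simp add: linear_on_def)
qed

lemma linear_on_hom_parts:
  assumes "linear_on (total G D) s t \<phi>" "v \<in> total G D"
  shows "\<phi> v = (\<Sum>g\<in>carrier G. \<phi> (hom_part G D v g))"
  using linear_on_sum[OF assms(1) total_subspace, of "carrier G" "hom_part G D v"]
    hom_part[OF assms(2)] grd_total by auto

lemma linear_on_eqI:
  assumes "linear_on (total G D) s t \<phi>" "linear_on (total G D) s t \<psi>"
    and "\<And>g v. g \<in> carrier G \<Longrightarrow> v \<in> D g \<Longrightarrow> \<phi> v = \<psi> v" and "v \<in> total G D"
  shows "\<phi> v = \<psi> v"
  using linear_on_hom_parts[OF assms(1,4)] linear_on_hom_parts[OF assms(2,4)] hom_part(1)[OF assms(4)]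
    assms(3) by (metis (no_types, lifting) sum.cong)

lemma fd_total:
  assumes "\<And>g. g \<in> carrier G \<Longrightarrow> fd_subspace s (D g)"
  shows "fd_subspace s (total G D)"
proof -
  have "\<forall>g\<in>carrier G. \<exists>B. finite B \<and> span B = D g" using assms unfolding fd_subspace_def by blast
  then obtain B where B: "\<And>g. g \<in> carrier G \<Longrightarrow> finite (B g)" "\<And>g. g \<in> carrier G \<Longrightarrow> span (B g) = D g"
    by metis
  let ?U = "\<Union>g\<in>carrier G. B g"
  have "?U \<subseteq> total G D" using B(2) span_superset grd_total by blast
  moreover have "total G D \<subseteq> span ?U"
  proof
    fix v assume "v \<in> total G D"
    then obtain x where x: "\<And>g. g \<in> carrier G \<Longrightarrow> x g \<in> D g" "v = (\<Sum>g\<in>carrier G. x g)"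
      by (auto elim!: totalE)
    have "x g \<in> span ?U" if "g \<in> carrier G" for g
      using x(1)[OF that] B(2)[OF that] span_mono[of "B g" ?U] that by blast
    then show "v \<in> span ?U" using x(2) span_sum by metis
  qed
  ultimately have "span ?U = total G D" using span_minimal total_subspace by blast
  moreover have "finite ?U" using B(1) fin by blast
  ultimately show ?thesis unfolding fd_subspace_def by blast
qed

lemma linear_on_total_image:
  assumes "linear_on (total G D) s t \<phi>" "\<And>g. g \<in> carrier G \<Longrightarrow> \<phi> ` D g \<subseteq> D' g"
    and "v \<in> total G D"
  shows "\<phi> v \<in> total G D'"
proof -
  have "\<forall>g\<in>carrier G. \<phi> (hom_part G D v g) \<in> D' g" using assms hom_part(1)[OF assms(3)] by blast
  then show ?thesis unfolding linear_on_hom_parts[OF assms(1,3)] total_def by blast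
qed

lemma hom_part_image:
  assumes "graded_sum t G D'" "linear_on (total G D) s t \<phi>" "\<And>g. g \<in> carrier G \<Longrightarrow> \<phi> ` D g \<subseteq> D' g"
    and "v \<in> total G D" "g \<in> carrier G"
  shows "hom_part G D' (\<phi> v) g = \<phi> (hom_part G D v g)"
  unfolding linear_on_hom_parts[OF assms(2,4)]
  by (rule graded_sum.hom_part_sum[OF assms(1)]) (use assms(3,5) hom_part(1)[OF assms(4)] in blast)+

text \<open>Lets bijectivity be checked degree by degree, since degree-preserving maps commute with
  the projections. It serves the group action, the splitting by an idempotent and the final
  isomorphism.\<close>

lemma bij_betw_total:
  assumes "graded_sum t G D'" "linear_on (total G D) s t \<phi>"
    and im: "\<And>g. g \<in> carrier G \<Longrightarrow> \<phi> ` D g = D' g"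
    and ker: "\<And>g v. g \<in> carrier G \<Longrightarrow> v \<in> D g \<Longrightarrow> \<phi> v = 0 \<Longrightarrow> v = 0"
  shows "bij_betw \<phi> (total G D) (total G D')"
proof -
  interpret t: graded_sum t G D' by fact
  have part: "hom_part G D' (\<phi> v) g = \<phi> (hom_part G D v g)" if "v \<in> total G D" "g \<in> carrier G" for v g
    using hom_part_image[OF assms(1,2)] im that by blast
  have "inj_on \<phi> (total G D)"
  proof (rule inj_on_linear_onI[OF assms(2) total_subspace])
    fix v assume v: "v \<in> total G D" "\<phi> v = 0"
    have "hom_part G D v g = 0" if g: "g \<in> carrier G" for g
    proof -
      have "\<phi> (hom_part G D v g) = 0"
        using part[OF v(1) g] v(2) t.hom_part_homogeneous[OF g _ g] t.sub[OF g] t.subspace_0 by simp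
      then show ?thesis using ker g hom_part(1)[OF v(1)] by blast
    qed
    then show "v = 0" using hom_part(2)[OF v(1)] by (metis (no_types, lifting) sum.neutral)
  qed
  moreover have "w \<in> \<phi> ` total G D" if w: "w \<in> total G D'" for w
  proof -
    have "\<forall>g\<in>carrier G. \<exists>v\<in>D g. \<phi> v = hom_part G D' w g"
      using t.hom_part(1)[OF w] im by (metis (no_types, lifting) imageE)
    then obtain x where x: "\<forall>g\<in>carrier G. x g \<in> D g \<and> \<phi> (x g) = hom_part G D' w g" by metis
    have "\<phi> (\<Sum>g\<in>carrier G. x g) = w"
      using linear_on_sum[OF assms(2) total_subspace, of "carrier G" x] x grd_total t.hom_part(2)[OF w] by auto
    then show ?thesis using sum_total[of x] x by (metis imageI)
  qed
  moreover have "\<phi> v \<in> total G D'" if "v \<in> total G D" for v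
    using linear_on_total_image[OF assms(2) _ that] im by blast
  ultimately show ?thesis by (auto simp: bij_betw_def)
qed

end

lemma graded_sumI:
  assumes "vector_space s" "finite (carrier G)" "\<And>g. g \<in> carrier G \<Longrightarrow> fd_subspace s (D g)" "direct G D"
  shows "graded_sum s G D"
proof -
  interpret vector_space s by fact
  show ?thesis by standard (use assms fd_subspace_subspace in auto)
qed

lemma direct_subset: "direct G D \<Longrightarrow> (\<And>g. g \<in> carrier G \<Longrightarrow> D' g \<subseteq> D g) \<Longrightarrow> direct G D'"
  unfolding direct_def by blast

lemma total_mono: "(\<And>g. g \<in> carrier G \<Longrightarrow> D' g \<subseteq> D g) \<Longrightarrow> total G D' \<subseteq> total G D"
  unfolding total_def by blast

section \<open>Conjugation and the degrees it produces\<close>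

context group
begin

lemma cj_closed [simp]: "g \<in> carrier G \<Longrightarrow> h \<in> carrier G \<Longrightarrow> cj G g h \<in> carrier G"
  by (simp add: cj_def)

lemma cj_one [simp]: "g \<in> carrier G \<Longrightarrow> cj G \<one> g = g" "g \<in> carrier G \<Longrightarrow> cj G g \<one> = \<one>"
  by (simp_all add: cj_def)

lemma cj_mult: "f \<in> carrier G \<Longrightarrow> g \<in> carrier G \<Longrightarrow> h \<in> carrier G \<Longrightarrow> cj G (f \<otimes> g) h = cj G f (cj G g h)"
  by (simp add: cj_def m_assoc inv_mult_group)

lemma cj_inv [simp]:
  "f \<in> carrier G \<Longrightarrow> h \<in> carrier G \<Longrightarrow> cj G (inv f) (cj G f h) = h"
  "f \<in> carrier G \<Longrightarrow> h \<in> carrier G \<Longrightarrow> cj G f (cj G (inv f) h) = h"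
  using cj_mult[of "inv f" f h] cj_mult[of f "inv f" h] by auto

lemma cj_mult_commute: "f \<in> carrier G \<Longrightarrow> h \<in> carrier G \<Longrightarrow> cj G f h \<otimes> f = f \<otimes> h"
  by (simp add: cj_def m_assoc)

lemma cj_inv_eq: "x \<in> carrier G \<Longrightarrow> cj G (inv x) f = inv x \<otimes> f \<otimes> x"
  by (simp add: cj_def)

lemma cj_tensor: "f \<in> carrier G \<Longrightarrow> g \<in> carrier G \<Longrightarrow> h \<in> carrier G \<Longrightarrow> cj G f (g \<otimes> h) = cj G f g \<otimes> cj G f h"
  by (simp add: cj_def m_assoc[symmetric]) (simp add: m_assoc)

lemma mult_inv_cancel [simp]:
  "x \<in> carrier G \<Longrightarrow> y \<in> carrier G \<Longrightarrow> x \<otimes> (inv x \<otimes> y) = y"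
  "x \<in> carrier G \<Longrightarrow> y \<in> carrier G \<Longrightarrow> inv x \<otimes> (x \<otimes> y) = y"
  by (simp_all add: m_assoc[symmetric])

end

section \<open>Scalars of the cocycle and objects of the category\<close>

locale group_cocycle = group G for G (structure) +
  fixes \<alpha> :: "'a \<Rightarrow> 'a \<Rightarrow> 'a \<Rightarrow> 'k::field"
  assumes fin: "finite (carrier G)" and coc: "normalised_3cocycle G \<alpha>"
begin

lemma alpha_nz: "f \<in> carrier G \<Longrightarrow> g \<in> carrier G \<Longrightarrow> h \<in> carrier G \<Longrightarrow> \<alpha> f g h \<noteq> 0"
  using coc by (simp add: normalised_3cocycle_def)

lemma alpha_one [simp]:
  assumes "f \<in> carrier G" "g \<in> carrier G"
  shows "\<alpha> \<one> f g = 1" "\<alpha> f \<one> g = 1" "\<alpha> f g \<one> = 1"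
  using coc assms by (simp_all add: normalised_3cocycle_def)

lemma acoef_nz: "f \<in> carrier G \<Longrightarrow> g \<in> carrier G \<Longrightarrow> h \<in> carrier G \<Longrightarrow> acoef G \<alpha> f g h \<noteq> 0"
  by (simp add: acoef_def alpha_nz)

lemma acoef_one [simp]:
  assumes "f \<in> carrier G" "g \<in> carrier G"
  shows "acoef G \<alpha> f g \<one> = 1" "acoef G \<alpha> \<one> f g = 1" "acoef G \<alpha> f \<one> g = 1"
  using assms by (simp_all add: acoef_def)

lemma tcoef_one [simp]:
  assumes "f \<in> carrier G" "g \<in> carrier G"
  shows "tcoef G \<alpha> f g \<one> = 1" "tcoef G \<alpha> f \<one> g = 1" "tcoef G \<alpha> \<one> f g = 1"
  using assms by (simp_all add: tcoef_def alpha_nz)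

lemma graded_sum_zobject: "zobject G \<alpha> X \<Longrightarrow> graded_sum (scal X) G (grd X)"
  by (rule graded_sumI) (auto simp: zobject_def fin)

text \<open>Bijectivity of the action, and equality instead of inclusion for the images of the
  components, come for free: \<open>f\<close> and \<open>inv f\<close> act inversely to each other
  up to a scalar once \<open>\<one>\<close> acts trivially.\<close>

lemma zobjectI:
  fixes X :: "('a, 'k, 'v::ab_group_add, 'e) zobj_scheme"
  assumes vs: "vector_space (scal X)" and fd: "\<And>g. g \<in> carrier G \<Longrightarrow> fd_subspace (scal X) (grd X g)"
    and dir: "direct G (grd X)"
    and lin: "\<And>f. f \<in> carrier G \<Longrightarrow> linear_on (space G X) (scal X) (scal X) (act X f)"
    and im: "\<And>f g v. f \<in> carrier G \<Longrightarrow> g \<in> carrier G \<Longrightarrow> v \<in> grd X g \<Longrightarrow> act X f v \<in> grd X (cj G f g)"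
    and one: "\<And>g v. g \<in> carrier G \<Longrightarrow> v \<in> grd X g \<Longrightarrow> act X \<one> v = v"
    and proj: "\<And>f g h v. f \<in> carrier G \<Longrightarrow> g \<in> carrier G \<Longrightarrow> h \<in> carrier G \<Longrightarrow> v \<in> grd X h \<Longrightarrow>
      act X (f \<otimes> g) v = scal X (acoef G \<alpha> f g h) (act X f (act X g v))"
  shows "zobject G \<alpha> X"
proof -
  interpret graded_sum "scal X" G "grd X"
    by (rule graded_sumI[OF vs fin fd dir])
  have img: "act X f ` grd X g = grd X (cj G f g)" if f: "f \<in> carrier G" and g: "g \<in> carrier G" for f g
  proof
    show "act X f ` grd X g \<subseteq> grd X (cj G f g)" using im f g by blast
    show "grd X (cj G f g) \<subseteq> act X f ` grd X g"
    proof
      fix v assume v: "v \<in> grd X (cj G f g)"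
      \<comment> \<open>The scalar by which the action of \<open>f \<otimes> inv f = \<one>\<close>
        differs from acting by \<open>inv f\<close> and then by \<open>f\<close>.\<close>
      let ?c = "acoef G \<alpha> f (inv f) (cj G f g)"
      have w: "act X (inv f) v \<in> grd X g" using im[of "inv f" "cj G f g" v] f g v by simp
      have "act X f (scal X ?c (act X (inv f) v)) = scal X ?c (act X f (act X (inv f) v))"
        using linear_onD(2)[OF lin[OF f]] grd_total[OF g w] by blast
      also have "\<dots> = v" using proj[of f "inv f" "cj G f g" v] one[of "cj G f g" v] v f g by simp
      finally show "v \<in> act X f ` grd X g" using w sub[OF g] subspace_scale by (metis imageI)
    qed
  qed
  \<comment> \<open>Acting by \<open>f\<close> permutes the degrees; it preserves degrees only
    towards this relabelled grading, which has the same total space.\<close>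
  define D' where "D' f h = grd X (cj G f h)" for f h
  have bij: "bij_betw (act X f) (space G X) (space G X)" if f: "f \<in> carrier G" for f
  proof -
    have reindex: "bij_betw (cj G f) (carrier G) (carrier G)"
      by (rule bij_betwI[of _ _ _ "cj G (inv f)"]) (use f in auto)
    have eq: "total G (D' f) = space G X"
    proof
      show "total G (D' f) \<subseteq> space G X"
      proof
        fix v assume "v \<in> total G (D' f)"
        then obtain x where x: "\<forall>h\<in>carrier G. x h \<in> D' f h" "v = (\<Sum>h\<in>carrier G. x h)"
          by (auto simp: total_def)
        moreover have "x h \<in> space G X" if "h \<in> carrier G" for h
          using grd_total[of "cj G f h" "x h"] x(1) f that by (simp add: D'_def)
        ultimately show "v \<in> space G X"
          using subspace_sum[OF total_subspace, of "carrier G" x] by simp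
      qed
      show "space G X \<subseteq> total G (D' f)"
      proof
        fix v assume "v \<in> space G X"
        then obtain x where x: "\<And>g. g \<in> carrier G \<Longrightarrow> x g \<in> grd X g" "v = (\<Sum>g\<in>carrier G. x g)"
          by (rule totalE) blast
        have "v = (\<Sum>h\<in>carrier G. x (cj G f h))"
          using sum.reindex_bij_betw[OF reindex, of x] x(2) by simp
        then show "v \<in> total G (D' f)" using x(1) f unfolding total_def D'_def by (auto intro!: exI[of _ "\<lambda>h. x (cj G f h)"])
      qed
    qed
    have "direct G (D' f)"
      unfolding direct_def
    proof (intro allI impI ballI)
      fix x g assume x: "(\<forall>g\<in>carrier G. x g \<in> D' f g) \<and> sum x (carrier G) = 0" and g: "g \<in> carrier G"
      have "sum (\<lambda>h. x (cj G (inv f) h)) (carrier G) = 0"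
        using sum.reindex_bij_betw[OF reindex, of "\<lambda>h. x (cj G (inv f) h)"] x f by simp
      moreover have "\<forall>h\<in>carrier G. x (cj G (inv f) h) \<in> grd X h" using x f unfolding D'_def
        by (metis cj_closed cj_inv(2) inv_closed)
      ultimately have "x (cj G (inv f) (cj G f g)) = 0"
        using dir[unfolded direct_def, rule_format, of "\<lambda>h. x (cj G (inv f) h)" "cj G f g"] f g by simp
      then show "x g = 0" using f g by simp
    qed
    then have "graded_sum (scal X) G (D' f)"
      unfolding graded_sum_def graded_sum_axioms_def using vs fin sub f unfolding D'_def by simp
    moreover have "v = 0" if "g \<in> carrier G" "v \<in> grd X g" "act X f v = 0" for g v
    proof -
      have "v = scal X (acoef G \<alpha> (inv f) f g) (act X (inv f) (act X f v))"
        using proj[of "inv f" f g v] one[of g v] f that by simp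
      also have "\<dots> = 0" using linear_on_zero[OF lin[of "inv f"]] that(3) f subspace_0[OF total_subspace] by simp
      finally show ?thesis .
    qed
    ultimately have "bij_betw (act X f) (space G X) (total G (D' f))"
      by (intro bij_betw_total[OF _ lin[OF f]]) (use img f in \<open>auto simp: D'_def\<close>)
    then show ?thesis using eq by simp
  qed
  show ?thesis
    unfolding zobject_def using vs fd dir lin bij img proj by (intro conjI ballI) simp_all
qed

text \<open>The projective law only says that acting by \<open>\<one>\<close> twice is the same as
  acting once; injectivity cancels one of the two.\<close>

lemma zobject_act_one:
  assumes X: "zobject G \<alpha> X" and g: "g \<in> carrier G" and v: "v \<in> grd X g"
  shows "act X \<one> v = v"
proof -
  interpret graded_sum "scal X" G "grd X" by (rule graded_sum_zobject[OF X])
  have "bij_betw (act X \<one>) (space G X) (space G X)" "act X \<one> ` grd X g = grd X (cj G \<one> g)"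
    "act X (\<one> \<otimes> \<one>) v = scal X (acoef G \<alpha> \<one> \<one> g) (act X \<one> (act X \<one> v))"
    using X g v unfolding zobject_def by blast+
  then have "act X \<one> v \<in> grd X g" "act X \<one> (act X \<one> v) = act X \<one> v" "inj_on (act X \<one>) (space G X)"
    using g v by (auto simp: bij_betw_def)
  then show ?thesis using grd_total[OF g] v by (auto simp: inj_on_def)
qed

text \<open>\<open>tensor_hom\<close> locates values only for homogeneous arguments; bilinearity and
  decomposition of both arguments extend this.\<close>

lemma tensor_hom_total:
  assumes X: "zobject G \<alpha> X" and Y: "zobject G \<alpha> Y" and Z: "zobject G \<alpha> Z"
    and \<mu>: "tensor_hom G \<alpha> X Y Z \<mu>" and x: "x \<in> space G X" and y: "y \<in> space G Y"
  shows "\<mu> x y \<in> space G Z"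
proof -
  interpret X: graded_sum "scal X" G "grd X" by (rule graded_sum_zobject[OF X])
  interpret Y: graded_sum "scal Y" G "grd Y" by (rule graded_sum_zobject[OF Y])
  interpret Z: graded_sum "scal Z" G "grd Z" by (rule graded_sum_zobject[OF Z])
  have lin: "linear_on (space G X) (scal X) (scal Z) (\<lambda>x. \<mu> x y)"
    "\<And>x. x \<in> space G X \<Longrightarrow> linear_on (space G Y) (scal Y) (scal Z) (\<mu> x)"
    using \<mu> y by (simp_all add: tensor_hom_def)
  have "\<mu> (hom_part G (grd X) x g) (hom_part G (grd Y) y h) \<in> space G Z"
    if "g \<in> carrier G" "h \<in> carrier G" for g h
    using \<mu> that X.hom_part(1)[OF x] Y.hom_part(1)[OF y] Z.grd_total[of "g \<otimes> h"]
    by (simp add: tensor_hom_def)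
  moreover have "\<mu> x y = (\<Sum>g\<in>carrier G. \<mu> (hom_part G (grd X) x g) y)"
    using X.linear_on_hom_parts[OF lin(1) x] .
  moreover have "\<mu> (hom_part G (grd X) x g) y
      = (\<Sum>h\<in>carrier G. \<mu> (hom_part G (grd X) x g) (hom_part G (grd Y) y h))" if "g \<in> carrier G" for g
    using Y.linear_on_hom_parts[OF lin(2) y] X.grd_total[OF that X.hom_part(1)[OF x that]] by blast
  ultimately show ?thesis by (auto intro!: Z.subspace_sum[OF Z.total_subspace])
qed

end

section \<open>Algebras and their corners\<close>

lemma vector_space_prod:
  assumes "vector_space s" "vector_space t"
  shows "vector_space (\<lambda>c (x, y). (s c x, t c y))"
proof -
  interpret s: vector_space s by fact
  interpret t: vector_space t by fact
  show ?thesis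
    by standard (auto simp: s.scale_right_distrib t.scale_right_distrib s.scale_left_distrib t.scale_left_distrib)
qed

locale graded_algebra = group_cocycle G \<alpha> for G (structure) and \<alpha> :: "'a \<Rightarrow> 'a \<Rightarrow> 'a \<Rightarrow> 'k::field" +
  fixes A :: "('a, 'k, 'v::ab_group_add) zalg"
  assumes alg: "zalgebra G \<alpha> A"
begin

abbreviation Gr where "Gr g \<equiv> grd A g"
abbreviation Sp where "Sp \<equiv> space G A"
abbreviation smul (infixr \<open>\<star>\<close> 75) where "c \<star> a \<equiv> scal A c a"
abbreviation mul (infixl \<open>\<cdot>\<close> 70) where "a \<cdot> b \<equiv> amul A a b"
abbreviation gact (infixr \<open>\<rhd>\<close> 80) where "f \<rhd> a \<equiv> act A f a"
abbreviation unit where "unit \<equiv> aunit A"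

lemma obj: "zobject G \<alpha> A" and tens: "tensor_hom G \<alpha> A A A (amul A)"
  using alg by (simp_all add: zalgebra_def)

sublocale V: graded_sum "scal A" G "grd A"
  using obj by (rule graded_sum_zobject)

lemma fd_Gr: "g \<in> carrier G \<Longrightarrow> fd_subspace (scal A) (Gr g)"
  using obj by (simp add: zobject_def)

lemma fd_Sp: "fd_subspace (scal A) Sp"
  using V.fd_total fd_Gr by blast

lemma Gr_zero [simp]: "g \<in> carrier G \<Longrightarrow> 0 \<in> Gr g" and Sp_zero [simp]: "0 \<in> Sp"
  using V.sub V.subspace_0 V.total_subspace by blast+

lemma Gr_scale [simp]: "g \<in> carrier G \<Longrightarrow> a \<in> Gr g \<Longrightarrow> c \<star> a \<in> Gr g"
  and Sp_scale [simp]: "a \<in> Sp \<Longrightarrow> c \<star> a \<in> Sp"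
  using V.sub V.subspace_scale V.total_subspace by blast+

lemma Gr_add: "g \<in> carrier G \<Longrightarrow> a \<in> Gr g \<Longrightarrow> b \<in> Gr g \<Longrightarrow> a + b \<in> Gr g"
  and Sp_add [simp]: "a \<in> Sp \<Longrightarrow> b \<in> Sp \<Longrightarrow> a + b \<in> Sp"
  using V.sub V.subspace_add V.total_subspace by blast+

lemma Gr_diff: "g \<in> carrier G \<Longrightarrow> a \<in> Gr g \<Longrightarrow> b \<in> Gr g \<Longrightarrow> a - b \<in> Gr g"
  using V.sub V.subspace_diff by blast

lemma Sp_sum: "(\<And>i. i \<in> I \<Longrightarrow> f i \<in> Sp) \<Longrightarrow> (\<Sum>i\<in>I. f i) \<in> Sp"
  using V.subspace_sum V.total_subspace by blast

lemma Gr_sum: "g \<in> carrier G \<Longrightarrow> (\<And>i. i \<in> I \<Longrightarrow> f i \<in> Gr g) \<Longrightarrow> (\<Sum>i\<in>I. f i) \<in> Gr g"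
  using V.subspace_sum V.sub by blast

lemma Gr_Sp: "g \<in> carrier G \<Longrightarrow> a \<in> Gr g \<Longrightarrow> a \<in> Sp"
  using V.grd_total by blast

lemma linear_left: "b \<in> Sp \<Longrightarrow> linear_on Sp (scal A) (scal A) (\<lambda>a. a \<cdot> b)"
  and linear_right: "a \<in> Sp \<Longrightarrow> linear_on Sp (scal A) (scal A) (\<lambda>b. a \<cdot> b)"
  using tens by (simp_all add: tensor_hom_def)

lemma linear_act: "f \<in> carrier G \<Longrightarrow> linear_on Sp (scal A) (scal A) (act A f)"
  using obj by (simp add: zobject_def)

lemma mul_add_left: "a \<in> Sp \<Longrightarrow> a' \<in> Sp \<Longrightarrow> b \<in> Sp \<Longrightarrow> (a + a') \<cdot> b = a \<cdot> b + a' \<cdot> b"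
  and mul_scale_left: "a \<in> Sp \<Longrightarrow> b \<in> Sp \<Longrightarrow> (c \<star> a) \<cdot> b = c \<star> (a \<cdot> b)"
  using linear_onD[OF linear_left] by blast+

lemma mul_add_right: "b \<in> Sp \<Longrightarrow> b' \<in> Sp \<Longrightarrow> a \<in> Sp \<Longrightarrow> a \<cdot> (b + b') = a \<cdot> b + a \<cdot> b'"
  and mul_scale_right: "a \<in> Sp \<Longrightarrow> b \<in> Sp \<Longrightarrow> a \<cdot> (c \<star> b) = c \<star> (a \<cdot> b)"
  using linear_onD[OF linear_right] by blast+

lemma mul_sum_left: "(\<And>i. i \<in> I \<Longrightarrow> f i \<in> Sp) \<Longrightarrow> b \<in> Sp \<Longrightarrow> (\<Sum>i\<in>I. f i) \<cdot> b = (\<Sum>i\<in>I. f i \<cdot> b)"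
  by (rule V.linear_on_sum[OF linear_left V.total_subspace])

lemma mul_sum_right: "(\<And>i. i \<in> I \<Longrightarrow> f i \<in> Sp) \<Longrightarrow> a \<in> Sp \<Longrightarrow> a \<cdot> (\<Sum>i\<in>I. f i) = (\<Sum>i\<in>I. a \<cdot> f i)"
  by (rule V.linear_on_sum[OF linear_right V.total_subspace])

lemma mul_diff_left: "a \<in> Sp \<Longrightarrow> a' \<in> Sp \<Longrightarrow> b \<in> Sp \<Longrightarrow> (a - a') \<cdot> b = a \<cdot> b - a' \<cdot> b"
  by (rule V.linear_on_diff[OF linear_left V.total_subspace])

lemma mul_diff_right: "b \<in> Sp \<Longrightarrow> b' \<in> Sp \<Longrightarrow> a \<in> Sp \<Longrightarrow> a \<cdot> (b - b') = a \<cdot> b - a \<cdot> b'"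
  by (rule V.linear_on_diff[OF linear_right V.total_subspace])

lemma mul_zero_left [simp]: "b \<in> Sp \<Longrightarrow> 0 \<cdot> b = 0"
  by (rule linear_on_zero[OF linear_left Sp_zero])

lemma mul_zero_right [simp]: "a \<in> Sp \<Longrightarrow> a \<cdot> 0 = 0"
  by (rule linear_on_zero[OF linear_right Sp_zero])

lemma mul_Gr: "f \<in> carrier G \<Longrightarrow> g \<in> carrier G \<Longrightarrow> a \<in> Gr f \<Longrightarrow> b \<in> Gr g \<Longrightarrow> a \<cdot> b \<in> Gr (f \<otimes> g)"
  using tens by (simp add: tensor_hom_def)

lemma mul_Gr_one: "g \<in> carrier G \<Longrightarrow> a \<in> Gr \<one> \<Longrightarrow> b \<in> Gr g \<Longrightarrow> a \<cdot> b \<in> Gr g"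
  using mul_Gr[of \<one> g a b] by simp

lemma mul_Sp [simp]: "a \<in> Sp \<Longrightarrow> b \<in> Sp \<Longrightarrow> a \<cdot> b \<in> Sp"
  using tensor_hom_total[OF obj obj obj tens] .

lemma act_Gr: "f \<in> carrier G \<Longrightarrow> g \<in> carrier G \<Longrightarrow> a \<in> Gr g \<Longrightarrow> f \<rhd> a \<in> Gr (cj G f g)"
  and act_Gr_image: "f \<in> carrier G \<Longrightarrow> g \<in> carrier G \<Longrightarrow> act A f ` Gr g = Gr (cj G f g)"
  using obj unfolding zobject_def by blast+

lemma act_Gr_one: "f \<in> carrier G \<Longrightarrow> a \<in> Gr \<one> \<Longrightarrow> f \<rhd> a \<in> Gr \<one>"
  using act_Gr[of f \<one> a] by simp

lemma act_bij: "f \<in> carrier G \<Longrightarrow> bij_betw (act A f) Sp Sp"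
  using obj by (simp add: zobject_def)

lemma act_Sp [simp]: "f \<in> carrier G \<Longrightarrow> a \<in> Sp \<Longrightarrow> f \<rhd> a \<in> Sp"
  using act_bij by (auto simp: bij_betw_def)

lemma act_inj: "f \<in> carrier G \<Longrightarrow> a \<in> Sp \<Longrightarrow> b \<in> Sp \<Longrightarrow> f \<rhd> a = f \<rhd> b \<Longrightarrow> a = b"
  using act_bij by (auto simp: bij_betw_def inj_on_def)

lemma act_add: "f \<in> carrier G \<Longrightarrow> a \<in> Sp \<Longrightarrow> b \<in> Sp \<Longrightarrow> f \<rhd> (a + b) = f \<rhd> a + f \<rhd> b"
  and act_scale: "f \<in> carrier G \<Longrightarrow> a \<in> Sp \<Longrightarrow> f \<rhd> (c \<star> a) = c \<star> f \<rhd> a"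
  using linear_onD[OF linear_act] by blast+

lemma act_zero [simp]: "f \<in> carrier G \<Longrightarrow> f \<rhd> 0 = 0"
  by (rule linear_on_zero[OF linear_act Sp_zero])

lemma act_sum: "f \<in> carrier G \<Longrightarrow> (\<And>i. i \<in> I \<Longrightarrow> x i \<in> Sp) \<Longrightarrow> f \<rhd> (\<Sum>i\<in>I. x i) = (\<Sum>i\<in>I. f \<rhd> x i)"
  by (rule V.linear_on_sum[OF linear_act V.total_subspace])

lemma act_comp:
  "f \<in> carrier G \<Longrightarrow> g \<in> carrier G \<Longrightarrow> h \<in> carrier G \<Longrightarrow> a \<in> Gr h \<Longrightarrow>
    (f \<otimes> g) \<rhd> a = acoef G \<alpha> f g h \<star> f \<rhd> g \<rhd> a"
  using obj by (simp add: zobject_def)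

text \<open>\<open>acoef\<close> with last argument the identity is 1, so in degree
  \<open>\<one>\<close> the projective action is an honest one; orbits and stabilisers of
  idempotents make sense because of this.\<close>

lemma act_comp_one: "f \<in> carrier G \<Longrightarrow> g \<in> carrier G \<Longrightarrow> a \<in> Gr \<one> \<Longrightarrow> (f \<otimes> g) \<rhd> a = f \<rhd> g \<rhd> a"
  using act_comp[of f g \<one> a] by simp

lemma act_one_Gr: "g \<in> carrier G \<Longrightarrow> a \<in> Gr g \<Longrightarrow> \<one> \<rhd> a = a"
  by (rule zobject_act_one[OF obj])

lemma act_one [simp]: "a \<in> Sp \<Longrightarrow> \<one> \<rhd> a = a"
  by (rule V.linear_on_eqI[where \<phi> = "act A \<one>" and \<psi> = "\<lambda>a. a" and t = "scal A"])
    (use linear_act act_one_Gr in \<open>auto simp: linear_on_def\<close>)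

lemma act_mul:
  "f \<in> carrier G \<Longrightarrow> g \<in> carrier G \<Longrightarrow> h \<in> carrier G \<Longrightarrow> a \<in> Gr g \<Longrightarrow> b \<in> Gr h \<Longrightarrow>
    f \<rhd> (a \<cdot> b) = tcoef G \<alpha> f g h \<star> ((f \<rhd> a) \<cdot> (f \<rhd> b))"
  using tens by (simp add: tensor_hom_def)

lemma act_mul_one:
  assumes f: "f \<in> carrier G" and a: "a \<in> Gr \<one>" and b: "b \<in> Sp"
  shows "f \<rhd> (a \<cdot> b) = (f \<rhd> a) \<cdot> (f \<rhd> b)"
proof (rule V.linear_on_eqI[where t = "scal A", OF _ _ _ b])
  have aS: "a \<in> Sp" using a Gr_Sp by blast
  show "linear_on Sp (scal A) (scal A) (\<lambda>b. f \<rhd> (a \<cdot> b))"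
    using f aS by (simp add: linear_on_def mul_add_right mul_scale_right act_add act_scale)
  show "linear_on Sp (scal A) (scal A) (\<lambda>b. (f \<rhd> a) \<cdot> (f \<rhd> b))"
    using f aS by (simp add: linear_on_def mul_add_right mul_scale_right act_add act_scale)
  show "f \<rhd> (a \<cdot> b) = (f \<rhd> a) \<cdot> (f \<rhd> b)" if "g \<in> carrier G" "b \<in> Gr g" for g b
    using act_mul[of f \<one> g a b] that a f by simp
qed

lemma assoc:
  "f \<in> carrier G \<Longrightarrow> g \<in> carrier G \<Longrightarrow> h \<in> carrier G \<Longrightarrow> a \<in> Gr f \<Longrightarrow> b \<in> Gr g \<Longrightarrow> c \<in> Gr h \<Longrightarrow>
    a \<cdot> (b \<cdot> c) = \<alpha> f g h \<star> (a \<cdot> b \<cdot> c)"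
  using alg by (simp add: zalgebra_def)

text \<open>The associator is 1 when its first argument is the identity; linearity in
  \<open>c\<close> and then in \<open>b\<close> removes homogeneity.\<close>

lemma assoc_one:
  assumes a: "a \<in> Gr \<one>" and b: "b \<in> Sp" and c: "c \<in> Sp"
  shows "a \<cdot> b \<cdot> c = a \<cdot> (b \<cdot> c)"
proof -
  have aS: "a \<in> Sp" using a Gr_Sp by blast
  have hom: "a \<cdot> b \<cdot> c = a \<cdot> (b \<cdot> c)" if g: "g \<in> carrier G" "b \<in> Gr g" for g b
  proof (rule V.linear_on_eqI[where t = "scal A", OF _ _ _ c])
    have bS: "b \<in> Sp" using that Gr_Sp by blast
    show "linear_on Sp (scal A) (scal A) (\<lambda>c. a \<cdot> b \<cdot> c)" using aS bS linear_right by simp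
    show "linear_on Sp (scal A) (scal A) (\<lambda>c. a \<cdot> (b \<cdot> c))"
      using aS bS by (simp add: linear_on_def mul_add_right mul_scale_right)
    show "a \<cdot> b \<cdot> c = a \<cdot> (b \<cdot> c)" if "h \<in> carrier G" "c \<in> Gr h" for h c
      using assoc[of \<one> g h a b c] that a g by simp
  qed
  show ?thesis
  proof (rule V.linear_on_eqI[where t = "scal A", OF _ _ _ b])
    show "linear_on Sp (scal A) (scal A) (\<lambda>b. a \<cdot> b \<cdot> c)"
      using aS c by (simp add: linear_on_def mul_add_right mul_scale_right mul_add_left mul_scale_left)
    show "linear_on Sp (scal A) (scal A) (\<lambda>b. a \<cdot> (b \<cdot> c))"
      using aS c by (simp add: linear_on_def mul_add_right mul_scale_right mul_add_left mul_scale_left)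
  qed (use hom in blast)
qed

lemma unit_Gr [simp]: "unit \<in> Gr \<one>" and act_unit [simp]: "f \<in> carrier G \<Longrightarrow> f \<rhd> unit = unit"
  and unit_left [simp]: "a \<in> Sp \<Longrightarrow> unit \<cdot> a = a" and unit_right [simp]: "a \<in> Sp \<Longrightarrow> a \<cdot> unit = a"
  using alg by (simp_all add: zalgebra_def)

lemma unit_Sp [simp]: "unit \<in> Sp"
  using Gr_Sp unit_Gr by blast

end

section \<open>Commutative algebras and the splitting by invariant idempotents\<close>

locale comm_graded_algebra = graded_algebra +
  assumes comm: "commutative G A"
begin

lemma commute:
  "f \<in> carrier G \<Longrightarrow> g \<in> carrier G \<Longrightarrow> a \<in> Gr f \<Longrightarrow> b \<in> Gr g \<Longrightarrow> a \<cdot> b = (f \<rhd> b) \<cdot> a"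
  using comm by (simp add: commutative_def braid_def)

text \<open>Moving \<open>a\<close> past \<open>b\<close> makes the degree of \<open>a\<close> act
  on \<open>b\<close>; that degree is \<open>\<one>\<close>, so the braiding is the plain
  flip.\<close>

lemma central:
  assumes a: "a \<in> Gr \<one>" and b: "b \<in> Sp"
  shows "b \<cdot> a = a \<cdot> b"
proof (rule V.linear_on_eqI[where t = "scal A", OF _ _ _ b])
  show "linear_on Sp (scal A) (scal A) (\<lambda>b. b \<cdot> a)" using linear_left[OF Gr_Sp[OF one_closed a]] .
  show "linear_on Sp (scal A) (scal A) (\<lambda>b. a \<cdot> b)" using linear_right[OF Gr_Sp[OF one_closed a]] .
  show "b \<cdot> a = a \<cdot> b" if "g \<in> carrier G" "b \<in> Gr g" for g b
    using commute[of \<one> g a b] act_one_Gr that a by simp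
qed

text \<open>With the identity in the middle slot the associator is again 1, so \<open>a\<close> may
  be bracketed with \<open>b\<close>; centrality then brings \<open>a\<close> to the front.\<close>

lemma left_commute_one:
  assumes a: "a \<in> Gr \<one>" and b: "b \<in> Sp" and c: "c \<in> Sp"
  shows "b \<cdot> (a \<cdot> c) = a \<cdot> (b \<cdot> c)"
proof -
  have aS: "a \<in> Sp" using a Gr_Sp by blast
  have hom: "b \<cdot> (a \<cdot> c) = (b \<cdot> a) \<cdot> c" if g: "g \<in> carrier G" "b \<in> Gr g" for g b
  proof (rule V.linear_on_eqI[where t = "scal A", OF _ _ _ c])
    have bS: "b \<in> Sp" using that Gr_Sp by blast
    show "linear_on Sp (scal A) (scal A) (\<lambda>c. b \<cdot> a \<cdot> c)" using aS bS linear_right by simp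
    show "linear_on Sp (scal A) (scal A) (\<lambda>c. b \<cdot> (a \<cdot> c))"
      using aS bS by (simp add: linear_on_def mul_add_right mul_scale_right)
    show "b \<cdot> (a \<cdot> c) = b \<cdot> a \<cdot> c" if "h \<in> carrier G" "c \<in> Gr h" for h c
      using assoc[of g \<one> h b a c] that a g by simp
  qed
  have "b \<cdot> (a \<cdot> c) = (b \<cdot> a) \<cdot> c"
  proof (rule V.linear_on_eqI[where t = "scal A", OF _ _ _ b])
    show "linear_on Sp (scal A) (scal A) (\<lambda>b. b \<cdot> a \<cdot> c)"
      using aS c by (simp add: linear_on_def mul_add_right mul_scale_right mul_add_left mul_scale_left)
    show "linear_on Sp (scal A) (scal A) (\<lambda>b. b \<cdot> (a \<cdot> c))"
      using aS c by (simp add: linear_on_def mul_add_right mul_scale_right mul_add_left mul_scale_left)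
  qed (use hom in blast)
  then show ?thesis using central[OF a b] assoc_one[OF a b c] by simp
qed

text \<open>The Peirce corner. It borrows action and product from \<open>A\<close>, so invariance of
  \<open>q\<close> is what keeps it stable under \<open>G\<close>, and idempotence is what makes
  \<open>q\<close> its unit.\<close>

definition corner where
  "corner q = \<lparr>scal = scal A, grd = \<lambda>g. (\<lambda>a. q \<cdot> a) ` Gr g, act = act A, amul = amul A, aunit = q\<rparr>"

definition invariant_idempotent where
  "invariant_idempotent q \<longleftrightarrow> q \<in> Gr \<one> \<and> q \<cdot> q = q \<and> (\<forall>f\<in>carrier G. f \<rhd> q = q)"

lemma zalgebra_corner:
  assumes q: "invariant_idempotent q"
  shows "zalgebra G \<alpha> (corner q)"
proof -
  have qG: "q \<in> Gr \<one>" and qq: "q \<cdot> q = q" and qinv: "\<And>f. f \<in> carrier G \<Longrightarrow> f \<rhd> q = q"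
    using q by (auto simp: invariant_idempotent_def)
  have qS: "q \<in> Sp" using qG Gr_Sp by blast
  \<comment> \<open>As \<open>q\<close> is idempotent, the image of multiplication by
    \<open>q\<close> is its fixed space; every closure property is checked on the equation
    \<open>q \<cdot> a = a\<close>.\<close>
  have mem: "a \<in> (\<lambda>a. q \<cdot> a) ` Gr g \<longleftrightarrow> a \<in> Gr g \<and> q \<cdot> a = a" if "g \<in> carrier G" for a g
  proof
    assume "a \<in> (\<lambda>a. q \<cdot> a) ` Gr g"
    then obtain b where b: "b \<in> Gr g" "a = q \<cdot> b" by blast
    then show "a \<in> Gr g \<and> q \<cdot> a = a"
      using mul_Gr_one[OF that qG] assoc_one[OF qG qS, of b] qq Gr_Sp[OF that] by simp
  next
    assume "a \<in> Gr g \<and> q \<cdot> a = a"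
    then show "a \<in> (\<lambda>a. q \<cdot> a) ` Gr g" by (auto intro!: image_eqI[where x = a])
  qed
  have sub: "(\<lambda>a. q \<cdot> a) ` Gr g \<subseteq> Gr g" if "g \<in> carrier G" for g using mem[OF that] by blast
  have tot: "space G (corner q) \<subseteq> Sp" using total_mono[of G "grd (corner q)" Gr] sub by (simp add: corner_def)
  have zobj: "zobject G \<alpha> (corner q)"
  proof (rule zobjectI)
    show "vector_space (scal (corner q))" by (simp add: corner_def V.vector_space_axioms)
    show "fd_subspace (scal (corner q)) (grd (corner q) g)" if g: "g \<in> carrier G" for g
    proof -
      have "linear_on (Gr g) (scal A) (scal A) (\<lambda>a. q \<cdot> a)"
        using linear_on_subset[OF linear_right[OF qS]] Gr_Sp[OF g] by blast
      then show ?thesis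
        using V.fd_subspace_image[OF V.vector_space_axioms _ fd_Gr[OF g]] by (simp add: corner_def)
    qed
    show "direct G (grd (corner q))" using direct_subset[OF V.dir] sub by (simp add: corner_def)
    show "linear_on (space G (corner q)) (scal (corner q)) (scal (corner q)) (act (corner q) f)"
      if "f \<in> carrier G" for f
      using linear_on_subset[OF linear_act[OF that] tot] by (simp add: corner_def)
    show "act (corner q) f v \<in> grd (corner q) (cj G f g)"
      if "f \<in> carrier G" "g \<in> carrier G" "v \<in> grd (corner q) g" for f g v
      using that mem[of g v] mem[of "cj G f g" "f \<rhd> v"] act_Gr[of f g v] act_mul_one[of f q v] qG qinv Gr_Sp
      by (simp add: corner_def)
    show "act (corner q) \<one> v = v" if "g \<in> carrier G" "v \<in> grd (corner q) g" for g v
      using that mem act_one_Gr by (simp add: corner_def)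
    show "act (corner q) (f \<otimes> g) v
        = scal (corner q) (acoef G \<alpha> f g h) (act (corner q) f (act (corner q) g v))"
      if "f \<in> carrier G" "g \<in> carrier G" "h \<in> carrier G" "v \<in> grd (corner q) h" for f g h v
      using that mem act_comp by (simp add: corner_def)
  qed
  have totq: "q \<cdot> a = a" if "a \<in> space G (corner q)" for a
  proof -
    obtain x where x: "\<forall>g\<in>carrier G. x g \<in> (\<lambda>a. q \<cdot> a) ` Gr g" "a = (\<Sum>g\<in>carrier G. x g)"
      using \<open>a \<in> space G (corner q)\<close> by (auto simp: corner_def total_def)
    then have "\<And>g. g \<in> carrier G \<Longrightarrow> x g \<in> Sp \<and> q \<cdot> x g = x g" using mem Gr_Sp by blast
    then show ?thesis using mul_sum_right[of "carrier G" x q] qS x(2) by simp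
  qed
  have mulmem: "a \<cdot> b \<in> (\<lambda>a. q \<cdot> a) ` Gr (g \<otimes> h)"
    if "g \<in> carrier G" "h \<in> carrier G" "a \<in> (\<lambda>a. q \<cdot> a) ` Gr g" "b \<in> (\<lambda>a. q \<cdot> a) ` Gr h" for a b g h
    using that mem[of g a] mem[of h b] mem[of "g \<otimes> h" "a \<cdot> b"] mul_Gr[of g h a b] assoc_one[OF qG, of a b] Gr_Sp
    by (metis m_closed)
  have "tensor_hom G \<alpha> (corner q) (corner q) (corner q) (amul (corner q))"
    unfolding tensor_hom_def
  proof (intro conjI ballI)
    fix y assume "y \<in> space G (corner q)"
    then have y: "y \<in> Sp" using tot by blast
    show "linear_on (space G (corner q)) (scal (corner q)) (scal (corner q)) (\<lambda>x. amul (corner q) x y)"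
      using linear_on_subset[OF linear_left[OF y] tot] by (simp add: corner_def)
    show "linear_on (space G (corner q)) (scal (corner q)) (scal (corner q)) (amul (corner q) y)"
      using linear_on_subset[OF linear_right[OF y] tot] by (simp add: corner_def)
  next
    fix g h x y assume "g \<in> carrier G" "h \<in> carrier G" "x \<in> grd (corner q) g" "y \<in> grd (corner q) h"
    then show "amul (corner q) x y \<in> grd (corner q) (g \<otimes> h)" using mulmem by (simp add: corner_def)
  next
    fix g h x y f
    assume "g \<in> carrier G" "h \<in> carrier G" "x \<in> grd (corner q) g" "y \<in> grd (corner q) h" "f \<in> carrier G"
    then show "act (corner q) f (amul (corner q) x y)
        = scal (corner q) (tcoef G \<alpha> f g h) (amul (corner q) (act (corner q) f x) (act (corner q) f y))"
      using act_mul mem by (simp add: corner_def)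
  qed
  moreover have "amul (corner q) a (aunit (corner q)) = a \<and> amul (corner q) (aunit (corner q)) a = a"
    if "a \<in> space G (corner q)" for a
    using totq[OF that] central[OF qG] tot that by (auto simp: corner_def)
  moreover have "aunit (corner q) \<in> grd (corner q) \<one>" using qG qq mem[of \<one> q] by (simp add: corner_def)
  moreover have "\<forall>f\<in>carrier G. act (corner q) f (aunit (corner q)) = aunit (corner q)"
    using qinv by (simp add: corner_def)
  moreover have "amul (corner q) a (amul (corner q) b c)
      = scal (corner q) (\<alpha> f g h) (amul (corner q) (amul (corner q) a b) c)"
    if "f \<in> carrier G" "g \<in> carrier G" "h \<in> carrier G" "a \<in> grd (corner q) f" "b \<in> grd (corner q) g"
      "c \<in> grd (corner q) h" for f g h a b c
    using that mem assoc by (simp add: corner_def)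
  ultimately show ?thesis unfolding zalgebra_def using zobj by blast
qed

text \<open>Otherwise \<open>q\<close> and its complement \<open>r\<close> are nonzero orthogonal
  central idempotents, both invariant, and sending \<open>a\<close> to
  \<open>(q \<cdot> a, r \<cdot> a)\<close> splits \<open>A\<close> into the two corners, against
  indecomposability.\<close>

lemma invariant_idempotent_trivial:
  assumes ind: "indecomposable G \<alpha> A" and q: "invariant_idempotent q" and "q \<noteq> 0"
  shows "q = unit"
proof (rule ccontr)
  assume "q \<noteq> unit"
  define r where "r = unit - q"
  have qG: "q \<in> Gr \<one>" and qq: "q \<cdot> q = q" and qinv: "\<And>f. f \<in> carrier G \<Longrightarrow> f \<rhd> q = q"
    using q by (auto simp: invariant_idempotent_def)
  have qS: "q \<in> Sp" using qG Gr_Sp by blast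
  have rG: "r \<in> Gr \<one>" using qG Gr_diff unit_Gr by (simp add: r_def)
  then have rS: "r \<in> Sp" using Gr_Sp by blast
  have rmul: "r \<cdot> a = a - q \<cdot> a" if "a \<in> Sp" for a using that qS by (simp add: r_def mul_diff_left)
  have qr: "q \<cdot> r = 0" using qS qq by (simp add: r_def mul_diff_right)
  have rq: "r \<cdot> q = 0" using rmul[OF qS] qq by simp
  have rr: "r \<cdot> r = r" using rmul[OF rS] qr by simp
  have r: "invariant_idempotent r"
    using rG rr qinv qS V.linear_on_diff[OF linear_act V.total_subspace, of _ unit q]
    by (simp add: invariant_idempotent_def) (simp add: r_def)
  have B: "zalgebra G \<alpha> (corner q)" and C: "zalgebra G \<alpha> (corner r)"
    using zalgebra_corner q r by blast+
  have oB: "zobject G \<alpha> (corner q)" and oC: "zobject G \<alpha> (corner r)"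
    using B C by (simp_all add: zalgebra_def)
  interpret B: graded_sum "scal (corner q)" G "grd (corner q)" using graded_sum_zobject oB by blast
  interpret C: graded_sum "scal (corner r)" G "grd (corner r)" using graded_sum_zobject oC by blast
  have gcorner: "grd (corner x) g = (\<lambda>a. x \<cdot> a) ` Gr g" and scorner: "scal (corner x) = scal A"
    and acorner: "act (corner x) = act A" and mcorner: "amul (corner x) = amul A" and ucorner: "aunit (corner x) = x"
    for x g by (simp_all add: corner_def)
  have "q \<in> space G (corner q)" "r \<in> space G (corner r)"
    using B C B.grd_total[of \<one> q] C.grd_total[of \<one> r] by (auto simp: zalgebra_def ucorner)
  moreover have "r \<noteq> 0" using \<open>q \<noteq> unit\<close> by (simp add: r_def)
  ultimately have nz: "space G (corner q) \<noteq> {0}" "space G (corner r) \<noteq> {0}" using \<open>q \<noteq> 0\<close> by auto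
  let ?S = "alg_sum (corner q) (corner r)"
  define \<phi> where "\<phi> a = (q \<cdot> a, r \<cdot> a)" for a
  have vs: "vector_space (scal ?S)"
    using vector_space_prod[OF B.vector_space_axioms C.vector_space_axioms] by (simp add: alg_sum_def)
  have lin: "linear_on Sp (scal A) (scal ?S) \<phi>"
    by (simp add: linear_on_def \<phi>_def alg_sum_def scorner mul_add_right mul_scale_right qS rS)
  have S: "graded_sum (scal ?S) G (grd ?S)"
  proof -
    interpret S: vector_space "scal ?S" by (rule vs)
    show ?thesis
    proof
      show "finite (carrier G)" by (rule fin)
      show "S.subspace (grd ?S g)" if "g \<in> carrier G" for g
        using B.sub[OF that] C.sub[OF that]
        unfolding S.subspace_def B.subspace_def C.subspace_def by (auto simp: alg_sum_def zero_prod_def)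
      show "direct G (grd ?S)"
        unfolding direct_def
      proof (intro allI impI ballI)
        fix x g assume x: "(\<forall>g\<in>carrier G. x g \<in> grd ?S g) \<and> sum x (carrier G) = 0" and g: "g \<in> carrier G"
        have "(\<Sum>g\<in>carrier G. fst (x g)) = 0" "(\<Sum>g\<in>carrier G. snd (x g)) = 0"
          using x by (metis fst_sum fst_zero, metis snd_sum snd_zero)
        moreover have "\<forall>g\<in>carrier G. fst (x g) \<in> grd (corner q) g" "\<forall>g\<in>carrier G. snd (x g) \<in> grd (corner r) g"
          using x by (auto simp: alg_sum_def)
        ultimately have "fst (x g) = 0" "snd (x g) = 0"
          using B.dir C.dir g by (auto simp: direct_def)
        then show "x g = 0" by (simp add: prod_eq_iff)
      qed
    qed
  qed
  have im: "\<phi> ` Gr g = grd ?S g" if g: "g \<in> carrier G" for g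
  proof
    show "\<phi> ` Gr g \<subseteq> grd ?S g" by (auto simp: \<phi>_def alg_sum_def gcorner)
    show "grd ?S g \<subseteq> \<phi> ` Gr g"
    proof
      fix z assume "z \<in> grd ?S g"
      then obtain a b where ab: "a \<in> Gr g" "b \<in> Gr g" "z = (q \<cdot> a, r \<cdot> b)"
        by (auto simp: alg_sum_def gcorner)
      then have abS: "a \<in> Sp" "b \<in> Sp" using Gr_Sp g by blast+
      \<comment> \<open>Orthogonality of \<open>q\<close> and \<open>r\<close> shows that the sum of
        the two components is a preimage of the pair.\<close>
      have "q \<cdot> (q \<cdot> a + r \<cdot> b) = q \<cdot> a"
        using abS qS rS assoc_one[OF qG qS, of a] assoc_one[OF qG rS, of b] qq qr by (simp add: mul_add_right)
      moreover have "r \<cdot> (q \<cdot> a + r \<cdot> b) = r \<cdot> b"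
        using abS qS rS assoc_one[OF rG qS, of a] assoc_one[OF rG rS, of b] rq rr by (simp add: mul_add_right)
      moreover have "q \<cdot> a + r \<cdot> b \<in> Gr g" using ab qG rG g by (simp add: Gr_add mul_Gr_one)
      ultimately show "z \<in> \<phi> ` Gr g" using ab(3) by (auto simp: \<phi>_def intro!: image_eqI[where x = "q \<cdot> a + r \<cdot> b"])
    qed
  qed
  have ker: "v = 0" if "v \<in> Sp" "\<phi> v = 0" for v
  proof -
    have "q \<cdot> v = 0" and "r \<cdot> v = 0" using that(2) by (simp_all add: \<phi>_def prod_eq_iff)
    then show ?thesis using rmul[OF that(1)] by simp
  qed
  have "bij_betw \<phi> Sp (space G ?S)"
    using V.bij_betw_total[OF S lin im] ker Gr_Sp by blast
  moreover have "zhom G A ?S \<phi>"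
  proof -
    have "act A f (x \<cdot> v) = x \<cdot> (f \<rhd> v)" if "x \<in> Gr \<one>" "f \<rhd> x = x" "f \<in> carrier G" "v \<in> Sp" for x f v
      using act_mul_one that by simp
    then have "\<phi> (act A f v) = act ?S f (\<phi> v)" if "f \<in> carrier G" "v \<in> Sp" for f v
      using that q r by (simp add: \<phi>_def alg_sum_def acorner invariant_idempotent_def)
    then show ?thesis using lin im by (simp add: zhom_def)
  qed
  moreover have "\<phi> (a \<cdot> b) = amul ?S (\<phi> a) (\<phi> b)" if "a \<in> Sp" "b \<in> Sp" for a b
  proof -
    have "x \<cdot> (a \<cdot> b) = x \<cdot> a \<cdot> (x \<cdot> b)" if "x \<in> Gr \<one>" "x \<cdot> x = x" for x
    proof -
      have x: "x \<in> Sp" using that Gr_Sp by blast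
      have "x \<cdot> a \<cdot> (x \<cdot> b) = x \<cdot> (x \<cdot> (a \<cdot> b))"
        using that x \<open>a \<in> Sp\<close> \<open>b \<in> Sp\<close> assoc_one[of x a "x \<cdot> b"] left_commute_one[of x a b] by simp
      then show ?thesis using that x \<open>a \<in> Sp\<close> \<open>b \<in> Sp\<close> assoc_one[of x x "a \<cdot> b"] by simp
    qed
    then show ?thesis using q r by (simp add: \<phi>_def alg_sum_def mcorner invariant_idempotent_def)
  qed
  moreover have "\<phi> unit = aunit ?S" using qS rS by (simp add: \<phi>_def alg_sum_def ucorner)
  ultimately have "alg_isomorphic G A ?S" unfolding alg_isomorphic_def by blast
  then show False using ind nz B C unfolding indecomposable_def by blast
qed

end

section \<open>Etale algebras\<close>

locale etale_algebra = comm_graded_algebra G \<alpha> A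
  for G (structure) and \<alpha> :: "'a \<Rightarrow> 'a \<Rightarrow> 'a \<Rightarrow> 'k::{alg_closed_field, field_char_0}"
    and A :: "('a, 'k, 'v::ab_group_add) zalg" +
  assumes ind: "indecomposable G \<alpha> A" and sep: "separable G A"
begin

lemma one_Sp: "a \<in> Gr \<one> \<Longrightarrow> a \<in> Sp"
  by (rule Gr_Sp[OF one_closed])

lemma one_mul: "a \<in> Gr \<one> \<Longrightarrow> b \<in> Gr \<one> \<Longrightarrow> a \<cdot> b \<in> Gr \<one>"
  by (simp add: mul_Gr_one)

lemma trace_square_zero:
  assumes "c \<in> Gr \<one>" "c \<cdot> c = 0"
  shows "trace_on (scal A) Sp (amul A c) = 0"
proof (rule V.trace_on_square_zero[OF fd_Sp])
  show "linear_on Sp (scal A) (scal A) (amul A c)" using assms one_Sp linear_right by blast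
  show "amul A c ` Sp \<subseteq> Sp" using assms one_Sp by auto
  show "c \<cdot> (c \<cdot> w) = 0" if "w \<in> Sp" for w
    using assoc_one[of c c w] assms that one_Sp by simp
qed

text \<open>A square-zero \<open>a\<close> is in the radical of the trace form: only the degree
  \<open>\<one>\<close> part of \<open>b\<close> contributes to the trace of
  \<open>a \<cdot> b\<close>, and its product with \<open>a\<close> is square-zero again by
  centrality.\<close>

lemma reduced:
  assumes a: "a \<in> Gr \<one>" "a \<cdot> a = 0"
  shows "a = 0"
proof -
  have aS: "a \<in> Sp" using a one_Sp by blast
  have "canonical_trace G A (a \<cdot> b) = 0" if b: "b \<in> Sp" for b
  proof -
    let ?b = "hom_part G Gr b \<one>"
    have bG: "?b \<in> Gr \<one>" using V.hom_part(1)[OF b] by simp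
    then have bS: "?b \<in> Sp" using one_Sp by blast
    have "hom_part G Gr (a \<cdot> b) \<one> = a \<cdot> ?b"
      by (rule V.hom_part_image[OF V.graded_sum_axioms linear_right[OF aS]]) (use a b mul_Gr_one in auto)
    moreover have "a \<cdot> ?b \<cdot> (a \<cdot> ?b) = 0"
      using assoc_one[OF a(1) bS, of "a \<cdot> ?b"] left_commute_one[OF a(1) bS bS] assoc_one[OF a(1) aS, of "?b \<cdot> ?b"]
        a aS bS by simp
    ultimately show ?thesis
      using trace_square_zero[of "a \<cdot> ?b"] one_mul[OF a(1) bG] by (simp add: canonical_trace_def)
  qed
  then show ?thesis using sep aS by (simp add: separable_def)
qed

text \<open>The trace form sees only degree \<open>\<one>\<close>, so nondegeneracy must already be
  witnessed by the component of \<open>b\<close> in the inverse degree.\<close>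

lemma pairing:
  assumes g: "g \<in> carrier G" and a: "a \<in> Gr g" and nz: "a \<noteq> 0"
  obtains b where "b \<in> Gr (inv g)" "a \<cdot> b \<noteq> 0"
proof -
  have aS: "a \<in> Sp" using a g Gr_Sp by blast
  obtain b where b: "b \<in> Sp" "canonical_trace G A (a \<cdot> b) \<noteq> 0"
    using sep aS nz by (auto simp: separable_def)
  let ?b = "hom_part G Gr b"
  have bG: "?b h \<in> Gr h" if "h \<in> carrier G" for h using V.hom_part(1)[OF b(1) that] .
  have "a \<cdot> ?b (inv g) \<noteq> 0"
  proof
    assume z: "a \<cdot> ?b (inv g) = 0"
    have "hom_part G Gr (a \<cdot> ?b h) \<one> = 0" if h: "h \<in> carrier G" for h
    proof (cases "g \<otimes> h = \<one>")
      case True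
      then have "h = inv g" using g h by (metis inv_equality inv_inv)
      then show ?thesis using z V.hom_part_homogeneous[of \<one> 0 \<one>] by simp
    next
      case False
      then show ?thesis using V.hom_part_homogeneous[OF _ mul_Gr[OF g h a bG[OF h]], of \<one>] g h by simp
    qed
    moreover have "a \<cdot> b = (\<Sum>h\<in>carrier G. a \<cdot> ?b h)"
      using V.linear_on_hom_parts[OF linear_right[OF aS] b(1)] .
    then have "hom_part G Gr (a \<cdot> b) \<one> = (\<Sum>h\<in>carrier G. hom_part G Gr (a \<cdot> ?b h) \<one>)"
      using V.linear_on_sum[OF V.hom_part_linear[OF one_closed] V.total_subspace, of "carrier G" "\<lambda>h. a \<cdot> ?b h"]
        bG aS Gr_Sp by simp
    ultimately have "hom_part G Gr (a \<cdot> b) \<one> = 0" by simp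
    \<comment> \<open>The element 0 is square-zero, so the lemma on square-zero operators also
      yields that multiplication by 0 has trace 0.\<close>
    then have "canonical_trace G A (a \<cdot> b) = 0"
      using trace_square_zero[of 0] by (simp add: canonical_trace_def)
    then show False using b(2) by simp
  qed
  then show thesis using that bG g by blast
qed

lemma unit_nz: "unit \<noteq> 0"
proof
  assume "unit = 0"
  then have "a = 0" if "a \<in> Sp" for a using unit_left[OF that] mul_zero_left[OF that] by simp
  then show False using ind Sp_zero by (auto simp: indecomposable_def)
qed

text \<open>The principal ideal generated by \<open>b\<close> in the commutative ring
  \<open>Gr \<one>\<close>, not in the whole algebra.\<close>

definition ideal where "ideal b = (\<lambda>x. b \<cdot> x) ` Gr \<one>"

lemma subspace_ideal:
  assumes "b \<in> Gr \<one>"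
  shows "V.subspace (ideal b)"
proof -
  have "linear_on (Gr \<one>) (scal A) (scal A) (\<lambda>x. b \<cdot> x)"
    using linear_on_subset[OF linear_right] assms one_Sp by blast
  then have "fd_subspace (scal A) (ideal b)"
    unfolding ideal_def using V.fd_subspace_image[OF V.vector_space_axioms] fd_Gr by blast
  then show ?thesis by (rule V.fd_subspace_subspace)
qed

lemma ideal_subset: "b \<in> Gr \<one> \<Longrightarrow> ideal b \<subseteq> Gr \<one>"
  unfolding ideal_def using one_mul by blast

lemma ideal_mono:
  assumes "b \<in> Gr \<one>" "x \<in> ideal b"
  shows "ideal x \<subseteq> ideal b"
proof
  fix y assume "y \<in> ideal x"
  then obtain u v where uv: "u \<in> Gr \<one>" "v \<in> Gr \<one>" "y = b \<cdot> u \<cdot> v" using assms by (auto simp: ideal_def)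
  then have "y = b \<cdot> (u \<cdot> v)" using assoc_one assms(1) one_Sp by simp
  then show "y \<in> ideal b" using uv one_mul by (auto simp: ideal_def)
qed

text \<open>Take \<open>b\<close> with \<open>ideal b\<close> nonzero of least dimension; each
  nonzero element of it then generates the whole ideal. As \<open>b \<cdot> b\<close> is nonzero by
  reducedness, \<open>b = b \<cdot> b \<cdot> c\<close> for some \<open>c\<close>, and
  \<open>p = b \<cdot> c\<close> is the unit of this ideal, which is a field.\<close>

lemma minimal_idempotent:
  obtains p where "p \<in> Gr \<one>" "p \<noteq> 0" "p \<cdot> p = p"
    "\<And>x. x \<in> Gr \<one> \<Longrightarrow> p \<cdot> x = x \<Longrightarrow> x \<noteq> 0 \<Longrightarrow> \<exists>y\<in>Gr \<one>. x \<cdot> y = p"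
proof -
  obtain b where b: "b \<in> Gr \<one> \<and> b \<noteq> 0"
    and least: "\<And>x. x \<in> Gr \<one> \<and> x \<noteq> 0 \<Longrightarrow> V.dim (ideal b) \<le> V.dim (ideal x)"
    using ex_has_least_nat[of "\<lambda>b. b \<in> Gr \<one> \<and> b \<noteq> 0" unit "\<lambda>b. V.dim (ideal b)"] unit_nz by auto
  have bG: "b \<in> Gr \<one>" and bS: "b \<in> Sp" using b one_Sp by auto
  have fd: "fd_subspace (scal A) (ideal b)"
    using V.fd_subspace_subset[OF fd_Gr[OF one_closed] subspace_ideal[OF bG] ideal_subset[OF bG]] .
  have eq: "ideal x = ideal b" if "x \<in> ideal b" "x \<noteq> 0" for x
  proof (rule ccontr)
    have xG: "x \<in> Gr \<one>" using that ideal_subset[OF bG] by blast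
    assume "ideal x \<noteq> ideal b"
    then have "ideal x \<subset> ideal b" using ideal_mono[OF bG that(1)] by blast
    then show False
      using V.fd_dim_psubset[OF fd subspace_ideal[OF xG]] least[of x] xG that(2) by simp
  qed
  have mem: "x \<in> ideal x" if "x \<in> Gr \<one>" for x
    using that one_Sp unfolding ideal_def by (auto intro!: image_eqI[where x = unit])
  have "b \<cdot> b \<in> ideal b" using bG by (auto simp: ideal_def)
  moreover have "b \<cdot> b \<noteq> 0" using reduced b by blast
  ultimately have "b \<in> ideal (b \<cdot> b)" using eq mem[OF bG] by blast
  then obtain c where c: "c \<in> Gr \<one>" "b = b \<cdot> b \<cdot> c" by (auto simp: ideal_def)
  define p where "p = b \<cdot> c"
  have cS: "c \<in> Sp" using c one_Sp by blast
  have p: "p \<in> Gr \<one>" "p \<in> ideal b" using c bG one_mul by (auto simp: p_def ideal_def)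
  have bp: "b \<cdot> p = b" using c(2) assoc_one[OF bG bS cS] by (simp add: p_def)
  have "p \<noteq> 0" using bp b bS by force
  \<comment> \<open>The product of \<open>b \<cdot> c\<close> with itself is rearranged to
    \<open>b \<cdot> b \<cdot> c \<cdot> c\<close>, and \<open>b \<cdot> b \<cdot> c\<close>
    collapses to \<open>b\<close>.\<close>
  moreover have "p \<cdot> p = p"
    using assoc_one[OF bG cS, of "b \<cdot> c"] left_commute_one[OF bG cS cS] assoc_one[OF bG bS, of "c \<cdot> c"]
      assoc_one[of "b \<cdot> b" c c] c(2) bS cS one_mul[OF bG bG] by (simp add: p_def)
  moreover have "\<exists>y\<in>Gr \<one>. x \<cdot> y = p" if x: "x \<in> Gr \<one>" "p \<cdot> x = x" "x \<noteq> 0" for x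
  proof -
    have "x \<in> ideal p" using x by (metis ideal_def imageI)
    then have "x \<in> ideal b" using ideal_mono[OF bG p(2)] by blast
    then have "p \<in> ideal x" using eq x(3) p(2) by blast
    then show ?thesis by (auto simp: ideal_def)
  qed
  ultimately show thesis using that p(1) by blast
qed

text \<open>The ideal of a minimal idempotent is a finite-dimensional field extension of
  \<open>k\<close> with unit \<open>p\<close>, hence one-dimensional by algebraic closure. The proof
  takes a root \<open>c\<close> of a polynomial of least degree annihilating \<open>a\<close> and
  shows \<open>a = c \<star> p\<close>.\<close>

lemma primitive_idempotent:
  obtains p where "p \<in> Gr \<one>" "p \<noteq> 0" "p \<cdot> p = p" "\<And>a. a \<in> Gr \<one> \<Longrightarrow> \<exists>c. p \<cdot> a = c \<star> p"
proof -
  obtain p where pG: "p \<in> Gr \<one>" and p0: "p \<noteq> 0" and pp: "p \<cdot> p = p"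
    and inv: "\<And>x. x \<in> Gr \<one> \<Longrightarrow> p \<cdot> x = x \<Longrightarrow> x \<noteq> 0 \<Longrightarrow> \<exists>y\<in>Gr \<one>. x \<cdot> y = p"
    using minimal_idempotent by metis
  have pS: "p \<in> Sp" using pG one_Sp by blast
  have "\<exists>c. a = c \<star> p" if a: "a \<in> Gr \<one>" "p \<cdot> a = a" for a
  proof -
    have aS: "a \<in> Sp" using a one_Sp by blast
    \<comment> \<open>Horner evaluation at \<open>a\<close> inside the ideal of \<open>p\<close>:
      constants become multiples of \<open>p\<close>, the unit there, and not of
      \<open>unit\<close>.\<close>
    define ev where "ev f = fold_coeffs (\<lambda>c v. c \<star> p + a \<cdot> v) f 0" for f
    have ev0: "ev 0 = 0" by (simp add: ev_def)
    have ev_pCons: "ev (pCons c f) = c \<star> p + a \<cdot> ev f" for c f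
      by (cases "c = 0 \<and> f = 0") (auto simp: ev_def aS)
    have evG: "ev f \<in> Gr \<one>" for f
      by (induction f) (simp_all add: ev0 ev_pCons Gr_add one_mul a pG)
    then have evS: "ev f \<in> Sp" for f using one_Sp by blast
    have pev: "p \<cdot> ev f = ev f" for f
      by (induction f)
        (use a pp in \<open>simp_all add: ev0 ev_pCons mul_add_right mul_scale_right assoc_one[symmetric] pS pG aS evS\<close>)
    have ev_add: "ev (f + g) = ev f + ev g" for f g
      by (induction f g rule: poly_induct2)
        (simp_all add: ev0 ev_pCons mul_add_right evS aS V.scale_left_distrib add_ac)
    have ev_smult: "ev (smult c f) = c \<star> ev f" for c f
      by (induction f)
        (simp_all add: ev0 ev_pCons mul_scale_right evS aS V.scale_right_distrib)
    have ev_sum: "ev (sum F I) = (\<Sum>i\<in>I. ev (F i))" if "finite I" for F and I :: "nat set"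
      using that by (induction I) (simp_all add: ev0 ev_add)
    \<comment> \<open>Otherwise the powers of \<open>a\<close> with exponents 0 up to
      \<open>card B\<close> would be \<open>card B + 1\<close> independent vectors in a space
      spanned by \<open>card B\<close> vectors.\<close>
    have "\<exists>f. f \<noteq> 0 \<and> ev f = 0"
    proof (rule ccontr)
      assume "\<not> ?thesis"
      then have ker: "\<And>f. ev f = 0 \<Longrightarrow> f = 0" by blast
      obtain B where B: "finite B" "V.span B = Gr \<one>"
        using fd_Gr[OF one_closed] unfolding fd_subspace_def by blast
      define pw where "pw i = ev (monom 1 i)" for i
      have inj: "inj_on pw {..card B}"
      proof (rule inj_onI)
        fix i j assume "pw i = pw j"
        then have "ev (monom 1 i + smult (-1) (monom 1 j)) = 0"
          by (simp only: ev_add ev_smult pw_def) simp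
        then have "monom (1::'k) i + smult (-1) (monom 1 j) = 0" by (rule ker)
        then have "monom (1::'k) i = monom 1 j" by simp
        then show "i = j" by (metis coeff_monom zero_neq_one)
      qed
      have "V.independent (pw ` {..card B})"
      proof (rule V.independent_if_scalars_zero)
        fix u x assume u: "(\<Sum>x\<in>pw ` {..card B}. u x \<star> x) = 0" and x: "x \<in> pw ` {..card B}"
        then obtain i where i: "i \<le> card B" "x = pw i" by blast
        let ?f = "\<Sum>i\<le>card B. monom (u (pw i)) i"
        have "ev (monom c i) = c \<star> pw i" for c i
          using ev_smult[of c "monom 1 i"] by (simp add: pw_def smult_monom)
        then have "ev ?f = (\<Sum>i\<le>card B. u (pw i) \<star> pw i)" by (simp add: ev_sum)
        also have "\<dots> = 0" using u sum.reindex[OF inj, of "\<lambda>x. u x \<star> x"] by simp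
        finally have "coeff ?f i = 0" using ker by fastforce
        then show "u x = 0" using i by (simp add: coeff_sum)
      qed simp
      moreover have "pw ` {..card B} \<subseteq> V.span B" using evG B(2) pw_def by auto
      ultimately have "card (pw ` {..card B}) \<le> card B" using V.independent_span_bound[OF B(1)] by blast
      then show False using card_image[OF inj] by simp
    qed
    then obtain f where f: "f \<noteq> 0 \<and> ev f = 0"
      and least: "\<And>g. g \<noteq> 0 \<and> ev g = 0 \<Longrightarrow> degree f \<le> degree g"
      using ex_has_least_nat[of "\<lambda>f. f \<noteq> 0 \<and> ev f = 0" _ degree] by metis
    have "degree f > 0"
    proof (rule ccontr)
      assume "\<not> degree f > 0"
      then obtain c where "f = [:c:]" using degree_eq_zeroE by blast
      then show False using f p0 by (simp add: ev_pCons ev0 aS)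
    qed
    then obtain c where "poly f c = 0" using alg_closed_imp_poly_has_root by blast
    then obtain g where g: "f = [:- c, 1:] * g" by (metis dvd_def poly_eq_0_iff_dvd)
    have g0: "g \<noteq> 0" using g f by force
    have "degree f = degree [:- c, 1:] + degree g" unfolding g by (rule degree_mult_eq) (use g0 in auto)
    then have evg: "ev g \<noteq> 0" using least[of g] g0 by force
    define x where "x = a - c \<star> p"
    have xG: "x \<in> Gr \<one>" using a pG by (simp add: x_def Gr_diff)
    have "f = smult (- c) g + pCons 0 g" using g by simp
    then have "ev f = - c \<star> ev g + a \<cdot> ev g" by (simp only: ev_add ev_smult ev_pCons) simp
    also have "\<dots> = x \<cdot> ev g"
      using pev[of g] aS pS evS[of g] by (simp add: x_def mul_diff_left mul_scale_left)
    finally have z: "x \<cdot> ev g = 0" using f by simp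
    \<comment> \<open>A nonzero \<open>x\<close> would be invertible in the ideal of
      \<open>p\<close>, and cancelling it from \<open>x \<cdot> ev g = 0\<close> would give
      \<open>ev g = 0\<close> for a \<open>g\<close> of smaller degree than
      \<open>f\<close>.\<close>
    have "x = 0"
    proof (rule ccontr)
      assume "x \<noteq> 0"
      moreover have "p \<cdot> x = x" using a pp pS aS by (simp add: x_def mul_diff_right mul_scale_right)
      ultimately obtain y where y: "y \<in> Gr \<one>" "x \<cdot> y = p" using inv xG by blast
      have "ev g = x \<cdot> y \<cdot> ev g" using pev y by simp
      also have "\<dots> = y \<cdot> (x \<cdot> ev g)"
        using assoc_one[OF xG, of y "ev g"] left_commute_one[OF xG, of y "ev g"] y one_Sp evS by simp
      also have "\<dots> = 0" using z y one_Sp by simp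
      finally show False using evg by simp
    qed
    then show ?thesis by (auto simp: x_def)
  qed
  moreover have "p \<cdot> (p \<cdot> a) = p \<cdot> a" if "a \<in> Gr \<one>" for a
    using assoc_one[OF pG pS, of a] pp that one_Sp by simp
  ultimately show thesis using that[of p] pG p0 pp one_mul by blast
qed

end

section \<open>The primitive idempotent \<open>p\<close>, its orbit and the corner at it\<close>

locale etale_point = etale_algebra G \<alpha> A
  for G (structure) and \<alpha> :: "'a \<Rightarrow> 'a \<Rightarrow> 'a \<Rightarrow> 'k::{alg_closed_field, field_char_0}"
    and A :: "('a, 'k, 'v::ab_group_add) zalg" +
  fixes p :: 'v
  assumes p_Gr: "p \<in> Gr \<one>" and p_nz: "p \<noteq> 0" and p_idem: "p \<cdot> p = p"
    and p_prim: "\<And>a. a \<in> Gr \<one> \<Longrightarrow> \<exists>c. p \<cdot> a = c \<star> p"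
begin

lemma p_Sp [simp]: "p \<in> Sp"
  using p_Gr one_Sp by blast

abbreviation pt where "pt x \<equiv> x \<rhd> p"

lemma pt_Gr: "x \<in> carrier G \<Longrightarrow> pt x \<in> Gr \<one>"
  using act_Gr_one p_Gr by blast

lemma pt_Sp [simp]: "x \<in> carrier G \<Longrightarrow> pt x \<in> Sp"
  by simp

lemma pt_idem: "x \<in> carrier G \<Longrightarrow> pt x \<cdot> pt x = pt x"
  using act_mul_one[of x p p] p_Gr p_idem by simp

lemma pt_nz: "x \<in> carrier G \<Longrightarrow> pt x \<noteq> 0"
  using act_inj[of x p 0] p_nz by auto

lemma pt_pt: "x \<in> carrier G \<Longrightarrow> y \<in> carrier G \<Longrightarrow> x \<rhd> pt y = pt (x \<otimes> y)"
  using act_comp_one p_Gr by simp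

lemma p_fix: "a \<in> Sp \<Longrightarrow> p \<cdot> (p \<cdot> a) = p \<cdot> a"
  using assoc_one[OF p_Gr, of p a] p_idem by simp

lemma p_mul: "a \<in> Sp \<Longrightarrow> b \<in> Sp \<Longrightarrow> p \<cdot> a = a \<Longrightarrow> p \<cdot> (a \<cdot> b) = a \<cdot> b"
  using assoc_one[OF p_Gr, of a b] by simp

definition stab where "stab = {x \<in> carrier G. pt x = p}"

lemma stab_closed: "x \<in> stab \<Longrightarrow> x \<in> carrier G"
  by (simp add: stab_def)

lemma subgroup_stab: "subgroup stab G"
proof (rule subgroupI)
  show "stab \<subseteq> carrier G" by (auto simp: stab_def)
  show "stab \<noteq> {}" using one_closed by (auto simp: stab_def)
  show "inv x \<in> stab" if "x \<in> stab" for x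
    using that pt_pt[of "inv x" x] by (simp add: stab_def)
  show "x \<otimes> y \<in> stab" if "x \<in> stab" "y \<in> stab" for x y
    using that pt_pt[of x y] by (simp add: stab_def)
qed

text \<open>The product is a multiple of \<open>p\<close> and also of \<open>pt x\<close>, by
  primitivity of both. Being idempotent, it forces each multiplier to be 1 if it is nonzero, and
  then \<open>pt x = p\<close>.\<close>

lemma p_orth:
  assumes x: "x \<in> carrier G" "x \<notin> stab"
  shows "p \<cdot> pt x = 0"
proof (rule ccontr)
  assume nz: "p \<cdot> pt x \<noteq> 0"
  obtain c where c: "p \<cdot> pt x = c \<star> p" using p_prim pt_Gr x by blast
  obtain d where d: "p \<cdot> pt (inv x) = d \<star> p" using p_prim pt_Gr x by blast
  \<comment> \<open>Primitivity is assumed only for \<open>p\<close>; that of \<open>pt x\<close> is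
    obtained by translating the product of \<open>p\<close> and \<open>pt (inv x)\<close> by
    \<open>x\<close>.\<close>
  have "x \<rhd> (p \<cdot> pt (inv x)) = pt x \<cdot> p"
    using act_mul_one[of x p "pt (inv x)"] p_Gr x pt_pt[of x "inv x"] by simp
  then have d': "p \<cdot> pt x = d \<star> pt x" using d act_scale[of x p d] central[OF p_Gr pt_Sp] x by simp
  have idem: "p \<cdot> pt x \<cdot> (p \<cdot> pt x) = p \<cdot> pt x"
    using assoc_one[OF p_Gr, of "pt x" "p \<cdot> pt x"] left_commute_one[OF p_Gr, of "pt x" "pt x"]
      pt_idem p_fix x by simp
  have "(c * c) \<star> p = c \<star> p"
    using idem p_idem unfolding c by (simp add: mul_scale_right mul_scale_left)
  then have "c = 1" using c nz p_nz by auto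
  have "(d * d) \<star> pt x = d \<star> pt x"
    using idem pt_idem x unfolding d' by (simp add: mul_scale_right mul_scale_left)
  then have "d = 1" using d' nz pt_nz x by auto
  with \<open>c = 1\<close> have "pt x = p" using c d' by simp
  then show False using x by (simp add: stab_def)
qed

lemma stab_card_nz: "of_nat (card stab) \<noteq> (0::'k)"
proof -
  have "finite stab" using fin by (simp add: stab_def)
  moreover have "stab \<noteq> {}" using subgroup.one_closed[OF subgroup_stab] by blast
  ultimately show ?thesis by simp
qed

text \<open>The sum runs over the group, so each point of the orbit occurs \<open>card stab\<close>
  times, and \<open>q\<close> is the sum over the orbit itself. Its idempotence follows from
  \<open>pt x \<cdot> q = pt x\<close>, the translate of \<open>p \<cdot> q = p\<close>.\<close>

lemma sum_pt: "(\<Sum>x\<in>carrier G. pt x) = of_nat (card stab) \<star> unit"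
proof -
  let ?n = "of_nat (card stab) :: 'k"
  let ?s = "\<Sum>x\<in>carrier G. pt x"
  define q where "q = inverse ?n \<star> ?s"
  have sG: "?s \<in> Gr \<one>" by (rule Gr_sum[OF one_closed pt_Gr])
  then have sS: "?s \<in> Sp" using one_Sp by blast
  have qG: "q \<in> Gr \<one>" and qS: "q \<in> Sp" using sG sS by (simp_all add: q_def)
  have "p \<cdot> ?s = (\<Sum>x\<in>carrier G. if x \<in> stab then p else 0)"
    using mul_sum_right[of "carrier G" "\<lambda>x. pt x" p] p_orth p_idem by (auto intro!: sum.cong simp: stab_def)
  also have "\<dots> = (\<Sum>x\<in>stab. p)"
    using fin by (simp add: sum.inter_filter[symmetric] stab_def conj_commute cong: conj_cong)
  also have "\<dots> = ?n \<star> p" by (simp add: V.sum_constant_scale)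
  finally have ps: "p \<cdot> ?s = ?n \<star> p" .
  have pq: "p \<cdot> q = p" using ps stab_card_nz by (simp add: q_def mul_scale_right sS)
  have inv: "f \<rhd> q = q" if f: "f \<in> carrier G" for f
  proof -
    have "f \<rhd> ?s = (\<Sum>x\<in>carrier G. pt (f \<otimes> x))" using f by (simp add: act_sum pt_pt)
    also have "\<dots> = ?s"
      by (rule sum.reindex_bij_betw, rule bij_betwI[of _ _ _ "\<lambda>x. inv f \<otimes> x"]) (use f in auto)
    finally show ?thesis using f sS by (simp add: q_def act_scale)
  qed
  have ptq: "pt x \<cdot> q = pt x" if x: "x \<in> carrier G" for x
    using act_mul_one[OF x p_Gr qS] pq inv[OF x] by simp
  have "?s \<cdot> q = ?s" using mul_sum_left[of "carrier G" "\<lambda>x. pt x" q] qS ptq by simp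
  then have "q \<cdot> q = q" using mul_scale_left[OF sS qS] by (simp add: q_def)
  then have "invariant_idempotent q" using qG inv by (simp add: invariant_idempotent_def)
  moreover have "q \<noteq> 0" using pq p_nz by auto
  ultimately have "q = unit" using invariant_idempotent_trivial ind by blast
  then have "?n \<star> q = ?n \<star> unit" by simp
  then show ?thesis using stab_card_nz by (simp add: q_def)
qed

text \<open>Centrality and the braided commutation rule give
  \<open>p \<cdot> a = pt g \<cdot> a\<close>. Multiplying by \<open>p\<close> once more leaves the
  left side unchanged and, for \<open>g\<close> outside \<open>stab\<close>, kills the right side by
  orthogonality.\<close>

lemma p_support:
  assumes "g \<in> carrier G" "a \<in> Gr g" "p \<cdot> a \<noteq> 0"
  shows "g \<in> stab"
proof (rule ccontr)
  assume g: "g \<notin> stab"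
  have aS: "a \<in> Sp" using assms Gr_Sp by blast
  have "p \<cdot> a = pt g \<cdot> a" using commute[of g \<one> a p] central[OF p_Gr aS] p_Gr assms by simp
  then have "p \<cdot> a = p \<cdot> pt g \<cdot> a" using p_fix[OF aS] assoc_one[OF p_Gr, of "pt g" a] assms aS by simp
  then show False using p_orth[OF assms(1) g] assms(3) aS by simp
qed

text \<open>The partner of \<open>a\<close> under the trace pairing, cut down by \<open>p\<close>
  and rescaled, is a right inverse. On the other side the product is a multiple of \<open>p\<close>
  as well, nonzero because reassociating \<open>a \<cdot> (b \<cdot> a)\<close> costs only the
  nonzero scalar \<open>\<alpha> g (inv g) g\<close>.\<close>

lemma p_inverse:
  assumes g: "g \<in> carrier G" and a: "a \<in> Gr g" "p \<cdot> a = a" "a \<noteq> 0"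
  obtains b c where "b \<in> Gr (inv g)" "p \<cdot> b = b" "a \<cdot> b = p" "b \<cdot> a = c \<star> p" "c \<noteq> 0"
proof -
  have aS: "a \<in> Sp" using a g Gr_Sp by blast
  obtain b0 where b0: "b0 \<in> Gr (inv g)" "a \<cdot> b0 \<noteq> 0" using pairing g a by blast
  have b0S: "b0 \<in> Sp" using b0 g Gr_Sp by blast
  have "a \<cdot> b0 \<in> Gr \<one>" using mul_Gr[OF g inv_closed[OF g] a(1) b0(1)] g by simp
  then obtain c where c: "a \<cdot> b0 = c \<star> p" using p_prim p_mul[OF aS b0S a(2)] by metis
  have c0: "c \<noteq> 0" using c b0 by auto
  define b where "b = inverse c \<star> (p \<cdot> b0)"
  have b: "b \<in> Gr (inv g)" "b \<in> Sp" using b0 b0S g p_Gr by (auto simp: b_def mul_Gr_one)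
  have pb: "p \<cdot> b = b" using p_fix b0S by (simp add: b_def mul_scale_right)
  have ab: "a \<cdot> b = p"
    using left_commute_one[OF p_Gr aS b0S] c c0 p_idem aS b0S by (simp add: b_def mul_scale_right)
  have "b \<cdot> a \<in> Gr \<one>" using mul_Gr[OF inv_closed[OF g] g b(1) a(1)] g by simp
  then obtain d where d: "b \<cdot> a = d \<star> p" using p_prim p_mul[OF b(2) aS pb] by metis
  have "a \<cdot> (b \<cdot> a) = \<alpha> g (inv g) g \<star> a" using assoc[of g "inv g" g a b a] ab a g b by simp
  then have "d \<noteq> 0" using d a alpha_nz[of g "inv g" g] g aS by auto
  then show thesis using that b pb ab d by blast
qed

text \<open>Insert \<open>b \<cdot> a\<close>, a nonzero multiple of \<open>p\<close>, after
  \<open>a'\<close> and reassociate: \<open>a' \<cdot> b\<close> has degree \<open>\<one>\<close>,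
  hence is a multiple of \<open>p\<close>, and a multiple of \<open>a\<close> remains.\<close>

lemma p_line:
  assumes g: "g \<in> carrier G" and a: "a \<in> Gr g" "p \<cdot> a = a" "a \<noteq> 0" and a': "a' \<in> Gr g" "p \<cdot> a' = a'"
  shows "\<exists>c. a' = c \<star> a"
proof -
  have aS: "a \<in> Sp" "a' \<in> Sp" using a a' g Gr_Sp by blast+
  obtain b c where b: "b \<in> Gr (inv g)" "p \<cdot> b = b" "a \<cdot> b = p" "b \<cdot> a = c \<star> p" "c \<noteq> 0"
    using p_inverse[OF g a] by metis
  have bS: "b \<in> Sp" using b(1) g Gr_Sp by blast
  have "a' \<cdot> b \<in> Gr \<one>" using mul_Gr[OF g inv_closed[OF g] a'(1) b(1)] g by simp
  then obtain d where d: "a' \<cdot> b = d \<star> p" using p_prim p_mul[OF aS(2) bS a'(2)] by metis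
  have "c \<star> a' = a' \<cdot> (b \<cdot> a)" using b(4) central[OF p_Gr aS(2)] a' aS by (simp add: mul_scale_right)
  also have "\<dots> = (\<alpha> g (inv g) g * d) \<star> a"
    using assoc[of g "inv g" g a' b a] a a' b g d aS by (simp add: mul_scale_left)
  finally have "a' = (inverse c * (\<alpha> g (inv g) g * d)) \<star> a"
    using b(5) by (metis V.scale_one V.scale_scale left_inverse)
  then show ?thesis by blast
qed

text \<open>Multiplying by the inverse of \<open>a\<close> from the left and reassociating returns a
  nonzero multiple of \<open>b\<close>.\<close>

lemma p_mul_nz:
  assumes g: "g \<in> carrier G" and h: "h \<in> carrier G" and a: "a \<in> Gr g" "p \<cdot> a = a" "a \<noteq> 0"
    and b: "b \<in> Gr h" "p \<cdot> b = b" "b \<noteq> 0"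
  shows "a \<cdot> b \<noteq> 0"
proof -
  have S: "a \<in> Sp" "b \<in> Sp" using a b g h Gr_Sp by blast+
  obtain b' c where b': "b' \<in> Gr (inv g)" "b' \<cdot> a = c \<star> p" "c \<noteq> 0" using p_inverse[OF g a] by metis
  have b'S: "b' \<in> Sp" using b' g Gr_Sp inv_closed by blast
  have "b' \<cdot> (a \<cdot> b) = (\<alpha> (inv g) g h * c) \<star> b"
    using assoc[of "inv g" g h b' a b] b' a b g h S by (simp add: mul_scale_left)
  moreover have "\<dots> \<noteq> 0" using b(3) b'(3) alpha_nz g h by simp
  ultimately show ?thesis using b'S by auto
qed

text \<open>The subgroup \<open>F\<close> of the overview; \<open>stab\<close> is \<open>H\<close>.
  Equality of the two is where the Lagrangian condition enters.\<close>

definition supp where "supp = {g \<in> carrier G. \<exists>a\<in>Gr g. p \<cdot> a \<noteq> 0}"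

lemma suppE:
  assumes "g \<in> supp"
  obtains a where "a \<in> Gr g" "p \<cdot> a = a" "a \<noteq> 0"
proof -
  obtain a where "a \<in> Gr g" "p \<cdot> a \<noteq> 0" "g \<in> carrier G" using assms by (auto simp: supp_def)
  then show thesis using that[of "p \<cdot> a"] p_fix Gr_Sp p_Gr by (auto simp: mul_Gr_one)
qed

lemma supp_subset: "supp \<subseteq> stab"
  using p_support by (auto simp: supp_def)

text \<open>Inverses and products of degrees come from inverses and products of nonzero elements of
  the corner at \<open>p\<close>.\<close>

lemma subgroup_supp: "subgroup supp G"
proof (rule subgroupI)
  show "supp \<subseteq> carrier G" by (auto simp: supp_def)
  show "supp \<noteq> {}" using p_Gr p_idem p_nz by (auto simp: supp_def intro!: exI[of _ \<one>] bexI[of _ p])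
  fix x assume x: "x \<in> supp"
  then have xG: "x \<in> carrier G" by (simp add: supp_def)
  obtain a where a: "a \<in> Gr x" "p \<cdot> a = a" "a \<noteq> 0" using x suppE by blast
  obtain b c where b: "b \<in> Gr (inv x)" "p \<cdot> b = b" "a \<cdot> b = p" using p_inverse[OF xG a] by metis
  then have "b \<noteq> 0" using p_nz a xG Gr_Sp by auto
  then have "p \<cdot> b \<noteq> 0" using b(2) by simp
  then show "inv x \<in> supp" using b(1) inv_closed[OF xG] unfolding supp_def by blast
  fix y assume y: "y \<in> supp"
  then have yG: "y \<in> carrier G" by (simp add: supp_def)
  obtain b where b: "b \<in> Gr y" "p \<cdot> b = b" "b \<noteq> 0" using y suppE by blast
  have "a \<cdot> b \<noteq> 0" using p_mul_nz[OF xG yG a b] .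
  moreover have "p \<cdot> (a \<cdot> b) = a \<cdot> b" using p_mul a b xG yG Gr_Sp by blast
  ultimately show "x \<otimes> y \<in> supp" using mul_Gr[OF xG yG a(1) b(1)] xG yG
    by (auto simp: supp_def intro!: bexI[of _ "a \<cdot> b"])
qed

end

section \<open>Local modules\<close>

lemma vector_space_fun: "vector_space s \<Longrightarrow> vector_space (\<lambda>c (m :: 'i \<Rightarrow> 'v::ab_group_add) x. s c (m x))"
  unfolding vector_space_def by (auto simp: fun_eq_iff)

lemma vector_space_times: "vector_space (\<lambda>c (x::'k::field). c * x)"
  by standard (auto simp: algebra_simps)

text \<open>Coordinates padded by zeros. They embed any finite-dimensional space into
  \<open>nat \<Rightarrow> 'a\<close>, the shape of the modules over which \<open>lagrangian\<close>
  quantifies.\<close>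

lemma (in vector_space) fd_coordinates:
  assumes "fd_subspace scale W"
  obtains \<psi> :: "'b \<Rightarrow> nat \<Rightarrow> 'a" where "linear_on W scale (\<lambda>c x i. c * x i) \<psi>" "inj_on \<psi> W"
proof -
  obtain B where B: "finite B" "independent B" "span B = W" using assms by (rule fd_basis)
  obtain e where e: "bij_betw e {0..<card B} B" using ex_bij_betw_nat_finite B(1) by blast
  define \<psi> where "\<psi> v i = (if i < card B then representation B v (e i) else 0)" for v i
  have "linear_on W scale (\<lambda>c x i. c * x i) \<psi>"
    using B by (auto simp: linear_on_def \<psi>_def fun_eq_iff representation_add representation_scale)
  moreover have "inj_on \<psi> W"
  proof (rule inj_onI)
    fix v w assume vw: "v \<in> W" "w \<in> W" "\<psi> v = \<psi> w"
    have "representation B v b = representation B w b" if "b \<in> B" for b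
    proof -
      have "b \<in> e ` {0..<card B}" using e \<open>b \<in> B\<close> by (simp add: bij_betw_def)
      then obtain i where "i < card B" "b = e i" by auto
      then show ?thesis using fun_cong[OF vw(3), of i] by (simp add: \<psi>_def)
    qed
    then have "(\<Sum>b\<in>B. scale (representation B v b) b) = (\<Sum>b\<in>B. scale (representation B w b) b)"
      by simp
    moreover have "(\<Sum>b\<in>B. scale (representation B u b) b) = u" if "u \<in> W" for u
      using that B by (intro sum_representation_eq) auto
    ultimately show "v = w" using vw by metis
  qed
  ultimately show thesis using that by blast
qed

lemma mod_isomorphic_trans:
  assumes "mod_isomorphic G A M N" "mod_isomorphic G A N P"
  shows "mod_isomorphic G A M P"
proof -
  obtain \<phi> where \<phi>: "zhom G M N \<phi>" "bij_betw \<phi> (space G M) (space G N)"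
    "\<forall>m\<in>space G M. \<forall>a\<in>space G A. \<phi> (mact M m a) = mact N (\<phi> m) a"
    using assms(1) by (auto simp: mod_isomorphic_def)
  obtain \<psi> where \<psi>: "zhom G N P \<psi>" "bij_betw \<psi> (space G N) (space G P)"
    "\<forall>m\<in>space G N. \<forall>a\<in>space G A. \<psi> (mact N m a) = mact P (\<psi> m) a"
    using assms(2) by (auto simp: mod_isomorphic_def)
  have im: "\<phi> m \<in> space G N" if "m \<in> space G M" for m using \<phi>(2) that by (auto simp: bij_betw_def)
  have "zhom G M P (\<psi> \<circ> \<phi>)"
    using \<phi>(1) \<psi>(1) im unfolding zhom_def linear_on_def by (simp add: image_subset_iff)
  moreover have "bij_betw (\<psi> \<circ> \<phi>) (space G M) (space G P)" using \<phi>(2) \<psi>(2) by (rule bij_betw_trans)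
  moreover have "\<forall>m\<in>space G M. \<forall>a\<in>space G A. (\<psi> \<circ> \<phi>) (mact M m a) = mact P ((\<psi> \<circ> \<phi>) m) a"
    using \<phi>(3) \<psi>(3) im by simp
  ultimately show ?thesis unfolding mod_isomorphic_def by blast
qed

section \<open>Changing the carrier of a module, and generators of free modules\<close>

context graded_algebra
begin

lemma right_module_transport:
  fixes M :: "('a, 'k, 'm::ab_group_add, 'v) zmod" and t :: "'k \<Rightarrow> 'w::ab_group_add \<Rightarrow> 'w"
  assumes M: "right_module G \<alpha> A M" and loc: "local_module G A M" and t: "vector_space t"
    and lin: "linear_on (space G M) (scal M) t \<psi>" and inj: "inj_on \<psi> (space G M)"
  obtains N :: "('a, 'k, 'w, 'v) zmod"
    where "right_module G \<alpha> A N" "local_module G A N" "mod_isomorphic G A M N"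
proof -
  let ?S = "space G M"
  \<comment> \<open>A left inverse of \<open>\<psi>\<close>; its arbitrary values outside the image
    of \<open>\<psi>\<close> never enter, because the transported module lives on that
    image.\<close>
  define \<iota> where "\<iota> = inv_into ?S \<psi>"
  define N where "N = \<lparr>scal = t, grd = \<lambda>g. \<psi> ` grd M g, act = \<lambda>f y. \<psi> (act M f (\<iota> y)),
    mact = \<lambda>y a. \<psi> (mact M (\<iota> y) a)\<rparr>"
  have N [simp]: "scal N = t" "\<And>g. grd N g = \<psi> ` grd M g" "\<And>f y. act N f y = \<psi> (act M f (\<iota> y))"
    "\<And>y a. mact N y a = \<psi> (mact M (\<iota> y) a)" by (simp_all add: N_def)
  have zM: "zobject G \<alpha> M" and tM: "tensor_hom G \<alpha> M A M (mact M)" using M by (simp_all add: right_module_def)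
  interpret M: graded_sum "scal M" G "grd M" by (rule graded_sum_zobject[OF zM])
  interpret t: vector_space t by (rule t)
  have \<iota> [simp]: "\<iota> (\<psi> m) = m" if "m \<in> ?S" for m using inj that by (simp add: \<iota>_def)
  have grdS: "m \<in> ?S" if "g \<in> carrier G" "m \<in> grd M g" for g m using M.grd_total that by blast
  have actS: "act M f m \<in> ?S" if "f \<in> carrier G" "m \<in> ?S" for f m
    using zM that unfolding zobject_def bij_betw_def by blast
  have actG: "act M f m \<in> grd M (cj G f g)" if "f \<in> carrier G" "g \<in> carrier G" "m \<in> grd M g" for f g m
    using zM that unfolding zobject_def by blast
  have mactS: "mact M m a \<in> ?S" if "m \<in> ?S" "a \<in> Sp" for m a
    using tensor_hom_total[OF zM obj zM tM] that .
  have mactG: "mact M m a \<in> grd M (f \<otimes> g)"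
    if "f \<in> carrier G" "g \<in> carrier G" "m \<in> grd M f" "a \<in> Gr g" for f g m a
    using tM that by (simp add: tensor_hom_def)
  have S: "space G N = \<psi> ` ?S"
  proof
    show "\<psi> ` ?S \<subseteq> space G N" using M.linear_on_total_image[OF lin, of "grd N"] by auto
    show "space G N \<subseteq> \<psi> ` ?S"
    proof
      fix y assume "y \<in> space G N"
      then obtain z where z: "\<forall>g\<in>carrier G. z g \<in> \<psi> ` grd M g" "y = (\<Sum>g\<in>carrier G. z g)"
        by (auto simp: total_def)
      then have "\<forall>g\<in>carrier G. \<exists>x. x \<in> grd M g \<and> z g = \<psi> x" by blast
      then obtain x where x: "\<forall>g\<in>carrier G. x g \<in> grd M g \<and> z g = \<psi> (x g)" by metis
      then have "y = \<psi> (\<Sum>g\<in>carrier G. x g)"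
        using M.linear_on_sum[OF lin M.total_subspace, of "carrier G" x] grdS z(2) by auto
      then show "y \<in> \<psi> ` ?S" using M.sum_total[of x] x by blast
    qed
  qed
  have add: "\<psi> x + \<psi> y = \<psi> (x + y)" "x + y \<in> ?S" if "x \<in> ?S" "y \<in> ?S" for x y
    using linear_onD(1)[OF lin] M.subspace_add[OF M.total_subspace] that by auto
  have scl: "t c (\<psi> x) = \<psi> (scal M c x)" "scal M c x \<in> ?S" if "x \<in> ?S" for x c
    using linear_onD(2)[OF lin] M.subspace_scale[OF M.total_subspace] that by auto
  have zN: "zobject G \<alpha> N"
  proof (rule zobjectI)
    show "vector_space (scal N)" using t by simp
    show "fd_subspace (scal N) (grd N g)" if g: "g \<in> carrier G" for g
    proof -
      have "fd_subspace (scal M) (grd M g)" using zM g unfolding zobject_def by blast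
      moreover have "linear_on (grd M g) (scal M) t \<psi>" using linear_on_subset[OF lin] grdS[OF g] by blast
      ultimately show ?thesis using M.fd_subspace_image[OF t] by simp
    qed
    show "direct G (grd N)"
      unfolding direct_def
    proof (intro allI impI ballI)
      fix z g assume z: "(\<forall>g\<in>carrier G. z g \<in> grd N g) \<and> sum z (carrier G) = 0" and g: "g \<in> carrier G"
      then have "\<forall>g\<in>carrier G. \<exists>x. x \<in> grd M g \<and> z g = \<psi> x" by auto
      then obtain x where x: "\<forall>g\<in>carrier G. x g \<in> grd M g \<and> z g = \<psi> (x g)" by metis
      then have "\<psi> (\<Sum>g\<in>carrier G. x g) = 0"
        using M.linear_on_sum[OF lin M.total_subspace, of "carrier G" x] grdS z by auto
      moreover have "\<psi> 0 = 0" using linear_on_zero[OF lin] M.subspace_0[OF M.total_subspace] by blast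
      moreover have "(\<Sum>g\<in>carrier G. x g) \<in> ?S" using x M.sum_total by blast
      ultimately have "(\<Sum>g\<in>carrier G. x g) = 0"
        using inj M.subspace_0[OF M.total_subspace] by (auto simp: inj_on_def)
      then have "x g = 0" using M.dir x g unfolding direct_def by blast
      then show "z g = 0" using x g \<open>\<psi> 0 = 0\<close> by simp
    qed
    show "linear_on (space G N) (scal N) (scal N) (act N f)" if f: "f \<in> carrier G" for f
    proof -
      have "linear_on ?S (scal M) (scal M) (act M f)" using zM f unfolding zobject_def by blast
      from linear_onD[OF this] show ?thesis
        unfolding linear_on_def S using f by (auto simp: add scl actS)
    qed
    show "act N f v \<in> grd N (cj G f g)" if "f \<in> carrier G" "g \<in> carrier G" "v \<in> grd N g" for f g v
      using that actG grdS by auto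
    show "act N \<one> v = v" if "g \<in> carrier G" "v \<in> grd N g" for g v
      using that grdS zobject_act_one[OF zM] by auto
    show "act N (f \<otimes> g) v = scal N (acoef G \<alpha> f g h) (act N f (act N g v))"
      if fgh: "f \<in> carrier G" "g \<in> carrier G" "h \<in> carrier G" and v: "v \<in> grd N h" for f g h v
    proof -
      obtain m where m: "m \<in> grd M h" "v = \<psi> m" using v by auto
      have "act M (f \<otimes> g) m = scal M (acoef G \<alpha> f g h) (act M f (act M g m))"
        using zM fgh m(1) unfolding zobject_def by blast
      then show ?thesis using m grdS fgh by (simp add: scl actS)
    qed
  qed
  have "tensor_hom G \<alpha> N A N (mact N)"
    unfolding tensor_hom_def
  proof (intro conjI ballI)
    fix a assume a: "a \<in> Sp"
    then have "linear_on ?S (scal M) (scal M) (\<lambda>m. mact M m a)" using tM by (simp add: tensor_hom_def)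
    from linear_onD[OF this] show "linear_on (space G N) (scal N) (scal N) (\<lambda>x. mact N x a)"
      unfolding linear_on_def S using a by (auto simp: add scl mactS)
  next
    fix x assume "x \<in> space G N"
    then obtain m where m: "m \<in> ?S" "x = \<psi> m" using S by blast
    then have "linear_on Sp (scal A) (scal M) (mact M m)" using tM by (simp add: tensor_hom_def)
    from linear_onD[OF this] show "linear_on Sp (scal A) (scal N) (mact N x)"
      unfolding linear_on_def using m by (auto simp: add scl mactS)
  next
    fix g h x a assume gh: "g \<in> carrier G" "h \<in> carrier G" "x \<in> grd N g" "a \<in> Gr h"
    then obtain m where m: "m \<in> grd M g" "x = \<psi> m" "m \<in> ?S" using grdS by auto
    have aS: "a \<in> Sp" using gh Gr_Sp by blast
    show "mact N x a \<in> grd N (g \<otimes> h)" using m gh mactG by auto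
    show "act N f (mact N x a) = scal N (tcoef G \<alpha> f g h) (mact N (act N f x) (f \<rhd> a))"
      if f: "f \<in> carrier G" for f
    proof -
      have "act M f (mact M m a) = scal M (tcoef G \<alpha> f g h) (mact M (act M f m) (f \<rhd> a))"
        using tM gh m(1) f by (simp add: tensor_hom_def)
      then show ?thesis using m aS f by (simp add: scl mactS actS)
    qed
  qed
  moreover have "mact N x (a \<cdot> b) = scal N (\<alpha> f g h) (mact N (mact N x a) b)"
    if fgh: "f \<in> carrier G" "g \<in> carrier G" "h \<in> carrier G"
      and x: "x \<in> grd N f" and ab: "a \<in> Gr g" "b \<in> Gr h" for f g h x a b
  proof -
    obtain m where m: "m \<in> grd M f" "x = \<psi> m" "m \<in> ?S" using grdS fgh(1) x by auto
    have "mact M m (a \<cdot> b) = scal M (\<alpha> f g h) (mact M (mact M m a) b)"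
      using M fgh ab m(1) by (simp add: right_module_def)
    then show ?thesis using m Gr_Sp[OF fgh(2) ab(1)] Gr_Sp[OF fgh(3) ab(2)] by (simp add: scl mactS)
  qed
  moreover have "\<forall>x\<in>space G N. mact N x unit = x" using M S by (auto simp: right_module_def)
  ultimately have "right_module G \<alpha> A N" unfolding right_module_def using zN by simp
  moreover have "local_module G A N"
    unfolding local_module_def
  proof (intro ballI)
    fix f g x a assume fg: "f \<in> carrier G" "g \<in> carrier G" "x \<in> grd N f" "a \<in> Gr g"
    then obtain m where m: "m \<in> grd M f" "x = \<psi> m" "m \<in> ?S" using grdS by auto
    have "mact M (act M (cj G f g) m) (f \<rhd> a) = mact M m a"
      using loc fg m by (simp add: local_module_def braid_def)
    then show "case_prod (mact N) (case_prod (braid N (cj G f g)) (braid A f x a)) = mact N x a"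
      using m fg by (simp add: braid_def actS)
  qed
  moreover have "mod_isomorphic G A M N"
    unfolding mod_isomorphic_def zhom_def
    using lin inj S by (intro exI[of _ \<psi>]) (auto simp: bij_betw_def)
  ultimately show thesis by (rule that)
qed

text \<open>Frees the Lagrangian condition from its fixed carrier type: a module on any type is
  isomorphic to one made of coordinate vectors.\<close>

lemma lagrangian_local_module:
  fixes M :: "('a, 'k, 'm::ab_group_add, 'v) zmod"
  assumes "lagrangian G \<alpha> A" "right_module G \<alpha> A M" "local_module G A M"
  shows "\<exists>n. mod_isomorphic G A M (regular_power n A)"
proof -
  have zM: "zobject G \<alpha> M" using assms(2) by (simp add: right_module_def)
  interpret M: graded_sum "scal M" G "grd M" by (rule graded_sum_zobject[OF zM])
  have "fd_subspace (scal M) (space G M)" using M.fd_total zM by (simp add: zobject_def)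
  then obtain \<psi> :: "'m \<Rightarrow> nat \<Rightarrow> 'k" where \<psi>: "linear_on (space G M) (scal M) (\<lambda>c x i. c * x i) \<psi>"
    "inj_on \<psi> (space G M)" by (rule M.fd_coordinates)
  obtain N :: "('a, 'k, nat \<Rightarrow> 'k, 'v) zmod"
    where N: "right_module G \<alpha> A N" "local_module G A N" "mod_isomorphic G A M N"
    using right_module_transport[OF assms(2,3) vector_space_fun[OF vector_space_times] \<psi>] by blast
  then obtain n where "mod_isomorphic G A N (regular_power n A)"
    using assms(1) by (auto simp: lagrangian_def)
  then show ?thesis using mod_isomorphic_trans N(3) by blast
qed

text \<open>The part of freeness that is exploited later. The generators are the preimages of the
  vectors with \<open>unit\<close> in one slot, and they inherit degree \<open>\<one>\<close> and
  invariance from \<open>unit\<close>.\<close>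

lemma regular_power_generators:
  fixes M :: "('a, 'k, 'm::ab_group_add, 'v) zmod"
  assumes M: "right_module G \<alpha> A M" and iso: "mod_isomorphic G A M (regular_power n A)"
  shows "\<exists>e. (\<forall>i<n. e i \<in> grd M \<one> \<and> (\<forall>f\<in>carrier G. act M f (e i) = e i)) \<and>
    (\<forall>m\<in>space G M. \<exists>a. (\<forall>i<n. a i \<in> Sp) \<and> m = (\<Sum>i<n. mact M (e i) (a i)))"
proof -
  let ?R = "regular_power n A"
  have zM: "zobject G \<alpha> M" and tM: "tensor_hom G \<alpha> M A M (mact M)" using M by (simp_all add: right_module_def)
  interpret M: graded_sum "scal M" G "grd M" by (rule graded_sum_zobject[OF zM])
  have R [simp]: "scal ?R = (\<lambda>c x i. c \<star> x i)" "grd ?R g = {x. (\<forall>i<n. x i \<in> Gr g) \<and> (\<forall>i\<ge>n. x i = 0)}"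
    "act ?R f x = (\<lambda>i. if i < n then f \<rhd> x i else 0)" "mact ?R x a = (\<lambda>i. if i < n then x i \<cdot> a else 0)"
    for g f x a by (simp_all add: regular_power_def)
  interpret vR: vector_space "scal ?R" using vector_space_fun[OF V.vector_space_axioms] by simp
  interpret R: graded_sum "scal ?R" G "grd ?R"
  proof
    show "finite (carrier G)" by (rule fin)
    show "vR.subspace (grd ?R g)" if "g \<in> carrier G" for g
      unfolding vR.subspace_def using that by (auto simp: Gr_add)
    show "direct G (grd ?R)"
      unfolding direct_def
    proof (intro allI impI ballI ext)
      fix x g i assume x: "(\<forall>g\<in>carrier G. x g \<in> grd ?R g) \<and> sum x (carrier G) = 0" and g: "g \<in> carrier G"
      have "(\<Sum>g\<in>carrier G. x g i) = 0" using x sum_fun_apply[of x "carrier G" i] by simp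
      moreover have "\<forall>g\<in>carrier G. x g i \<in> Gr g" using x by (cases "i < n") auto
      ultimately show "x g i = 0 i" using V.dir g unfolding direct_def by fastforce
    qed
  qed
  obtain \<phi> where \<phi>: "zhom G M ?R \<phi>" "bij_betw \<phi> (space G M) (space G ?R)"
    "\<And>m a. m \<in> space G M \<Longrightarrow> a \<in> Sp \<Longrightarrow> \<phi> (mact M m a) = mact ?R (\<phi> m) a"
    using iso by (auto simp: mod_isomorphic_def)
  have lin: "linear_on (space G M) (scal M) (scal ?R) \<phi>"
    and im: "\<And>g. g \<in> carrier G \<Longrightarrow> \<phi> ` grd M g \<subseteq> grd ?R g"
    and equiv: "\<And>f v. f \<in> carrier G \<Longrightarrow> v \<in> space G M \<Longrightarrow> \<phi> (act M f v) = act ?R f (\<phi> v)"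
    using \<phi>(1) by (auto simp: zhom_def)
  have inj: "x = y" if "x \<in> space G M" "y \<in> space G M" "\<phi> x = \<phi> y" for x y
    using \<phi>(2) that by (auto simp: bij_betw_def inj_on_def)
  define \<epsilon> :: "nat \<Rightarrow> nat \<Rightarrow> 'v" where "\<epsilon> i = (\<lambda>j. if j = i then unit else 0)" for i
  have \<epsilon>: "\<epsilon> i \<in> grd ?R \<one>" if "i < n" for i using that by (auto simp: \<epsilon>_def)
  then have \<epsilon>S: "\<epsilon> i \<in> space G ?R" if "i < n" for i using R.grd_total[OF one_closed] that by blast
  define e where "e i = inv_into (space G M) \<phi> (\<epsilon> i)" for i
  have e: "e i \<in> space G M" "\<phi> (e i) = \<epsilon> i" if "i < n" for i
    using \<phi>(2) \<epsilon>S[OF that] inv_into_into[of "\<epsilon> i" \<phi> "space G M"] f_inv_into_f[of "\<epsilon> i" \<phi> "space G M"]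
    by (auto simp: e_def bij_betw_def)
  \<comment> \<open>\<open>\<phi>\<close> commutes with the projection to degree
    \<open>\<one>\<close>, so injectivity carries the homogeneity of \<open>\<epsilon> i\<close>
    back to \<open>e i\<close>.\<close>
  have "e i \<in> grd M \<one>" if i: "i < n" for i
  proof -
    have 1: "hom_part G (grd M) (e i) \<one> \<in> grd M \<one>" using M.hom_part(1)[OF e(1)[OF i]] by simp
    have "\<phi> (hom_part G (grd M) (e i) \<one>) = hom_part G (grd ?R) (\<phi> (e i)) \<one>"
      by (rule M.hom_part_image[OF R.graded_sum_axioms lin im e(1)[OF i] one_closed, symmetric])
    also have "\<dots> = \<phi> (e i)" using R.hom_part_homogeneous[OF one_closed \<epsilon>[OF i] one_closed] e(2)[OF i] by simp
    finally have "hom_part G (grd M) (e i) \<one> = e i" using inj M.grd_total[OF one_closed 1] e(1)[OF i] by blast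
    then show ?thesis using 1 by simp
  qed
  moreover have "act M f (e i) = e i" if "i < n" "f \<in> carrier G" for i f
  proof (rule inj)
    show "act M f (e i) \<in> space G M" using zM that e unfolding zobject_def bij_betw_def by blast
    show "e i \<in> space G M" using e that by blast
    show "\<phi> (act M f (e i)) = \<phi> (e i)" using that equiv e by (auto simp: \<epsilon>_def fun_eq_iff)
  qed
  moreover have "\<exists>a. (\<forall>i<n. a i \<in> Sp) \<and> m = (\<Sum>i<n. mact M (e i) (a i))" if m: "m \<in> space G M" for m
  proof -
    \<comment> \<open>The coefficients of \<open>m\<close> are the entries of its image in the
      regular power.\<close>
    let ?y = "\<phi> m"
    have "?y \<in> space G ?R" using \<phi>(2) m by (auto simp: bij_betw_def)
    then obtain z where z: "\<forall>g\<in>carrier G. z g \<in> grd ?R g" "?y = (\<Sum>g\<in>carrier G. z g)"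
      unfolding total_def by blast
    have yi: "?y i = (\<Sum>g\<in>carrier G. z g i)" for i unfolding z(2) by (rule sum_fun_apply)
    have yS: "?y i \<in> Sp" if "i < n" for i unfolding yi using z(1) that by (auto intro!: Sp_sum intro: Gr_Sp)
    have y0: "?y i = 0" if "\<not> i < n" for i unfolding yi using z(1) that by (auto intro!: sum.neutral)
    have eS: "mact M (e i) (?y i) \<in> space G M" if "i < n" for i
      using tensor_hom_total[OF zM obj zM tM] e(1)[OF that] yS[OF that] .
    have "\<phi> (\<Sum>i<n. mact M (e i) (?y i)) = (\<Sum>i<n. \<phi> (mact M (e i) (?y i)))"
      by (rule M.linear_on_sum[OF lin M.total_subspace]) (use eS in simp)
    also have "\<dots> = (\<Sum>i<n. mact ?R (\<epsilon> i) (?y i))" using \<phi>(3) e yS by (intro sum.cong) (simp_all cong: if_cong)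
    also have "\<dots> = ?y"
    proof
      fix j
      have "(\<Sum>i<n. mact ?R (\<epsilon> i) (?y i)) j = (\<Sum>i<n. if i = j then ?y j else 0)"
        unfolding sum_fun_apply
      proof (rule sum.cong[OF refl])
        fix i assume "i \<in> {..<n}"
        then show "mact ?R (\<epsilon> i) (?y i) j = (if i = j then ?y j else 0)"
          using yS[of i] by (cases "i = j") (auto simp: \<epsilon>_def)
      qed
      also have "\<dots> = ?y j" using y0 by simp
      finally show "(\<Sum>i<n. mact ?R (\<epsilon> i) (?y i)) j = ?y j" .
    qed
    finally have "\<phi> (\<Sum>i<n. mact M (e i) (?y i)) = ?y" .
    moreover have "(\<Sum>i<n. mact M (e i) (?y i)) \<in> space G M"
      by (rule M.subspace_sum[OF M.total_subspace]) (use eS in simp)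
    ultimately have "(\<Sum>i<n. mact M (e i) (?y i)) = m" using inj[OF _ m] by blast
    then show ?thesis using yS by (intro exI[of _ ?y]) auto
  qed
  ultimately show ?thesis by (intro exI[of _ e] conjI allI impI ballI)
qed

end

context etale_point
begin

text \<open>A local module that detects the gap between \<open>supp\<close> and \<open>stab\<close>: it is induced from the
  \<open>stab\<close>-representation of functions on \<open>stab/supp\<close>, placed in degree \<open>\<one>\<close>, tensored with the corner
  at \<open>p\<close>.\<close>

definition fibre_module where
  "fibre_module = \<lparr>
     scal = (\<lambda>c m x. c \<star> m x),
     grd = (\<lambda>f. {m. (\<forall>x\<in>carrier G. m x \<in> Gr f \<and> pt x \<cdot> m x = m x \<and> (\<forall>s\<in>supp. m (x \<otimes> s) = m x)) \<and>
       (\<forall>x. x \<notin> carrier G \<longrightarrow> m x = 0)}),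
     act = (\<lambda>g m x. if x \<in> carrier G then g \<rhd> m (inv g \<otimes> x) else 0),
     mact = (\<lambda>m a x. if x \<in> carrier G then m x \<cdot> a else 0)\<rparr>"

abbreviation FM where "FM \<equiv> fibre_module"

lemma FM_scal: "scal FM = (\<lambda>c m x. c \<star> m x)"
  and FM_grd: "m \<in> grd FM f \<longleftrightarrow> (\<forall>x\<in>carrier G. m x \<in> Gr f \<and> pt x \<cdot> m x = m x \<and>
    (\<forall>s\<in>supp. m (x \<otimes> s) = m x)) \<and> (\<forall>x. x \<notin> carrier G \<longrightarrow> m x = 0)"
  and FM_act: "act FM g m x = (if x \<in> carrier G then g \<rhd> m (inv g \<otimes> x) else 0)"
  and FM_mact: "mact FM m a x = (if x \<in> carrier G then m x \<cdot> a else 0)"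
  by (simp_all add: fibre_module_def)

lemma supp_closed: "s \<in> supp \<Longrightarrow> s \<in> carrier G"
  by (simp add: supp_def)

lemma pt_shift: "x \<in> carrier G \<Longrightarrow> y \<in> carrier G \<Longrightarrow> a \<in> Sp \<Longrightarrow> x \<rhd> (pt y \<cdot> a) = pt (x \<otimes> y) \<cdot> (x \<rhd> a)"
  using act_mul_one[of x "pt y" a] pt_Gr pt_pt by simp

lemma FM_total:
  assumes "m \<in> space G FM"
  shows "m x \<in> Sp" "x \<notin> carrier G \<Longrightarrow> m x = 0"
proof -
  obtain z where z: "\<forall>g\<in>carrier G. z g \<in> grd FM g" "m = (\<Sum>g\<in>carrier G. z g)"
    using assms by (auto simp: total_def)
  have m: "m x = (\<Sum>g\<in>carrier G. z g x)" unfolding z(2) by (rule sum_fun_apply)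
  show "x \<notin> carrier G \<Longrightarrow> m x = 0" unfolding m using z(1) by (auto intro!: sum.neutral simp: FM_grd)
  show "m x \<in> Sp" unfolding m
    using z(1) by (cases "x \<in> carrier G") (auto intro!: Sp_sum simp: FM_grd intro: Gr_Sp)
qed

text \<open>Elements of degree \<open>f\<close> lie among the functions from the finite set
  \<open>carrier G\<close> to \<open>Gr f\<close>, which are spanned by functions with a single
  nonzero value taken from a finite spanning set.\<close>

lemma fd_FM:
  assumes f: "f \<in> carrier G"
  shows "fd_subspace (scal FM) (grd FM f)"
proof -
  interpret F: vector_space "scal FM" using vector_space_fun[OF V.vector_space_axioms] by (simp add: FM_scal)
  obtain B where B: "finite B" "V.span B = Gr f" using fd_Gr[OF f] unfolding fd_subspace_def by blast
  define \<delta> where "\<delta> y b = (\<lambda>x. if x = y then b else 0)" for y :: 'a and b :: 'v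
  let ?W = "\<Union>y\<in>carrier G. \<delta> y ` B"
  have \<delta>: "\<delta> y b \<in> F.span ?W" if "y \<in> carrier G" "b \<in> Gr f" for y b
  proof -
    have "linear_on (V.span B) (scal A) (scal FM) (\<delta> y)"
      by (auto simp: linear_on_def \<delta>_def FM_scal fun_eq_iff)
    then have "\<delta> y b \<in> F.span (\<delta> y ` B)"
      using V.linear_on_image_span[OF F.vector_space_axioms] B(2) that(2) by blast
    then show ?thesis using F.span_mono[of "\<delta> y ` B" ?W] that(1) by blast
  qed
  have incl: "grd FM f \<subseteq> F.span ?W"
  proof
    fix m assume m: "m \<in> grd FM f"
    have "m = (\<Sum>y\<in>carrier G. \<delta> y (m y))"
    proof
      fix x
      have "(\<Sum>y\<in>carrier G. \<delta> y (m y)) x = (\<Sum>y\<in>carrier G. if y = x then m x else 0)"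
        unfolding sum_fun_apply by (auto intro!: sum.cong simp: \<delta>_def)
      then show "m x = (\<Sum>y\<in>carrier G. \<delta> y (m y)) x" using m fin by (simp add: FM_grd)
    qed
    moreover have "(\<Sum>y\<in>carrier G. \<delta> y (m y)) \<in> F.span ?W"
      using m \<delta> by (intro F.span_sum) (simp add: FM_grd)
    ultimately show "m \<in> F.span ?W" by simp
  qed
  have sub: "F.subspace (grd FM f)"
    unfolding F.subspace_def
    using f by (auto simp: FM_grd FM_scal Gr_add mul_add_right mul_scale_right Gr_Sp)
  have fd: "fd_subspace (scal FM) (F.span ?W)"
    unfolding fd_subspace_def by (intro exI[of _ ?W] conjI refl finite_UN_I fin finite_imageI B(1))
  show ?thesis by (rule F.fd_subspace_subset[OF fd sub incl])
qed

lemma zobject_FM: "zobject G \<alpha> FM"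
proof (rule zobjectI)
  show "vector_space (scal FM)" using vector_space_fun[OF V.vector_space_axioms] by (simp add: FM_scal)
  show "fd_subspace (scal FM) (grd FM g)" if "g \<in> carrier G" for g using fd_FM that .
  show "direct G (grd FM)"
    unfolding direct_def
  proof (intro allI impI ballI ext)
    fix z g x assume z: "(\<forall>g\<in>carrier G. z g \<in> grd FM g) \<and> sum z (carrier G) = 0" and g: "g \<in> carrier G"
    have "(\<Sum>g\<in>carrier G. z g x) = 0" using z sum_fun_apply[of z "carrier G" x] by simp
    moreover have "\<forall>g\<in>carrier G. z g x \<in> Gr g" using z by (cases "x \<in> carrier G") (auto simp: FM_grd)
    ultimately show "z g x = 0 x" using V.dir g unfolding direct_def by fastforce
  qed
  show "linear_on (space G FM) (scal FM) (scal FM) (act FM f)" if "f \<in> carrier G" for f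
    using that by (auto simp: linear_on_def FM_scal FM_act fun_eq_iff act_add act_scale FM_total)
  show "act FM f m \<in> grd FM (cj G f g)" if f: "f \<in> carrier G" and g: "g \<in> carrier G" and m: "m \<in> grd FM g" for f g m
    unfolding FM_grd
  proof (intro conjI ballI allI impI)
    fix x assume x: "x \<in> carrier G"
    have y: "inv f \<otimes> x \<in> carrier G" using f x by simp
    show "act FM f m x \<in> Gr (cj G f g)" using m f g x y act_Gr by (simp add: FM_grd FM_act)
    show "pt x \<cdot> act FM f m x = act FM f m x"
      using m f g x y pt_shift[of f "inv f \<otimes> x" "m (inv f \<otimes> x)"] Gr_Sp[OF g] by (simp add: FM_grd FM_act)
    \<comment> \<open>\<open>G\<close> translates the argument from the left and \<open>supp\<close>
      from the right, so the two do not interfere.\<close>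
    fix s assume s: "s \<in> supp"
    have "inv f \<otimes> (x \<otimes> s) = inv f \<otimes> x \<otimes> s" using f x supp_closed[OF s] by (simp add: m_assoc)
    then show "act FM f m (x \<otimes> s) = act FM f m x"
      using m x y s supp_closed[OF s] by (simp add: FM_grd FM_act)
  qed (simp add: FM_act)
  show "act FM \<one> m = m" if "g \<in> carrier G" "m \<in> grd FM g" for g m
    using that act_one_Gr by (auto simp: FM_grd FM_act fun_eq_iff)
  show "act FM (f \<otimes> g) m = scal FM (acoef G \<alpha> f g h) (act FM f (act FM g m))"
    if "f \<in> carrier G" "g \<in> carrier G" "h \<in> carrier G" "m \<in> grd FM h" for f g h m
    using that by (auto simp: FM_grd FM_act FM_scal fun_eq_iff act_comp inv_mult_group m_assoc)
qed

lemma right_module_FM: "right_module G \<alpha> A FM"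
proof -
  have "tensor_hom G \<alpha> FM A FM (mact FM)"
    unfolding tensor_hom_def
  proof (intro conjI ballI)
    show "linear_on (space G FM) (scal FM) (scal FM) (\<lambda>m. mact FM m a)" if "a \<in> Sp" for a
      using that by (auto simp: linear_on_def FM_scal FM_mact fun_eq_iff mul_add_left mul_scale_left FM_total)
    show "linear_on Sp (scal A) (scal FM) (mact FM m)" if "m \<in> space G FM" for m
      using that by (auto simp: linear_on_def FM_scal FM_mact fun_eq_iff mul_add_right mul_scale_right FM_total)
  next
    fix g h m a assume gh: "g \<in> carrier G" "h \<in> carrier G" "m \<in> grd FM g" "a \<in> Gr h"
    have aS: "a \<in> Sp" using gh Gr_Sp by blast
    have mS: "m x \<in> Sp" if "x \<in> carrier G" for x using gh that Gr_Sp[OF gh(1)] by (simp add: FM_grd)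
    have "pt x \<cdot> (m x \<cdot> a) = m x \<cdot> a" if "x \<in> carrier G" for x
    proof -
      have "pt x \<cdot> m x = m x" using gh that by (simp add: FM_grd)
      then show ?thesis using assoc_one[OF pt_Gr[OF that] mS[OF that] aS] by simp
    qed
    then show "mact FM m a \<in> grd FM (g \<otimes> h)"
      using gh mul_Gr supp_closed by (auto simp: FM_grd FM_mact)
    show "act FM f (mact FM m a) = scal FM (tcoef G \<alpha> f g h) (mact FM (act FM f m) (f \<rhd> a))"
      if "f \<in> carrier G" for f
      using gh that act_mul by (auto simp: FM_grd FM_act FM_mact FM_scal fun_eq_iff)
  qed
  moreover have "mact FM m (a \<cdot> b) = scal FM (\<alpha> f g h) (mact FM (mact FM m a) b)"
    if "f \<in> carrier G" "g \<in> carrier G" "h \<in> carrier G" "m \<in> grd FM f" "a \<in> Gr g" "b \<in> Gr h" for f g h m a b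
    using that assoc by (auto simp: FM_grd FM_mact FM_scal fun_eq_iff)
  moreover have "mact FM m unit = m" if "m \<in> space G FM" for m
    using FM_total[OF that] by (auto simp: FM_mact fun_eq_iff)
  ultimately show ?thesis unfolding right_module_def using zobject_FM by simp
qed

text \<open>Evaluated at \<open>x\<close>, the double braiding moves the argument to
  \<open>inv k \<otimes> x\<close>. If \<open>inv x \<otimes> k \<otimes> x\<close> is in
  \<open>supp\<close>, this stays in the coset of \<open>x\<close> and \<open>m\<close> does not
  change; otherwise \<open>pt x\<close> annihilates \<open>b\<close>, and both sides vanish.\<close>

lemma local_module_FM: "local_module G A FM"
  unfolding local_module_def
proof (intro ballI)
  fix f g m a assume f: "f \<in> carrier G" and g: "g \<in> carrier G" and m: "m \<in> grd FM f" and a: "a \<in> Gr g"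
  define k where "k = cj G f g"
  define b where "b = f \<rhd> a"
  have k: "k \<in> carrier G" and b: "b \<in> Gr k" using f g a act_Gr by (simp_all add: k_def b_def)
  have S: "a \<in> Sp" "b \<in> Sp" using a b g k Gr_Sp by blast+
  have "mact FM (act FM k m) b x = mact FM m a x" for x
  proof (cases "x \<in> carrier G")
    case x: True
    have mG: "m y \<in> Gr f" "pt y \<cdot> m y = m y" if "y \<in> carrier G" for y using m that by (simp_all add: FM_grd)
    have mS: "m y \<in> Sp" if "y \<in> carrier G" for y using mG(1)[OF that] Gr_Sp f by blast
    have y: "inv k \<otimes> x \<in> carrier G" using k x by simp
    \<comment> \<open>Two uses of commutativity in \<open>A\<close> undo the double braiding for the
      value \<open>m x\<close>; what remains is to compare \<open>m\<close> at \<open>x\<close> and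
      at \<open>inv k \<otimes> x\<close>.\<close>
    have ma: "m x \<cdot> a = b \<cdot> m x" using commute[OF f g mG(1)[OF x] a] by (simp add: b_def)
    have mb: "b \<cdot> m x = (k \<rhd> m x) \<cdot> b" using commute[OF k f b mG(1)[OF x]] .
    have "(k \<rhd> m (inv k \<otimes> x)) \<cdot> b = m x \<cdot> a"
    proof (cases "inv x \<otimes> k \<otimes> x \<in> supp")
      case True
      then have "inv (inv x \<otimes> k \<otimes> x) \<in> supp" using subgroup.m_inv_closed[OF subgroup_supp] by blast
      then have "m (x \<otimes> inv (inv x \<otimes> k \<otimes> x)) = m x" using m x by (simp add: FM_grd)
      moreover have "x \<otimes> inv (inv x \<otimes> k \<otimes> x) = inv k \<otimes> x"
        using x k by (simp add: inv_mult_group m_assoc)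
      ultimately show ?thesis using ma mb by simp
    next
      case False
      \<comment> \<open>Translated back by \<open>inv x\<close>, the element \<open>b\<close> has a
        degree outside \<open>supp\<close>, where the corner at \<open>p\<close> is zero.\<close>
      have "(inv x) \<rhd> b \<in> Gr (inv x \<otimes> k \<otimes> x)" using act_Gr[of "inv x" k b] b k x by (simp add: cj_def)
      then have "p \<cdot> ((inv x) \<rhd> b) = 0" using False x k by (auto simp: supp_def)
      then have "(inv x) \<rhd> (pt x \<cdot> b) = (inv x) \<rhd> 0" using pt_shift[of "inv x" x b] x S p_Gr by simp
      then have z: "pt x \<cdot> b = 0" using act_inj[of "inv x" "pt x \<cdot> b" 0] x S by simp
      define u where "u = k \<rhd> m (inv k \<otimes> x)"
      have uS: "u \<in> Sp" using k y mS by (simp add: u_def)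
      have "u = pt x \<cdot> u"
        using pt_shift[OF k y mS[OF y]] mG(2)[OF y] k x by (simp add: u_def)
      then have "u \<cdot> b = pt x \<cdot> (u \<cdot> b)" using assoc_one[OF pt_Gr[OF x] uS S(2)] by metis
      also have "\<dots> = 0" using left_commute_one[OF pt_Gr[OF x] uS S(2)] z uS by simp
      finally have "u \<cdot> b = 0" .
      moreover have "b \<cdot> m x = 0"
        using left_commute_one[OF pt_Gr[OF x] S(2) mS[OF x]] assoc_one[OF pt_Gr[OF x] S(2) mS[OF x]] mG(2)[OF x] z mS[OF x]
        by simp
      ultimately show ?thesis using ma by (simp add: u_def)
    qed
    then show ?thesis using x by (simp add: FM_mact FM_act)
  qed (simp add: FM_mact)
  then have "mact FM (act FM k m) b = mact FM m a" by (simp add: fun_eq_iff)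
  then show "case_prod (mact FM) (case_prod (braid FM (cj G f g)) (braid A f m a)) = mact FM m a"
    by (simp add: braid_def k_def b_def)
qed

text \<open>If the module is free, then \<open>x \<mapsto> [x \<in> supp] p\<close> has the form \<open>x \<mapsto> pt x \<cdot> a\<close> for a single \<open>a\<close>, since
  invariant elements of degree \<open>\<one>\<close> are multiples of \<open>x \<mapsto> pt x\<close>. The latter is constant on \<open>stab\<close>.\<close>

lemma stab_eq_supp:
  assumes lag: "lagrangian G \<alpha> A"
  shows "stab = supp"
proof
  show "supp \<subseteq> stab" by (rule supp_subset)
  interpret FM: graded_sum "scal FM" G "grd FM" by (rule graded_sum_zobject[OF zobject_FM])
  obtain n where iso: "mod_isomorphic G A FM (regular_power n A)"
    using lagrangian_local_module[OF lag right_module_FM local_module_FM] by blast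
  obtain e where e': "(\<forall>i<n. e i \<in> grd FM \<one> \<and> (\<forall>f\<in>carrier G. act FM f (e i) = e i)) \<and>
      (\<forall>m\<in>space G FM. \<exists>a. (\<forall>i<n. a i \<in> Sp) \<and> m = (\<Sum>i<n. mact FM (e i) (a i)))"
    using regular_power_generators[OF right_module_FM iso] by (rule exE)
  have e: "e i \<in> grd FM \<one>" "f \<in> carrier G \<Longrightarrow> act FM f (e i) = e i" if "i < n" for i f
    using e' that by blast+
  define m where "m x = (if x \<in> supp then p else 0)" for x
  have "m \<in> grd FM \<one>"
    unfolding FM_grd
  proof (intro conjI ballI allI impI)
    fix x assume x: "x \<in> carrier G"
    show "m x \<in> Gr \<one>" by (simp add: m_def p_Gr)
    show "pt x \<cdot> m x = m x" using supp_subset x p_idem by (auto simp: m_def stab_def)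
    fix s assume s: "s \<in> supp"
    have "x \<otimes> s \<in> supp \<longleftrightarrow> x \<in> supp"
    proof
      assume "x \<otimes> s \<in> supp"
      then have "x \<otimes> s \<otimes> inv s \<in> supp"
        using subgroup.m_closed[OF subgroup_supp] subgroup.m_inv_closed[OF subgroup_supp s] by blast
      then show "x \<in> supp" using x supp_closed[OF s] by (simp add: m_assoc)
    qed (use subgroup.m_closed[OF subgroup_supp] s in blast)
    then show "m (x \<otimes> s) = m x" by (simp add: m_def)
  qed (simp add: m_def supp_def)
  then have "m \<in> space G FM" using FM.grd_total[OF one_closed] by blast
  then obtain a where a: "\<And>i. i < n \<Longrightarrow> a i \<in> Sp" "m = (\<Sum>i<n. mact FM (e i) (a i))" using e' by blast
  have "e i x = e i \<one>" if i: "i < n" and x: "x \<in> stab" for i x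
  proof -
    have xG: "x \<in> carrier G" using x stab_closed by blast
    have "e i \<one> \<in> Gr \<one>" "pt \<one> \<cdot> e i \<one> = e i \<one>" using e(1)[OF i] unfolding FM_grd by blast+
    then have e1: "e i \<one> \<in> Gr \<one>" "p \<cdot> e i \<one> = e i \<one>" by simp_all
    obtain c where c: "e i \<one> = c \<star> p" using p_prim[OF e1(1)] e1(2) by auto
    have "e i x = x \<rhd> e i \<one>" using fun_cong[OF e(2)[OF i xG], of x] xG by (simp add: FM_act)
    then show ?thesis using c x xG by (simp add: act_scale stab_def)
  qed
  then have "m x = m \<one>" if "x \<in> stab" for x
    unfolding a(2) sum_fun_apply using that stab_closed[OF that] by (simp add: FM_mact)
  moreover have "m \<one> \<noteq> 0" using subgroup.one_closed[OF subgroup_supp] p_nz by (simp add: m_def)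
  ultimately show "stab \<subseteq> supp" by (metis m_def subsetI)
qed

end

section \<open>The isomorphism with \<open>L(H,\<gamma>)\<close>\<close>

text \<open>Isolates what is kept of the Lagrangian condition: every degree in the stabiliser occurs
  in the corner at \<open>p\<close>.\<close>

locale lagrangian_point = etale_point G \<alpha> A p
  for G (structure) and \<alpha> :: "'a \<Rightarrow> 'a \<Rightarrow> 'a \<Rightarrow> 'k::{alg_closed_field, field_char_0}"
    and A :: "('a, 'k, 'v::ab_group_add) zalg" and p :: 'v +
  assumes supp_stab: "supp = stab"
begin

lemma stab_mult: "f \<in> stab \<Longrightarrow> g \<in> stab \<Longrightarrow> f \<otimes> g \<in> stab"
  and stab_inv: "f \<in> stab \<Longrightarrow> inv f \<in> stab" and stab_one: "\<one> \<in> stab"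
  using subgroup_stab by (simp_all add: subgroup.m_closed subgroup.m_inv_closed subgroup.one_closed)

lemma stab_cj: "f \<in> stab \<Longrightarrow> g \<in> stab \<Longrightarrow> cj G f g \<in> stab"
  by (simp add: cj_def stab_mult stab_inv)

lemma stab_cj_iff: "f \<in> stab \<Longrightarrow> g \<in> carrier G \<Longrightarrow> cj G f g \<in> stab \<longleftrightarrow> g \<in> stab"
  using stab_cj[of f g] stab_cj[of "inv f" "cj G f g"] stab_inv stab_closed by auto

lemma finite_stab: "finite stab"
  using fin by (simp add: stab_def)

section \<open>Structure constants of the corner at \<open>p\<close>\<close>

text \<open>The value at \<open>\<one>\<close> is fixed to be \<open>p\<close>, the unit of the
  corner, so that \<open>\<gamma>\<close> comes out normalised; elsewhere any nonzero vector of the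
  line will do.\<close>

definition u where "u h = (if h = \<one> then p else SOME a. a \<in> Gr h \<and> p \<cdot> a = a \<and> a \<noteq> 0)"

lemma u_one [simp]: "u \<one> = p"
  by (simp add: u_def)

lemma u:
  assumes "h \<in> stab"
  shows "u h \<in> Gr h" "p \<cdot> u h = u h" "u h \<noteq> 0"
proof -
  have "\<exists>a. a \<in> Gr h \<and> p \<cdot> a = a \<and> a \<noteq> 0" using assms supp_stab suppE by metis
  from someI_ex[OF this] show "u h \<in> Gr h" "p \<cdot> u h = u h" "u h \<noteq> 0"
    using p_Gr p_idem p_nz by (auto simp: u_def)
qed

lemma u_Sp [simp]: "h \<in> stab \<Longrightarrow> u h \<in> Sp"
  using u(1) Gr_Sp stab_closed by blast

lemma u_line:
  assumes h: "h \<in> stab" and "a \<in> Gr h" "p \<cdot> a = a"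
  obtains c where "a = c \<star> u h"
  using p_line[OF stab_closed[OF h] u[OF h] assms(2,3)] by blast

lemma u_cancel: "h \<in> stab \<Longrightarrow> c \<star> u h = d \<star> u h \<longleftrightarrow> c = d"
  using u(3) by simp

definition \<gamma> where "\<gamma> f g = (THE c. u f \<cdot> u g = c \<star> u (f \<otimes> g))"

lemma u_mult:
  assumes f: "f \<in> stab" and g: "g \<in> stab"
  shows "u f \<cdot> u g = \<gamma> f g \<star> u (f \<otimes> g)"
proof -
  have "u f \<cdot> u g \<in> Gr (f \<otimes> g)" using mul_Gr[OF stab_closed[OF f] stab_closed[OF g] u(1)[OF f] u(1)[OF g]] .
  moreover have "p \<cdot> (u f \<cdot> u g) = u f \<cdot> u g" using p_mul f g u by simp
  ultimately obtain c where c: "u f \<cdot> u g = c \<star> u (f \<otimes> g)" using u_line stab_mult[OF f g] by metis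
  then have "\<gamma> f g = c" unfolding \<gamma>_def using u(3)[OF stab_mult[OF f g]] by (intro the_equality) auto
  then show ?thesis using c by simp
qed

lemma \<gamma>_nz:
  assumes f: "f \<in> stab" and g: "g \<in> stab"
  shows "\<gamma> f g \<noteq> 0"
  using p_mul_nz[OF stab_closed[OF f] stab_closed[OF g] u[OF f] u[OF g]] u_mult[OF f g] by auto

lemma \<gamma>_cochain: "normalised_2cochain G stab \<gamma>"
proof -
  have "\<gamma> \<one> f = 1" "\<gamma> f \<one> = 1" if f: "f \<in> stab" for f
  proof -
    have "\<gamma> \<one> f \<star> u f = 1 \<star> u f" using u_mult[OF stab_one f] u(2)[OF f] stab_closed[OF f] by simp
    then show "\<gamma> \<one> f = 1" using u_cancel[OF f] by blast
    have "\<gamma> f \<one> \<star> u f = 1 \<star> u f"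
      using u_mult[OF f stab_one] u(2)[OF f] central[OF p_Gr u_Sp[OF f]] stab_closed[OF f] by simp
    then show "\<gamma> f \<one> = 1" using u_cancel[OF f] by blast
  qed
  then show ?thesis using \<gamma>_nz by (simp add: normalised_2cochain_def)
qed

text \<open>Both bracketings of \<open>u f\<close>, \<open>u g\<close>, \<open>u h\<close> are
  multiples of the same nonzero vector, and the associator between them is
  \<open>\<alpha> f g h\<close>.\<close>

lemma \<gamma>_coboundary:
  assumes f: "f \<in> stab" and g: "g \<in> stab" and h: "h \<in> stab"
  shows "coboundary G \<gamma> f g h = \<alpha> f g h"
proof -
  note S = f[THEN stab_closed] g[THEN stab_closed] h[THEN stab_closed]
  note fg = stab_mult[OF f g] and gh = stab_mult[OF g h]
  have "(\<gamma> g h * \<gamma> f (g \<otimes> h)) \<star> u (f \<otimes> g \<otimes> h) = u f \<cdot> (u g \<cdot> u h)"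
    using u_mult[OF g h] u_mult[OF f gh] f g h gh S by (simp add: mul_scale_right m_assoc)
  also have "\<dots> = \<alpha> f g h \<star> (u f \<cdot> u g \<cdot> u h)" using assoc[OF S u(1)[OF f] u(1)[OF g] u(1)[OF h]] .
  also have "\<dots> = (\<alpha> f g h * (\<gamma> f g * \<gamma> (f \<otimes> g) h)) \<star> u (f \<otimes> g \<otimes> h)"
    using u_mult[OF f g] u_mult[OF fg h] f g h fg by (simp add: mul_scale_left)
  finally have "\<gamma> g h * \<gamma> f (g \<otimes> h) = \<alpha> f g h * (\<gamma> f g * \<gamma> (f \<otimes> g) h)"
    using u_cancel[OF stab_mult[OF fg h]] by blast
  then show ?thesis using \<gamma>_nz f g h fg gh by (simp add: coboundary_def field_simps)
qed

lemma act_p_fixed: "h \<in> stab \<Longrightarrow> a \<in> Sp \<Longrightarrow> h \<rhd> (p \<cdot> a) = p \<cdot> (h \<rhd> a)"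
  using act_mul_one[of h p a] p_Gr by (simp add: stab_def)

text \<open>The scalar is forced by braided commutativity of \<open>u h\<close> and
  \<open>u f\<close>; it is the one that defines the action on \<open>k[H,\<gamma>]\<close>.\<close>

lemma act_u:
  assumes h: "h \<in> stab" and f: "f \<in> stab"
  shows "h \<rhd> u f = (\<gamma> h f / \<gamma> (cj G h f) h) \<star> u (cj G h f)"
proof -
  note S = h[THEN stab_closed] f[THEN stab_closed]
  have k: "cj G h f \<in> stab" using stab_cj h f .
  have "h \<rhd> u f \<in> Gr (cj G h f)" using act_Gr[OF S u(1)[OF f]] .
  moreover have "p \<cdot> (h \<rhd> u f) = h \<rhd> u f" using act_p_fixed[OF h, of "u f"] u f by simp
  ultimately obtain c where c: "h \<rhd> u f = c \<star> u (cj G h f)" using u_line k by metis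
  have "\<gamma> h f \<star> u (h \<otimes> f) = (h \<rhd> u f) \<cdot> u h"
    using commute[OF S u(1)[OF h] u(1)[OF f]] u_mult[OF h f] by simp
  also have "\<dots> = (c * \<gamma> (cj G h f) h) \<star> u (h \<otimes> f)"
    using c u_mult[OF k h] k h S by (simp add: mul_scale_left cj_mult_commute)
  finally have "\<gamma> h f = c * \<gamma> (cj G h f) h" using u_cancel[OF stab_mult[OF h f]] by blast
  then show ?thesis using c \<gamma>_nz[OF k h] by simp
qed

text \<open>The coordinate of \<open>p \<cdot> v\<close> along \<open>u h\<close>, meaningful for
  \<open>v\<close> of degree \<open>h\<close> in \<open>stab\<close>.\<close>

definition \<kappa> where "\<kappa> h v = (THE c. p \<cdot> v = c \<star> u h)"

lemma \<kappa>_eqI: "h \<in> stab \<Longrightarrow> p \<cdot> v = c \<star> u h \<Longrightarrow> \<kappa> h v = c"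
  unfolding \<kappa>_def using u(3) by (intro the_equality) auto

lemma \<kappa>:
  assumes h: "h \<in> stab" and v: "v \<in> Gr h"
  shows "p \<cdot> v = \<kappa> h v \<star> u h"
proof -
  have hG: "h \<in> carrier G" using h stab_closed by blast
  obtain c where c: "p \<cdot> v = c \<star> u h"
    using u_line[OF h, of "p \<cdot> v"] p_fix[of v] mul_Gr_one[OF hG p_Gr v] Gr_Sp[OF hG v] by metis
  then show ?thesis using \<kappa>_eqI[OF h c] by simp
qed

lemma \<kappa>_add: "h \<in> stab \<Longrightarrow> v \<in> Gr h \<Longrightarrow> w \<in> Gr h \<Longrightarrow> \<kappa> h (v + w) = \<kappa> h v + \<kappa> h w"
  using \<kappa>[of h v] \<kappa>[of h w] by (intro \<kappa>_eqI) (auto simp: mul_add_right Gr_Sp[OF stab_closed] V.scale_left_distrib)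

lemma \<kappa>_scale: "h \<in> stab \<Longrightarrow> v \<in> Gr h \<Longrightarrow> \<kappa> h (c \<star> v) = c * \<kappa> h v"
  using \<kappa>[of h v] by (intro \<kappa>_eqI) (auto simp: mul_scale_right Gr_Sp[OF stab_closed])

lemma \<kappa>_zero: "h \<in> stab \<Longrightarrow> p \<cdot> v = 0 \<Longrightarrow> \<kappa> h v = 0"
  by (rule \<kappa>_eqI) auto

section \<open>The comparison map to \<open>L(H,\<gamma>)\<close> in coordinates\<close>

abbreviation T where "T \<equiv> twisted_group_algebra G stab \<gamma>"
abbreviation E where "E \<equiv> L_alg G \<alpha> stab \<gamma>"

lemma T_scal: "scal T = (\<lambda>c a x. c * a x)" and T_grd: "grd T f = {(\<lambda>x. c * bvec f x) | c. True}"
  and T_unit: "aunit T = bvec \<one>"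
  by (simp_all add: twisted_group_algebra_def)

lemma T_act:
  assumes "s \<in> stab"
  shows "act T h (\<lambda>x. c * bvec s x) = (\<lambda>x. c * (\<gamma> h s / \<gamma> (cj G h s) h) * bvec (cj G h s) x)"
proof
  fix x
  have "act T h (\<lambda>x. c * bvec s x) x
      = (\<Sum>f\<in>stab. if f = s then c * (\<gamma> h s / \<gamma> (cj G h s) h) * bvec (cj G h s) x else 0)"
    by (auto simp: twisted_group_algebra_def bvec_def intro!: sum.cong)
  then show "act T h (\<lambda>x. c * bvec s x) x = c * (\<gamma> h s / \<gamma> (cj G h s) h) * bvec (cj G h s) x"
    using finite_stab assms by simp
qed

lemma T_act_zero: "act T h (\<lambda>x. 0) = (\<lambda>x. 0)"
  by (simp add: twisted_group_algebra_def)

lemma T_mul: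
  assumes "s \<in> stab" "t \<in> stab"
  shows "amul T (\<lambda>x. c * bvec s x) (\<lambda>x. d * bvec t x) = (\<lambda>x. c * d * \<gamma> s t * bvec (s \<otimes> t) x)"
proof
  fix x
  have "amul T (\<lambda>x. c * bvec s x) (\<lambda>x. d * bvec t x) x
      = (\<Sum>f\<in>stab. if f = s then (\<Sum>g\<in>stab. if g = t then c * d * \<gamma> s t * bvec (s \<otimes> t) x else 0) else 0)"
    by (auto simp: twisted_group_algebra_def bvec_def intro!: sum.cong)
  then show "amul T (\<lambda>x. c * bvec s x) (\<lambda>x. d * bvec t x) x = c * d * \<gamma> s t * bvec (s \<otimes> t) x"
    using finite_stab assms by simp
qed

lemma T_mul_zero: "amul T (\<lambda>x. 0) b = (\<lambda>x. 0)" "amul T a (\<lambda>x. 0) = (\<lambda>x. 0)"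
  by (simp_all add: twisted_group_algebra_def)

lemma E_scal: "scal E = (\<lambda>c a x h. c * a x h)" and E_grd: "grd E = E_grd G \<alpha> stab T"
  and E_unit: "aunit E = (\<lambda>x. if x \<in> carrier G then bvec \<one> else 0)"
  and E_act: "act E g a x = (if x \<in> carrier G then \<Sum>f\<in>carrier G.
    scal T (inverse (acoef G \<alpha> (inv x) g f)) (hom_part G (grd E) a f (inv g \<otimes> x)) else 0)"
  and E_mul: "amul E a b x = (if x \<in> carrier G then \<Sum>f\<in>carrier G. \<Sum>g\<in>carrier G.
    scal T (tcoef G \<alpha> (inv x) f g) (amul T (hom_part G (grd E) a f x) (hom_part G (grd E) b g x)) else 0)"
  by (simp_all add: L_alg_def E_alg_def Let_def T_scal T_unit cong: if_cong)

text \<open>The map of the overview with \<open>p \<cdot> ((inv x) \<rhd> a)\<close> replaced by its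
  coordinates along the vectors \<open>u h\<close>. Splitting into homogeneous parts first is needed
  because \<open>\<kappa> h\<close> makes sense only in degree \<open>h\<close>.\<close>

definition \<phi> where
  "\<phi> a = (\<lambda>x h. if x \<in> carrier G \<and> h \<in> stab then \<kappa> h (hom_part G Gr ((inv x) \<rhd> a) h) else 0)"

lemma \<phi>_hom:
  assumes f: "f \<in> carrier G" and a: "a \<in> Gr f" and x: "x \<in> carrier G"
  shows "\<phi> a x = (if cj G (inv x) f \<in> stab
    then (\<lambda>h. \<kappa> (cj G (inv x) f) ((inv x) \<rhd> a) * bvec (cj G (inv x) f) h) else (\<lambda>h. 0))"
proof
  fix h
  have g: "cj G (inv x) f \<in> carrier G" and xa: "(inv x) \<rhd> a \<in> Gr (cj G (inv x) f)"
    using act_Gr f a x by simp_all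
  show "\<phi> a x h = (if cj G (inv x) f \<in> stab
    then (\<lambda>h. \<kappa> (cj G (inv x) f) ((inv x) \<rhd> a) * bvec (cj G (inv x) f) h) else (\<lambda>h. 0)) h"
  proof (cases "h \<in> stab")
    case True
    then show ?thesis
      using V.hom_part_homogeneous[OF g xa stab_closed[OF True]] x \<kappa>_zero[OF True, of 0]
      by (auto simp: \<phi>_def bvec_def)
  qed (auto simp: \<phi>_def bvec_def)
qed

lemma \<phi>_linear: "linear_on Sp (scal A) (scal E) \<phi>"
proof -
  have "\<phi> (a + b) x h = \<phi> a x h + \<phi> b x h" "\<phi> (c \<star> a) x h = c * \<phi> a x h"
    if ab: "a \<in> Sp" "b \<in> Sp" for a b c x h
  proof -
    consider "x \<in> carrier G" "h \<in> stab" | "\<not> (x \<in> carrier G \<and> h \<in> stab)" by blast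
    then have "\<phi> (a + b) x h = \<phi> a x h + \<phi> b x h \<and> \<phi> (c \<star> a) x h = c * \<phi> a x h"
    proof cases
      case 1
      have hG: "h \<in> carrier G" using 1 stab_closed by blast
      have S: "(inv x) \<rhd> a \<in> Sp" "(inv x) \<rhd> b \<in> Sp" using ab 1 by simp_all
      note lin = linear_onD[OF V.hom_part_linear[OF hG]]
      show ?thesis
        using 1 ab S V.hom_part(1)[OF S(1) hG] V.hom_part(1)[OF S(2) hG]
        by (simp add: \<phi>_def act_add act_scale lin \<kappa>_add \<kappa>_scale)
    qed (auto simp: \<phi>_def)
    then show "\<phi> (a + b) x h = \<phi> a x h + \<phi> b x h" "\<phi> (c \<star> a) x h = c * \<phi> a x h" by auto
  qed
  then show ?thesis by (simp add: linear_on_def E_scal fun_eq_iff)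
qed

text \<open>Equivariance under \<open>h\<close> in \<open>stab\<close>: acting by
  \<open>inv (x \<otimes> h)\<close> is, up to \<open>acoef\<close>, acting by \<open>inv x\<close>
  and then by \<open>inv h\<close>. The latter fixes \<open>p\<close>, and by \<open>act_u\<close>
  it moves the coordinates as in \<open>k[H,\<gamma>]\<close>.\<close>

lemma \<phi>_E_grd:
  assumes f: "f \<in> carrier G" and a: "a \<in> Gr f"
  shows "\<phi> a \<in> grd E f"
  unfolding E_grd E_grd_def
proof (intro CollectI conjI ballI allI impI)
  fix x assume x: "x \<in> carrier G"
  define s where "s = cj G (inv x) f"
  define xa where "xa = (inv x) \<rhd> a"
  have s: "s \<in> carrier G" "xa \<in> Gr s" using act_Gr f a x by (simp_all add: s_def xa_def)
  have \<phi>x: "\<phi> a x = (if s \<in> stab then (\<lambda>h. \<kappa> s xa * bvec s h) else (\<lambda>h. 0))"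
    using \<phi>_hom[OF f a x] by (simp add: s_def xa_def)
  show "\<phi> a x \<in> (if inv x \<otimes> f \<otimes> x \<in> stab then grd T (inv x \<otimes> f \<otimes> x) else {0})"
    using \<phi>x cj_inv_eq[OF x, of f] by (auto simp: T_grd s_def zero_fun_def)
  fix h assume h: "h \<in> stab"
  have hG: "h \<in> carrier G" using h stab_closed by blast
  define t where "t = cj G (inv h) s"
  have t: "cj G (inv (x \<otimes> h)) f = t" using cj_mult[of "inv h" "inv x" f] f x hG
    by (simp add: t_def s_def inv_mult_group)
  let ?c = "acoef G \<alpha> (inv h) (inv x) f"
  have xha: "(inv (x \<otimes> h)) \<rhd> a = ?c \<star> (inv h) \<rhd> xa"
    using act_comp[of "inv h" "inv x" f a] f a x hG by (simp add: inv_mult_group xa_def)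
  show "\<phi> a (x \<otimes> h) = scal T ?c (act T (inv h) (\<phi> a x))"
  proof (cases "s \<in> stab")
    case True
    then have tH: "t \<in> stab" using stab_cj stab_inv h by (simp add: t_def)
    have xaS: "xa \<in> Sp" using s Gr_Sp by blast
    have "p \<cdot> (?c \<star> (inv h) \<rhd> xa) = ?c \<star> (inv h) \<rhd> (p \<cdot> xa)"
      using act_p_fixed[OF stab_inv[OF h] xaS] xaS hG by (simp add: mul_scale_right)
    also have "\<dots> = (?c * (\<kappa> s xa * (\<gamma> (inv h) s / \<gamma> t (inv h)))) \<star> u t"
      using \<kappa>[OF True s(2)] act_u[OF stab_inv[OF h] True] True hG by (simp add: act_scale t_def)
    finally have "\<kappa> t (?c \<star> (inv h) \<rhd> xa) = ?c * (\<kappa> s xa * (\<gamma> (inv h) s / \<gamma> t (inv h)))"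
      by (rule \<kappa>_eqI[OF tH])
    then show ?thesis
      using \<phi>_hom[OF f a, of "x \<otimes> h"] x hG tH True
      by (simp add: t xha \<phi>x T_act T_scal t_def mult.assoc)
  next
    case False
    then have "t \<notin> stab" using stab_cj_iff[OF stab_inv[OF h] s(1)] by (simp add: t_def)
    then show ?thesis
      using \<phi>_hom[OF f a, of "x \<otimes> h"] x hG False by (simp add: t \<phi>x T_act_zero T_scal)
  qed
qed (simp add: \<phi>_def zero_fun_def)

text \<open>If \<open>\<phi> a\<close> vanishes, translating back shows that each
  \<open>pt x\<close> annihilates \<open>a\<close>; these idempotents sum to a nonzero multiple of
  \<open>unit\<close>.\<close>

lemma \<phi>_kernel:
  assumes f: "f \<in> carrier G" and a: "a \<in> Gr f" and "\<phi> a = 0"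
  shows "a = 0"
proof -
  have aS: "a \<in> Sp" using a f Gr_Sp by blast
  have "pt x \<cdot> a = 0" if x: "x \<in> carrier G" for x
  proof -
    let ?s = "cj G (inv x) f"
    have xa: "(inv x) \<rhd> a \<in> Gr ?s" using act_Gr f a x by simp
    have "p \<cdot> ((inv x) \<rhd> a) = 0"
    proof (cases "?s \<in> stab")
      case True
      then have "\<kappa> ?s ((inv x) \<rhd> a) = 0"
        using fun_cong[OF \<phi>_hom[OF f a x], of ?s] assms(3) by (simp add: bvec_def)
      then show ?thesis using \<kappa>[OF True xa] by simp
    next
      case False
      then show ?thesis using p_support[OF _ xa] f x by (metis cj_closed inv_closed)
    qed
    then have "(inv x) \<rhd> (pt x \<cdot> a) = (inv x) \<rhd> 0" using pt_shift[of "inv x" x a] x aS by simp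
    then show ?thesis using act_inj[of "inv x" "pt x \<cdot> a" 0] x aS by simp
  qed
  then have "(of_nat (card stab) \<star> unit) \<cdot> a = 0"
    using mul_sum_left[of "carrier G" "\<lambda>x. pt x" a] aS sum_pt by simp
  then show ?thesis using stab_card_nz aS mul_scale_left[of unit a] by simp
qed

lemma card_left_coset:
  assumes z: "z \<in> carrier G"
  shows "card {y \<in> carrier G. inv z \<otimes> y \<in> stab} = card stab"
proof -
  have "bij_betw (\<lambda>h. z \<otimes> h) stab {y \<in> carrier G. inv z \<otimes> y \<in> stab}"
    by (rule bij_betwI[of _ _ _ "\<lambda>y. inv z \<otimes> y"]) (use z stab_closed in auto)
  then show ?thesis by (simp add: bij_betw_same_card)
qed

text \<open>The value \<open>e x\<close> gives a vector \<open>r x\<close> of the corner at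
  \<open>p\<close>; carried to the corner at \<open>pt x\<close> it becomes \<open>w x\<close>,
  which depends only on the coset of \<open>x\<close>. The average of the \<open>w x\<close> is the
  preimage, since \<open>p\<close> sees only the coset in question.\<close>

lemma \<phi>_surj:
  assumes f: "f \<in> carrier G" and e: "e \<in> grd E f"
  shows "e \<in> \<phi> ` Gr f"
proof -
  define s where "s x = cj G (inv x) f" for x
  have sG: "s x \<in> carrier G" if "x \<in> carrier G" for x using that f by (simp add: s_def)
  have e1: "e x = (if s x \<in> stab then (\<lambda>h. e x (s x) * bvec (s x) h) else (\<lambda>h. 0))"
    if x: "x \<in> carrier G" for x
  proof -
    have "e x \<in> (if inv x \<otimes> f \<otimes> x \<in> stab then grd T (inv x \<otimes> f \<otimes> x) else {0})"
      using e x unfolding E_grd E_grd_def by blast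
    then have "e x \<in> (if s x \<in> stab then grd T (s x) else {0})" by (simp only: s_def cj_inv_eq[OF x])
    then show ?thesis by (auto simp: T_grd bvec_def zero_fun_def fun_eq_iff split: if_splits)
  qed
  have e2: "e (x \<otimes> h) = scal T (acoef G \<alpha> (inv h) (inv x) f) (act T (inv h) (e x))"
    if "x \<in> carrier G" "h \<in> stab" for x h
    using e that by (simp add: E_grd E_grd_def)
  have e3: "e x = 0" if "x \<notin> carrier G" for x using e that by (simp add: E_grd E_grd_def)
  define r where "r x = (if s x \<in> stab then e x (s x) \<star> u (s x) else 0)" for x
  have rG: "r x \<in> Gr (s x)" if "x \<in> carrier G" for x using u(1) sG[OF that] by (simp add: r_def)
  then have rS: "r x \<in> Sp" if "x \<in> carrier G" for x using that sG Gr_Sp by blast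
  have pr: "p \<cdot> r x = r x" for x using u(2) by (simp add: r_def mul_scale_right)
  \<comment> \<open>The equivariance imposed on \<open>e\<close> becomes that of \<open>r\<close>,
    because \<open>act_u\<close> matches the action on \<open>k[H,\<gamma>]\<close>.\<close>
  have r_shift: "r (x \<otimes> h) = acoef G \<alpha> (inv h) (inv x) f \<star> (inv h) \<rhd> r x"
    if x: "x \<in> carrier G" and h: "h \<in> stab" for x h
  proof -
    have hG: "h \<in> carrier G" using h stab_closed by blast
    have t: "s (x \<otimes> h) = cj G (inv h) (s x)" using cj_mult[of "inv h" "inv x" f] f x hG
      by (simp add: s_def inv_mult_group)
    show ?thesis
    proof (cases "s x \<in> stab")
      case True
      then have tH: "s (x \<otimes> h) \<in> stab" using t stab_cj stab_inv h by simp
      have "act T (inv h) (e x)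
          = (\<lambda>k. e x (s x) * (\<gamma> (inv h) (s x) / \<gamma> (s (x \<otimes> h)) (inv h)) * bvec (s (x \<otimes> h)) k)"
        by (subst e1[OF x]) (simp add: True T_act t)
      then have "e (x \<otimes> h) (s (x \<otimes> h)) = acoef G \<alpha> (inv h) (inv x) f *
          (e x (s x) * (\<gamma> (inv h) (s x) / \<gamma> (s (x \<otimes> h)) (inv h)))"
        by (simp add: e2[OF x h] T_scal bvec_def)
      then show ?thesis
        using True tH hG act_u[OF stab_inv[OF h] True] by (simp add: r_def act_scale t)
    next
      case False
      then have "s (x \<otimes> h) \<notin> stab" using stab_cj_iff[OF stab_inv[OF h] sG[OF x]] by (simp add: t)
      then show ?thesis using False hG by (simp add: r_def)
    qed
  qed
  \<comment> \<open>A preimage under \<open>inv x\<close> is chosen instead of acting on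
    \<open>r x\<close> by \<open>x\<close>, since the two actions are inverse only up to a
    scalar.\<close>
  have "\<forall>x\<in>carrier G. \<exists>w\<in>Gr f. (inv x) \<rhd> w = r x"
    using act_Gr_image[OF _ f] rG by (metis imageE inv_closed s_def)
  then obtain w where w: "\<And>x. x \<in> carrier G \<Longrightarrow> w x \<in> Gr f" "\<And>x. x \<in> carrier G \<Longrightarrow> (inv x) \<rhd> w x = r x"
    by metis
  have wS: "w x \<in> Sp" if "x \<in> carrier G" for x using w that Gr_Sp f by blast
  have w_shift: "w (x \<otimes> h) = w x" if x: "x \<in> carrier G" and h: "h \<in> stab" for x h
  proof -
    have hG: "h \<in> carrier G" using h stab_closed by blast
    have "(inv (x \<otimes> h)) \<rhd> w x = r (x \<otimes> h)"
      using act_comp[of "inv h" "inv x" f "w x"] w x hG f r_shift[OF x h] by (simp add: inv_mult_group)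
    then show ?thesis using act_inj[of "inv (x \<otimes> h)" "w (x \<otimes> h)" "w x"] w(2) wS x hG by simp
  qed
  have ptw: "pt x \<cdot> w x = w x" if x: "x \<in> carrier G" for x
  proof -
    have "(inv x) \<rhd> (pt x \<cdot> w x) = (inv x) \<rhd> w x"
      using pt_shift[of "inv x" x "w x"] x wS w(2) pr by simp
    then show ?thesis using act_inj[of "inv x" "pt x \<cdot> w x" "w x"] x wS by simp
  qed
  \<comment> \<open>For \<open>y\<close> in the coset of \<open>z\<close> the vectors
    \<open>w y\<close> and \<open>w z\<close> agree; otherwise \<open>w y\<close> lies in the corner
    at \<open>pt y\<close>, whose translate is orthogonal to \<open>p\<close>.\<close>
  have pw: "p \<cdot> ((inv z) \<rhd> w y) = (if inv z \<otimes> y \<in> stab then r z else 0)"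
    if z: "z \<in> carrier G" and y: "y \<in> carrier G" for z y
  proof (cases "inv z \<otimes> y \<in> stab")
    case True
    then have "w y = w z" using w_shift[OF z True] z y by simp
    then show ?thesis using w(2)[OF z] pr True by simp
  next
    case False
    have "(inv z) \<rhd> w y = pt (inv z \<otimes> y) \<cdot> ((inv z) \<rhd> w y)"
      using pt_shift[of "inv z" y "w y"] ptw wS z y by simp
    then have "p \<cdot> ((inv z) \<rhd> w y) = p \<cdot> pt (inv z \<otimes> y) \<cdot> ((inv z) \<rhd> w y)"
      using assoc_one[OF p_Gr, of "pt (inv z \<otimes> y)" "(inv z) \<rhd> w y"] wS z y by simp
    then show ?thesis using p_orth[of "inv z \<otimes> y"] False wS z y by simp
  qed
  let ?n = "of_nat (card stab) :: 'k"
  \<comment> \<open>Each coset contributes \<open>card stab\<close> equal summands, which explains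
    the factor.\<close>
  define b where "b = inverse ?n \<star> (\<Sum>y\<in>carrier G. w y)"
  have sumS: "(\<Sum>y\<in>carrier G. w y) \<in> Sp" and bG: "b \<in> Gr f"
    using w(1) wS f by (auto simp: b_def intro!: Sp_sum Gr_sum Gr_scale)
  have pb: "p \<cdot> ((inv z) \<rhd> b) = r z" if z: "z \<in> carrier G" for z
  proof -
    have "p \<cdot> ((inv z) \<rhd> (\<Sum>y\<in>carrier G. w y)) = (\<Sum>y\<in>carrier G. p \<cdot> ((inv z) \<rhd> w y))"
      using z wS by (simp add: act_sum mul_sum_right)
    also have "\<dots> = (\<Sum>y\<in>carrier G. if inv z \<otimes> y \<in> stab then r z else 0)"
      using pw z by (intro sum.cong) auto
    also have "\<dots> = (\<Sum>y\<in>{y \<in> carrier G. inv z \<otimes> y \<in> stab}. r z)"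
      by (rule sum.inter_filter[OF fin, symmetric])
    also have "\<dots> = ?n \<star> r z" by (simp only: V.sum_constant_scale card_left_coset[OF z])
    finally show ?thesis
      using z sumS stab_card_nz by (simp add: b_def act_scale mul_scale_right)
  qed
  have "\<phi> b = e"
  proof
    fix x
    show "\<phi> b x = e x"
    proof (cases "x \<in> carrier G")
      case x: True
      have "\<kappa> (s x) ((inv x) \<rhd> b) = e x (s x)" if "s x \<in> stab"
        using that pb[OF x] by (intro \<kappa>_eqI) (simp_all add: r_def)
      then show ?thesis by (subst e1[OF x]) (simp add: \<phi>_hom[OF f bG x] s_def)
    next
      case False
      then show ?thesis using e3 by (simp add: \<phi>_def zero_fun_def)
    qed
  qed
  then show ?thesis using bG by blast
qed

lemma \<phi>_image: "f \<in> carrier G \<Longrightarrow> \<phi> ` Gr f = grd E f"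
  using \<phi>_E_grd \<phi>_surj by blast

text \<open>Finite dimension is inherited from \<open>A\<close> through \<open>\<phi>\<close>.
  Directness is read off the supports: at a fixed \<open>x\<close>, different degrees
  \<open>g\<close> sit at different points \<open>cj G (inv x) g\<close>.\<close>

lemma graded_sum_E: "graded_sum (scal E) G (grd E)"
proof (rule graded_sumI)
  show vs: "vector_space (scal E)"
    using vector_space_fun[OF vector_space_fun[OF vector_space_times]] by (simp add: E_scal)
  show "finite (carrier G)" by (rule fin)
  show "fd_subspace (scal E) (grd E f)" if f: "f \<in> carrier G" for f
  proof -
    have "linear_on (Gr f) (scal A) (scal E) \<phi>"
      using linear_on_subset[OF \<phi>_linear] Gr_Sp[OF f] by blast
    from V.fd_subspace_image[OF vs this fd_Gr[OF f]] show ?thesis unfolding \<phi>_image[OF f] .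
  qed
  show "direct G (grd E)"
    unfolding direct_def
  proof (intro allI impI ballI)
    fix z g assume z: "(\<forall>g\<in>carrier G. z g \<in> grd E g) \<and> sum z (carrier G) = 0" and g: "g \<in> carrier G"
    have supported: "z g' x h = 0" if "g' \<in> carrier G" "x \<in> carrier G" "h \<noteq> cj G (inv x) g'" for g' x h
    proof -
      have "z g' x \<in> (if inv x \<otimes> g' \<otimes> x \<in> stab then grd T (inv x \<otimes> g' \<otimes> x) else {0})"
        using z that unfolding E_grd E_grd_def by blast
      then have "z g' x \<in> (if cj G (inv x) g' \<in> stab then grd T (cj G (inv x) g') else {0})"
        by (simp only: cj_inv_eq[OF that(2)])
      then show ?thesis using that(3) by (auto simp: T_grd bvec_def split: if_splits)
    qed
    show "z g = 0"
    proof (intro ext)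
      fix x h
      show "z g x h = 0 x h"
      proof (cases "x \<in> carrier G \<and> h = cj G (inv x) g")
        case True
        have "(\<Sum>g'\<in>carrier G. z g' x h) = (\<Sum>g'\<in>carrier G. if g' = g then z g x h else 0)"
        proof (rule sum.cong[OF refl])
          fix g' assume g': "g' \<in> carrier G"
          have "h \<noteq> cj G (inv x) g'" if "g' \<noteq> g"
            using that True g g' by (metis cj_inv(2))
          then show "z g' x h = (if g' = g then z g x h else 0)" using supported g' True by auto
        qed
        moreover have "(\<Sum>g'\<in>carrier G. z g' x h) = 0"
          using z sum_fun_apply[of z "carrier G" x] sum_fun_apply[of "\<lambda>g'. z g' x" "carrier G" h] by simp
        ultimately show ?thesis using fin g by simp
      next
        case False
        moreover have "x \<notin> carrier G \<Longrightarrow> z g x = 0" using z g unfolding E_grd E_grd_def by blast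
        ultimately show ?thesis using supported[OF g, of x h] False by (cases "x \<in> carrier G") auto
      qed
    qed
  qed
qed

lemma hom_part_\<phi>: "a \<in> Sp \<Longrightarrow> f \<in> carrier G \<Longrightarrow> hom_part G (grd E) (\<phi> a) f = \<phi> (hom_part G Gr a f)"
  by (rule V.hom_part_image[OF graded_sum_E \<phi>_linear]) (use \<phi>_image in auto)

text \<open>The composition law for \<open>inv x\<close> and \<open>g\<close> read backwards, which
  is where the inverse of \<open>acoef\<close> comes from.\<close>

lemma \<phi>_act_hom:
  assumes f: "f \<in> carrier G" and a: "a \<in> Gr f" and g: "g \<in> carrier G" and x: "x \<in> carrier G"
  shows "\<phi> (g \<rhd> a) x = scal T (inverse (acoef G \<alpha> (inv x) g f)) (\<phi> a (inv g \<otimes> x))"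
proof -
  let ?c = "acoef G \<alpha> (inv x) g f" and ?s = "cj G (inv x) (cj G g f)"
  have i: "inv (inv g \<otimes> x) = inv x \<otimes> g" using g x by (simp add: inv_mult_group)
  have s: "cj G (inv x \<otimes> g) f = ?s" using cj_mult f g x by simp
  have ga: "g \<rhd> a \<in> Gr (cj G g f)" using act_Gr f a g by blast
  have "(inv x \<otimes> g) \<rhd> a = ?c \<star> (inv x) \<rhd> g \<rhd> a" using act_comp f a g x by simp
  then have "?s \<in> stab \<Longrightarrow> \<kappa> ?s ((inv x \<otimes> g) \<rhd> a) = ?c * \<kappa> ?s ((inv x) \<rhd> g \<rhd> a)"
    using \<kappa>_scale act_Gr[OF _ _ ga] f g x by simp
  then show ?thesis
    using \<phi>_hom[OF _ ga x] \<phi>_hom[OF f a, of "inv g \<otimes> x"] acoef_nz[of "inv x" g f] f g x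
    by (simp add: i s T_scal mult.assoc[symmetric])
qed

text \<open>The scalar \<open>tcoef\<close> comes from acting by \<open>inv x\<close> on a product;
  multiplication by the central idempotent \<open>p\<close> is multiplicative, and
  \<open>u_mult\<close> turns the product into that of \<open>k[H,\<gamma>]\<close>.\<close>

lemma \<phi>_mul_hom:
  assumes f: "f \<in> carrier G" and a: "a \<in> Gr f" and g: "g \<in> carrier G" and b: "b \<in> Gr g" and x: "x \<in> carrier G"
  shows "\<phi> (a \<cdot> b) x = scal T (tcoef G \<alpha> (inv x) f g) (amul T (\<phi> a x) (\<phi> b x))"
proof -
  let ?c = "tcoef G \<alpha> (inv x) f g"
  define s t where "s = cj G (inv x) f" and "t = cj G (inv x) g"
  define a' b' where "a' = (inv x) \<rhd> a" and "b' = (inv x) \<rhd> b"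
  have st: "s \<in> carrier G" "t \<in> carrier G" using f g x by (simp_all add: s_def t_def)
  have G: "a' \<in> Gr s" "b' \<in> Gr t" using act_Gr f g a b x by (simp_all add: s_def t_def a'_def b'_def)
  then have S: "a' \<in> Sp" "b' \<in> Sp" using st Gr_Sp by blast+
  have ab: "(inv x) \<rhd> (a \<cdot> b) = ?c \<star> (a' \<cdot> b')" using act_mul f g a b x by (simp add: a'_def b'_def)
  have ab\<phi>: "\<phi> (a \<cdot> b) x = (if s \<otimes> t \<in> stab then (\<lambda>h. \<kappa> (s \<otimes> t) (?c \<star> (a' \<cdot> b')) * bvec (s \<otimes> t) h) else (\<lambda>h. 0))"
    using \<phi>_hom[OF m_closed[OF f g] mul_Gr[OF f g a b] x] cj_tensor[of "inv x" f g] f g x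
    by (simp add: ab s_def t_def)
  have a\<phi>: "\<phi> a x = (if s \<in> stab then (\<lambda>h. \<kappa> s a' * bvec s h) else (\<lambda>h. 0))"
    and b\<phi>: "\<phi> b x = (if t \<in> stab then (\<lambda>h. \<kappa> t b' * bvec t h) else (\<lambda>h. 0))"
    using \<phi>_hom[OF f a x] \<phi>_hom[OF g b x] by (simp_all add: s_def t_def a'_def b'_def)
  have split: "p \<cdot> (a' \<cdot> b') = (p \<cdot> a') \<cdot> (p \<cdot> b')"
    using assoc_one[OF p_Gr S(1), of "p \<cdot> b'"] left_commute_one[OF p_Gr S] p_fix[of "a' \<cdot> b'"] S by simp
  show ?thesis
  proof (cases "s \<in> stab \<and> t \<in> stab")
    case True
    then have sH: "s \<in> stab" and tH: "t \<in> stab" by auto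
    have "p \<cdot> (?c \<star> (a' \<cdot> b')) = (?c * (\<kappa> s a' * \<kappa> t b' * \<gamma> s t)) \<star> u (s \<otimes> t)"
      using split \<kappa>[OF sH G(1)] \<kappa>[OF tH G(2)] u_mult[OF sH tH] sH tH S
      by (simp add: mul_scale_left mul_scale_right)
    then have "\<kappa> (s \<otimes> t) (?c \<star> (a' \<cdot> b')) = ?c * (\<kappa> s a' * \<kappa> t b' * \<gamma> s t)"
      by (rule \<kappa>_eqI[OF stab_mult[OF sH tH]])
    then show ?thesis using sH tH stab_mult[OF sH tH] by (simp add: ab\<phi> a\<phi> b\<phi> T_mul T_scal mult.assoc)
  next
    case False
    \<comment> \<open>The product \<open>s \<otimes> t\<close> may lie in \<open>stab\<close>
      although a factor does not; the left side is then still 0 because \<open>p\<close> kills that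
      factor.\<close>
    then have "p \<cdot> a' = 0 \<or> p \<cdot> b' = 0" using p_support st G by blast
    then have "p \<cdot> (?c \<star> (a' \<cdot> b')) = 0" using split S by (auto simp: mul_scale_right)
    then have "\<kappa> (s \<otimes> t) (?c \<star> (a' \<cdot> b')) = 0" if "s \<otimes> t \<in> stab" using \<kappa>_zero that by blast
    then show ?thesis using False by (auto simp: ab\<phi> a\<phi> b\<phi> T_mul_zero T_scal)
  qed
qed

lemma sum_\<phi>: "(\<And>i. i \<in> I \<Longrightarrow> a i \<in> Sp) \<Longrightarrow> \<phi> (\<Sum>i\<in>I. a i) x = (\<Sum>i\<in>I. \<phi> (a i) x)"
  using V.linear_on_sum[OF \<phi>_linear V.total_subspace, of I a] by (simp add: sum_fun_apply)

lemma \<phi>_outside: "x \<notin> carrier G \<Longrightarrow> \<phi> a x = 0"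
  by (simp add: \<phi>_def zero_fun_def)

text \<open>Action and product of \<open>E\<close> are defined through homogeneous parts, with which
  \<open>\<phi>\<close> commutes, so linearity reduces both compatibilities to the homogeneous
  case.\<close>

lemma alg_isomorphic_E: "alg_isomorphic G A E"
proof -
  have hp: "hom_part G Gr a f \<in> Gr f" "hom_part G Gr a f \<in> Sp" if "a \<in> Sp" "f \<in> carrier G" for a f
    using V.hom_part(1)[OF that] V.grd_total[OF that(2)] by blast+
  have "\<phi> (g \<rhd> a) = act E g (\<phi> a)" if g: "g \<in> carrier G" and a: "a \<in> Sp" for g a
  proof
    fix x
    show "\<phi> (g \<rhd> a) x = act E g (\<phi> a) x"
    proof (cases "x \<in> carrier G")
      case x: True
      have "\<phi> (g \<rhd> a) x = \<phi> (\<Sum>f\<in>carrier G. g \<rhd> hom_part G Gr a f) x"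
        using V.linear_on_hom_parts[OF linear_act[OF g] a] by simp
      also have "\<dots> = (\<Sum>f\<in>carrier G. \<phi> (g \<rhd> hom_part G Gr a f) x)"
        using hp a g by (intro sum_\<phi>) simp
      also have "\<dots> = act E g (\<phi> a) x"
        using \<phi>_act_hom hp a g x by (simp add: E_act hom_part_\<phi>)
      finally show ?thesis .
    qed (simp add: \<phi>_outside E_act)
  qed
  then have hom: "zhom G A E \<phi>" using \<phi>_linear \<phi>_image by (simp add: zhom_def)
  have bij: "bij_betw \<phi> Sp (space G E)"
    by (rule V.bij_betw_total[OF graded_sum_E \<phi>_linear \<phi>_image \<phi>_kernel])
  have "\<phi> (a \<cdot> b) = amul E (\<phi> a) (\<phi> b)" if a: "a \<in> Sp" and b: "b \<in> Sp" for a b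
  proof
    fix x
    show "\<phi> (a \<cdot> b) x = amul E (\<phi> a) (\<phi> b) x"
    proof (cases "x \<in> carrier G")
      case x: True
      let ?a = "hom_part G Gr a" and ?b = "hom_part G Gr b"
      have "a \<cdot> b = (\<Sum>f\<in>carrier G. ?a f \<cdot> b)" using V.linear_on_hom_parts[OF linear_left[OF b] a] .
      then have "\<phi> (a \<cdot> b) x = (\<Sum>f\<in>carrier G. \<phi> (?a f \<cdot> b) x)" using hp a b by (simp add: sum_\<phi>)
      also have "\<dots> = (\<Sum>f\<in>carrier G. \<Sum>g\<in>carrier G. \<phi> (?a f \<cdot> ?b g) x)"
      proof (rule sum.cong[OF refl])
        fix f assume f: "f \<in> carrier G"
        have "?a f \<cdot> b = (\<Sum>g\<in>carrier G. ?a f \<cdot> ?b g)"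
          using V.linear_on_hom_parts[OF linear_right[OF hp(2)[OF a f]] b] .
        then show "\<phi> (?a f \<cdot> b) x = (\<Sum>g\<in>carrier G. \<phi> (?a f \<cdot> ?b g) x)" using hp a b f by (simp add: sum_\<phi>)
      qed
      also have "\<dots> = amul E (\<phi> a) (\<phi> b) x"
        using \<phi>_mul_hom hp a b x by (simp add: E_mul hom_part_\<phi>)
      finally show ?thesis .
    qed (simp add: \<phi>_outside E_mul)
  qed
  moreover have "\<phi> unit = aunit E"
  proof
    fix x
    \<comment> \<open>Holds because \<open>p \<cdot> unit = p = u \<one>\<close>, by the
      normalisation of \<open>u\<close>.\<close>
    have "\<kappa> \<one> unit = 1" by (rule \<kappa>_eqI[OF stab_one]) simp
    then show "\<phi> unit x = aunit E x"
      using \<phi>_hom[OF one_closed unit_Gr, of x] stab_one by (cases "x \<in> carrier G") (simp_all add: E_unit \<phi>_outside)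
  qed
  ultimately show ?thesis unfolding alg_isomorphic_def using hom bij by blast
qed

end

theorem corollary3p21:
  fixes G :: "('g, 'z) monoid_scheme"
    and \<alpha> :: "'g \<Rightarrow> 'g \<Rightarrow> 'g \<Rightarrow> 'k::{alg_closed_field, field_char_0}"
    and L :: "('g, 'k, 'v::ab_group_add) zalg"
  assumes "group G" and "finite (carrier G)"
    and "normalised_3cocycle G \<alpha>"
    and "lagrangian G \<alpha> L"
  shows "\<exists>H \<gamma>. subgroup H G \<and> normalised_2cochain G H \<gamma> \<and>
    (\<forall>f\<in>H. \<forall>g\<in>H. \<forall>h\<in>H. coboundary G \<gamma> f g h = \<alpha> f g h) \<and>
    alg_isomorphic G L (L_alg G \<alpha> H \<gamma>)"
proof -
  have "etale G \<alpha> L" using assms(4) by (simp add: lagrangian_def)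
  then interpret etale_algebra G \<alpha> L
    using assms(1-3)
    by (simp add: etale_def etale_algebra_def etale_algebra_axioms_def comm_graded_algebra_def
        comm_graded_algebra_axioms_def graded_algebra_def graded_algebra_axioms_def group_cocycle_def
        group_cocycle_axioms_def)
  obtain p where p: "p \<in> grd L \<one>\<^bsub>G\<^esub>" "p \<noteq> 0" "amul L p p = p"
    "\<And>a. a \<in> grd L \<one>\<^bsub>G\<^esub> \<Longrightarrow> \<exists>c. amul L p a = scal L c p"
    using primitive_idempotent by blast
  interpret etale_point G \<alpha> L p by unfold_locales (use p in auto)
  interpret lagrangian_point G \<alpha> L p by unfold_locales (use stab_eq_supp assms(4) in simp)
  show ?thesis
    using subgroup_stab \<gamma>_cochain \<gamma>_coboundary alg_isomorphic_E by blast
qed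

end
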